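(* Let $n\in\mathbb N$. There exist a polynomial $Q_2$ of degree $2^n-1$ and $\mu_2>0$ such that $$S_n(x):=\sum_{1\le m_1,\dots,m_n\le x}\frac1{\operatorname{lcm}(m_1,\dots,m_n)}=Q_2(\ln x)+O(x^{-\mu_2})\quad\text{as }x\to\infty.$$ In particular, $$S_n(x)=C_n(s_n)\,K_n(s_n,\|\cdot\|_\infty)\,(\ln x)^{2^n-1}+O\big((\ln x)^{2^n-2}\big)\quad\text{as }x\to\infty,$$ where $$C_n(s_n):=\prod_p\Big(1-\frac1p\Big)^{2^n-1}\Big(\sum_{k=0}^\infty\frac{(k+1)^n-k^n}{p^k}\Big)>0$$ (product over primes $p$) and $$K_n(s_n,\|\cdot\|_\infty):=\lim_{x\to\infty}\mathcal I_n(I,\mathbf u,\mathbf c;x)\,(\ln x)^{-2^n+1}>0,$$ where $\mathcal I_n(I,\mathbf u,\mathbf c;x)$ is the integral associated with $I=\{0,1\}^n\setminus\{\mathbf 0\}$, the sequence $\mathbf u=(u(\boldsymbol\nu))_{\boldsymbol\nu\in I}$ defined by $u(\boldsymbol\nu)=1$ for all $\boldsymbol\nu\in I$, and the vector $\mathbf c=\mathbf 0$.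
   Context: $\mathbb N=\{1,2,\dots\}$, $\mathbb N_0=\mathbb N\cup\{0\}$; $\langle\cdot,\cdot\rangle$ is the standard inner product, $(\mathbf e_1,\dots,\mathbf e_n)$ the canonical basis of $\mathbb R^n$, $\mathbf 0=(0,\dots,0)$. Here $s_n$ denotes the function $s_n(m_1,\dots,m_n)=1/\operatorname{lcm}(m_1,\dots,m_n)$ (it only serves as a label in $C_n(s_n)$ and $K_n(s_n,\|\cdot\|_\infty)$). The integral $\mathcal I_n$: let $I$ be a finite subset of $\mathbb N_0^n\setminus\{\mathbf 0\}$ with elements $\boldsymbol\nu^1,\dots,\boldsymbol\nu^r$ ($r=\#I$), $\mathbf u=(u(\boldsymbol\nu))_{\boldsymbol\nu\in I}$ positive integers, $\mathbf c\in[0,\infty)^n$. Put $q_0=0$ and $q_k=\sum_{j=1}^k u(\boldsymbol\nu^j)$ for $1\le k\le r$. For $x>0$, $$\mathcal I_n(I,\mathbf u,\mathbf c;x):=\int_{\mathcal A(I,\mathbf u;x)}\frac{dy_1\cdots dy_{q_r}}{\prod_{k=1}^r\prod_{\ell=q_{k-1}+1}^{q_k}y_\ell^{1-\langle\boldsymbol\nu^k,\mathbf c\rangle}},$$ where $\mathcal A(I,\mathbf u;x):=\{\mathbf y\in[1,\infty)^{q_r}:\ \prod_{k=1}^r\prod_{\ell=q_{k-1}+1}^{q_k}y_\ell^{\langle\boldsymbol\nu^k,\mathbf e_j\rangle}\le x\ \ \forall j=1,\dots,n\}$. *)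

theory Defs
  imports "HOL-Analysis.Analysis" "HOL-Computational_Algebra.Computational_Algebra"
    "HOL-Library.Landau_Symbols"
begin

text \<open>
  Vectors of dimension \<open>n\<close> are extensional functions on \<open>{1..n}\<close>, so that the dimension is an
  ordinary natural number.
\<close>

definition zero_vec :: "nat \<Rightarrow> nat \<Rightarrow> 'a::zero"
  where "zero_vec n = (\<lambda>_\<in>{1..n}. 0)"

definition inner_vec :: "nat \<Rightarrow> (nat \<Rightarrow> real) \<Rightarrow> (nat \<Rightarrow> real) \<Rightarrow> real"
  where "inner_vec n v w = (\<Sum>j=1..n. v j * w j)"

definition lcm_sum :: "nat \<Rightarrow> real \<Rightarrow> real"
  where "lcm_sum n x =
    (\<Sum>m \<in> {1..n} \<rightarrow>\<^sub>E {k::nat. 1 \<le> k \<and> real k \<le> x}. 1 / real (Lcm (m ` {1..n})))"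

text \<open>
  In the next three definitions, \<open>I\<close> is a finite set of non-zero vectors of natural numbers,
  \<open>\<nu> 1, \<dots>, \<nu> (card I)\<close> is an enumeration of \<open>I\<close> without repetition, and \<open>u\<close> is positive on \<open>I\<close>.
  The \<open>u (\<nu> k)\<close> integration variables attached to \<open>\<nu> k\<close> have the indices
  \<open>block_end \<nu> u (k - 1) + 1, \<dots>, block_end \<nu> u k\<close>.
\<close>

definition block_end :: "(nat \<Rightarrow> nat \<Rightarrow> nat) \<Rightarrow> ((nat \<Rightarrow> nat) \<Rightarrow> nat) \<Rightarrow> nat \<Rightarrow> nat"
  where "block_end \<nu> u k = (\<Sum>j=1..k. u (\<nu> j))"

text \<open>The exponent \<open>\<nu> k j\<close> is the inner product of \<open>\<nu> k\<close> with the \<open>j\<close>-th canonical basis vector.\<close>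

definition int_region ::
    "nat \<Rightarrow> (nat \<Rightarrow> nat) set \<Rightarrow> (nat \<Rightarrow> nat \<Rightarrow> nat) \<Rightarrow> ((nat \<Rightarrow> nat) \<Rightarrow> nat) \<Rightarrow> real \<Rightarrow> (nat \<Rightarrow> real) set"
  where "int_region n I \<nu> u x =
    {y \<in> {1..block_end \<nu> u (card I)} \<rightarrow>\<^sub>E {1..}.
      \<forall>j\<in>{1..n}.
        (\<Prod>k=1..card I. \<Prod>l\<in>{block_end \<nu> u (k - 1) + 1..block_end \<nu> u k}. y l ^ \<nu> k j) \<le> x}"

definition region_integral ::
    "nat \<Rightarrow> (nat \<Rightarrow> nat) set \<Rightarrow> (nat \<Rightarrow> nat \<Rightarrow> nat) \<Rightarrow> ((nat \<Rightarrow> nat) \<Rightarrow> nat) \<Rightarrow> (nat \<Rightarrow> real) \<Rightarrow> real \<Rightarrow> real"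
  where "region_integral n I \<nu> u c x =
    (LINT y : int_region n I \<nu> u x | Pi\<^sub>M {1..block_end \<nu> u (card I)} (\<lambda>_. lborel).
      1 / (\<Prod>k=1..card I. \<Prod>l\<in>{block_end \<nu> u (k - 1) + 1..block_end \<nu> u k}.
             y l powr (1 - inner_vec n (\<lambda>j. real (\<nu> k j)) c)))"

definition bin_vecs :: "nat \<Rightarrow> (nat \<Rightarrow> nat) set"
  where "bin_vecs n = ({1..n} \<rightarrow>\<^sub>E {0, 1}) - {zero_vec n}"

text \<open>
  The normalised integral whose limit is \<open>K_const\<close>. It depends on the enumeration \<open>\<nu>\<close> of
  \<open>bin_vecs n\<close> only through the naming of the integration variables.
\<close>

definition K_ratio :: "nat \<Rightarrow> (nat \<Rightarrow> nat \<Rightarrow> nat) \<Rightarrow> real \<Rightarrow> real"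
  where "K_ratio n \<nu> x =
    region_integral n (bin_vecs n) \<nu> (\<lambda>_. 1) (zero_vec n) x * ln x powi (- (2 ^ n) + 1)"

definition K_const :: "nat \<Rightarrow> (nat \<Rightarrow> nat \<Rightarrow> nat) \<Rightarrow> real"
  where "K_const n \<nu> = Lim at_top (K_ratio n \<nu>)"

definition euler_term :: "nat \<Rightarrow> nat \<Rightarrow> nat \<Rightarrow> real"
  where "euler_term n p k = (real (k + 1) ^ n - real k ^ n) / real p ^ k"

definition euler_factor :: "nat \<Rightarrow> nat \<Rightarrow> real"
  where "euler_factor n p =
    (if prime p then (1 - 1 / real p) ^ (2 ^ n - 1) * (\<Sum>k. euler_term n p k) else 1)"

definition C_const :: "nat \<Rightarrow> real"
  where "C_const n = (\<Prod>p. euler_factor n p)"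

end

theory Submission
  imports Defs
begin

text \<open>
  Write \<open>1 / lcm\<close> as a convolution \<open>eta * g\<close> in \<open>n\<close> variables, where the Dirichlet series of \<open>g\<close> is the
  product of \<open>zeta(1 + \<Sum>j\<in>S. s\<^sub>j)\<close> over the non-empty \<open>S \<subseteq> {1..n}\<close> and \<open>eta\<close> has an Euler product that
  converges absolutely beyond the origin. This leaves the sums \<open>T\<close> of \<open>\<Prod>S. 1 / d\<^sub>S\<close> over the positive
  integers \<open>d\<^sub>S\<close> with \<open>ln h\<^sub>j + (\<Sum>S\<ni>j. ln d\<^sub>S) \<le> L = ln x\<close> for all \<open>j\<close>.

  Fix \<open>D\<close>. Replacing each summation over \<open>d\<^sub>S > D\<close> by an integral changes \<open>T\<close> only by a factor
  \<open>1 + O(1 / D)\<close> and a shift of \<open>L\<close> by \<open>O(1 / D)\<close>, because all functions involved are monotone. The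
  hybrid obtained in this way is a finite combination of volumes of polytopes
  \<open>{t \<ge> 0. \<forall>j. (\<Sum>S\<ni>j. t\<^sub>S) \<le> L - a\<^sub>j}\<close>. Such a volume is a piecewise polynomial function whose pieces
  are polyhedral cones in \<open>(L - a\<^sub>j)\<^sub>j\<close>, so it is a polynomial in \<open>L\<close> as soon as \<open>L\<close> exceeds a constant
  multiple of \<open>max a\<^sub>j\<close>. Hence the sum in question is within a power of \<open>1 / D\<close> of a polynomial
  \<open>P\<^sub>D(L)\<close> whenever \<open>L\<close> lies between fixed multiples of \<open>ln D\<close>. Comparing \<open>P\<^sub>D\<close> with
  \<open>P\<^sub>2\<^sub>D\<close> shows that these polynomials, whose degrees are bounded, converge fast enough to a single
  polynomial.

  The leading coefficient comes from comparing the sum directly with the integral: it is the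
  product of \<open>\<Sum>eta\<close>, which is the Euler product \<open>C_const n\<close>, and of the volume of the polytope for
  \<open>L = 1\<close> and \<open>a = 0\<close>.
\<close>


section \<open>Piecewise polynomial functions\<close>

text \<open>Replacing all sums by integrals at once costs a relative error of order 1/L, because
  small \<open>d\<close> are badly approximated; only the leading term survives that. With
  \<open>d \<le> D\<close> kept exact the loss is O(1/D), and the price is that the hybrid is a
  polynomial in \<open>L\<close> only beyond a threshold. Since the pieces of the volume are cones,
  this threshold is linear in the offsets, hence of order ln D. So \<open>D\<close> may be a small
  power of x, and O(1/D) becomes a power saving in x.

  The polynomial obtained depends on \<open>D\<close> and has no useful closed form. A limit exists
  because polynomials of bounded degree that are close on an interval of length 1 are close on all
  smaller arguments, up to a power of the distance, and a power of ln D is harmless against a power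
  of D.

  Sums, integrals and hybrids are treated as one iterated operator on antitone functions with values
  in \<open>ennreal\<close>. Each comparison is then needed in one variable only, and measurability
  comes from monotonicity.\<close>

definition lin :: "nat set \<Rightarrow> (nat \<Rightarrow> real) \<Rightarrow> (nat \<Rightarrow> real) \<Rightarrow> real"
  where "lin N c w = (\<Sum>j\<in>N. c j * w j)"

inductive pwpoly :: "nat set \<Rightarrow> ((nat \<Rightarrow> real) \<Rightarrow> real) \<Rightarrow> bool" for N where
  const: "pwpoly N (\<lambda>_. c)"
| coord: "j \<in> N \<Longrightarrow> pwpoly N (\<lambda>w. w j)"
| add: "pwpoly N f \<Longrightarrow> pwpoly N g \<Longrightarrow> pwpoly N (\<lambda>w. f w + g w)"
| mult: "pwpoly N f \<Longrightarrow> pwpoly N g \<Longrightarrow> pwpoly N (\<lambda>w. f w * g w)"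
| ind: "pwpoly N (\<lambda>w. if 0 \<le> lin N c w then 1 else 0)"

lemma pwpoly_sum: "finite A \<Longrightarrow> (\<And>i. i \<in> A \<Longrightarrow> pwpoly N (f i)) \<Longrightarrow> pwpoly N (\<lambda>w. \<Sum>i\<in>A. f i w)"
  by (induction A rule: finite_induct) (simp_all add: pwpoly.const pwpoly.add)

lemma pwpoly_uminus: "pwpoly N f \<Longrightarrow> pwpoly N (\<lambda>w. - f w)"
  using pwpoly.mult[OF pwpoly.const[of N "-1"]] by simp

lemma pwpoly_diff: "pwpoly N f \<Longrightarrow> pwpoly N g \<Longrightarrow> pwpoly N (\<lambda>w. f w - g w)"
  using pwpoly.add[OF _ pwpoly_uminus] by fastforce

lemma pwpoly_power: "pwpoly N f \<Longrightarrow> pwpoly N (\<lambda>w. f w ^ k)"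
  by (induction k) (simp_all add: pwpoly.const pwpoly.mult)

lemma pwpoly_lin: "finite N \<Longrightarrow> pwpoly N (lin N c)"
  unfolding lin_def by (intro pwpoly_sum pwpoly.intros)

lemma lin_diff: "lin N (\<lambda>j. c j - d j) w = lin N c w - lin N d w"
  by (simp add: lin_def algebra_simps sum_subtractf)

lemma pwpoly_le: "pwpoly N (\<lambda>w. if lin N c w \<le> lin N d w then 1 else 0)"
  using pwpoly.ind[of N "\<lambda>j. d j - c j"] by (simp add: lin_diff)

lemma pwpoly_ball:
  "finite A \<Longrightarrow> (\<And>a. a \<in> A \<Longrightarrow> pwpoly N (\<lambda>w. if P a w then 1 else 0)) \<Longrightarrow>
    pwpoly N (\<lambda>w. if \<forall>a\<in>A. P a w then 1 else 0)"
proof (induction A rule: finite_induct)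
  case (insert a A)
  have "pwpoly N (\<lambda>w. (if P a w then 1 else 0) * (if \<forall>a\<in>A. P a w then 1 else 0))"
    using insert by (intro pwpoly.mult) auto
  moreover have "(\<lambda>w. (if P a w then 1 else 0) * (if \<forall>a\<in>A. P a w then 1 else 0)) =
      (\<lambda>w. if \<forall>a\<in>insert a A. P a w then 1 else (0::real))" by auto
  ultimately show ?case by simp
qed (simp add: pwpoly.const)

lemma pwpoly_if:
  assumes "pwpoly N (\<lambda>w. if P w then 1 else 0)" "pwpoly N f" "pwpoly N g"
  shows "pwpoly N (\<lambda>w. if P w then f w else g w)"
proof -
  have "pwpoly N (\<lambda>w. (if P w then 1 else 0) * f w + (1 - (if P w then 1 else 0)) * g w)"
    using assms by (intro pwpoly.add pwpoly.mult pwpoly_diff pwpoly.const) auto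
  moreover have "(\<lambda>w. (if P w then 1 else 0) * f w + (1 - (if P w then 1 else 0)) * g w) =
    (\<lambda>w. if P w then f w else g w)" by auto
  ultimately show ?thesis by simp
qed

lemma pwpoly_Max_lin:
  assumes N: "finite N"
  shows "finite A \<Longrightarrow> A \<noteq> {} \<Longrightarrow> pwpoly N (\<lambda>w. Max ((\<lambda>\<alpha>. lin N \<alpha> w) ` A))"
proof (induction A rule: finite_ne_induct)
  case (singleton x)
  then show ?case using pwpoly_lin[OF N] by simp
next
  case (insert a A)
  have "pwpoly N (\<lambda>w. if \<forall>\<alpha>\<in>A. lin N \<alpha> w \<le> lin N a w then lin N a w else Max ((\<lambda>\<alpha>. lin N \<alpha> w) ` A))"
    using insert pwpoly_lin[OF N] by (intro pwpoly_if[OF pwpoly_ball[OF _ pwpoly_le]]) auto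
  moreover have "(\<lambda>w. if \<forall>\<alpha>\<in>A. lin N \<alpha> w \<le>
    lin N a w then lin N a w else Max ((\<lambda>\<alpha>. lin N \<alpha> w) ` A)) =
      (\<lambda>w. Max ((\<lambda>\<alpha>. lin N \<alpha> w) ` insert a A))"
  proof (intro ext)
    fix w
    have "Max ((\<lambda>\<alpha>. lin N \<alpha> w) ` insert a A) = max (lin N a w) (Max ((\<lambda>\<alpha>. lin N \<alpha> w) ` A))"
      using insert.hyps by simp
    moreover have "(\<forall>\<alpha>\<in>A. lin N \<alpha> w \<le> lin N a w) \<longleftrightarrow> Max ((\<lambda>\<alpha>. lin N \<alpha> w) ` A) \<le> lin N a w"
      using insert.hyps by simp
    ultimately show "(if \<forall>\<alpha>\<in>A. lin N \<alpha> w \<le>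
      lin N a w then lin N a w else Max ((\<lambda>\<alpha>. lin N \<alpha> w) ` A)) =
        Max ((\<lambda>\<alpha>. lin N \<alpha> w) ` insert a A)" by (simp add: max_def)
  qed
  ultimately show ?case by simp
qed

lemma pwpoly_Min_lin:
  assumes N: "finite N" and A: "finite A" "A \<noteq> {}"
  shows "pwpoly N (\<lambda>w. Min ((\<lambda>\<alpha>. lin N \<alpha> w) ` A))"
proof -
  have "Min ((\<lambda>\<alpha>. lin N \<alpha> w) ` A) = - Max ((\<lambda>\<alpha>. lin N \<alpha> w) ` (\<lambda>\<alpha> j. - \<alpha> j) ` A)" for w
    using A by (subst minus_Max_eq_Min) (auto simp: image_image lin_def sum_negf)
  moreover have "pwpoly N (\<lambda>w. - Max ((\<lambda>\<alpha>. lin N \<alpha> w) ` (\<lambda>\<alpha> j. - \<alpha> j) ` A))"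
    using A by (intro pwpoly_uminus pwpoly_Max_lin N) auto
  ultimately show ?thesis by simp
qed

text \<open>Along the diagonal line L -> (L - a j) a linear form is \<open>\<sigma> * L\<close>
  minus a constant of size at most \<open>\<tau> * B\<close>, so its sign no longer changes once
  \<open>L\<close> exceeds \<open>\<tau> * B / \<bar>\<sigma>\<bar>\<close>. Both \<open>C\<close>
  and \<open>d\<close> are chosen before \<open>a\<close> and \<open>B\<close>; this uniformity
  later bounds the degrees independently of \<open>D\<close>.\<close>

lemma pwpoly_diag:
  assumes N: "finite N" and f: "pwpoly N f"
  shows "\<exists>C\<ge>0. \<exists>d. \<forall>a B. (\<forall>j\<in>N. \<bar>a j\<bar> \<le> B) \<longrightarrow> 0 \<le> B \<longrightarrow>
    (\<exists>p. degree p \<le> d \<and> (\<forall>L. C * B < L \<longrightarrow> f (\<lambda>j. L - a j) = poly p L))" (is "?P f")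
proof -
  \<comment> \<open>Sums and products are handled together. The sum of the degrees is crude for
    addition, but it serves both cases.\<close>
  have combine: "?P (\<lambda>w. F (f w) (g w))"
    if IH: "?P f" "?P g" and deg: "\<And>p q. degree (G p q) \<le> degree p + degree q"
      and eval: "\<And>p q x. poly (G p q) x = F (poly p x) (poly q x)"
        for f g F and G :: "real poly \<Rightarrow> _"
  proof -
    obtain C1 d1 where C1: "C1 \<ge> 0" "\<And>a B. (\<forall>j\<in>N. \<bar>a j\<bar> \<le> B) \<Longrightarrow> 0 \<le> B \<Longrightarrow>
      (\<exists>p. degree p \<le> d1 \<and> (\<forall>L. C1 * B < L \<longrightarrow> f (\<lambda>j. L - a j) = poly p L))" using IH(1) by metis
    obtain C2 d2 where C2: "C2 \<ge> 0" "\<And>a B. (\<forall>j\<in>N. \<bar>a j\<bar> \<le> B) \<Longrightarrow> 0 \<le> B \<Longrightarrow>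
      (\<exists>p. degree p \<le> d2 \<and> (\<forall>L. C2 * B < L \<longrightarrow> g (\<lambda>j. L - a j) = poly p L))" using IH(2) by metis
    show ?thesis
    proof (intro exI[of _ "max C1 C2"] conjI exI[of _ "d1 + d2"] allI impI)
      fix a :: "nat \<Rightarrow> real" and B :: real assume a: "\<forall>j\<in>N. \<bar>a j\<bar> \<le> B" and B: "0 \<le> B"
      obtain p where p: "degree p \<le> d1" "\<And>L. C1 * B < L \<Longrightarrow> f (\<lambda>j. L - a j) = poly p L"
        using C1(2)[OF a B] by blast
      obtain q where q: "degree q \<le> d2" "\<And>L. C2 * B < L \<Longrightarrow> g (\<lambda>j. L - a j) = poly q L"
        using C2(2)[OF a B] by blast
      have "C1 * B \<le> max C1 C2 * B" "C2 * B \<le> max C1 C2 * B" using B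
        by (auto intro!: mult_right_mono)
      then show "\<exists>p. degree p \<le> d1 + d2 \<and>
         (\<forall>L. max C1 C2 * B < L \<longrightarrow> F (f (\<lambda>j. L - a j)) (g (\<lambda>j. L - a j)) = poly p L)"
        using p q order.trans[OF deg add_mono[OF p(1) q(1)]]
          by (intro exI[of _ "G p q"]) (auto simp: eval)
    qed (use C1 in auto)
  qed
  show ?thesis using f
proof (induction rule: pwpoly.induct)
  case (const c)
  show ?case
    by (intro exI[of _ "0::real"] exI[of _ "0::nat"] conjI allI impI exI[of _ "[:c:]"]) auto
next
  case (coord j)
  have "\<exists>p. degree p \<le> 1 \<and> (\<forall>L. 0 * B < L \<longrightarrow> L - a j = poly p L)"
    for a :: "nat \<Rightarrow> real" and B :: real
    by (intro exI[of _ "[:- a j, 1:]"]) auto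
  then show ?case
    by (intro exI[of _ "0::real"] conjI[OF order.refl] exI[of _ "1::nat"] allI impI)
next
  case (add f g)
  show ?case
    by (rule combine[OF add.IH, of "(+)" "(+)"]) (auto intro: order.trans[OF degree_add_le_max])
next
  case (mult f g)
  show ?case
    by (rule combine[OF mult.IH, of "(*)" "(*)"]) (auto intro: order.trans[OF degree_mult_le])
next
  case (ind c)
  define \<sigma> where "\<sigma> = (\<Sum>j\<in>N. c j)"
  define \<tau> where "\<tau> = (\<Sum>j\<in>N. \<bar>c j\<bar>)"
  have tau: "\<tau> \<ge> 0" by (auto simp: \<tau>_def intro: sum_nonneg)
  show ?case
  \<comment> \<open>For \<open>\<sigma> = 0\<close> this quotient is 0, and the indicator is then
    constant along the whole line, so any threshold works.\<close>
  proof (intro exI[of _ "\<tau> / \<bar>\<sigma>\<bar>"] conjI exI[of _ "0::nat"] allI impI)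
    fix a :: "nat \<Rightarrow> real" and B :: real assume a: "\<forall>j\<in>N. \<bar>a j\<bar> \<le> B" and B: "0 \<le> B"
    have eq: "lin N c (\<lambda>j. L - a j) = \<sigma> * L - lin N c a" for L
      by (simp add: lin_def \<sigma>_def algebra_simps sum_subtractf sum_distrib_left)
    have "\<bar>lin N c a\<bar> \<le> (\<Sum>j\<in>N. \<bar>c j\<bar> * B)"
      unfolding lin_def using a by (intro order.trans[OF sum_abs] sum_mono) (auto simp: abs_mult intro: mult_left_mono)
    also have "\<dots> = \<tau> * B" by (simp add: \<tau>_def sum_distrib_right)
    finally have bd: "\<bar>lin N c a\<bar> \<le> \<tau> * B" .
    consider "\<sigma> = 0" | "\<sigma> > 0" | "\<sigma> < 0" by linarith
    then show "\<exists>p. degree p \<le> 0 \<and> (\<forall>L. \<tau> / \<bar>\<sigma>\<bar> * B < L \<longrightarrow>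
        (if 0 \<le> lin N c (\<lambda>j. L - a j) then 1 else 0) = poly p L)"
    proof cases
      case 1
      then show ?thesis by (intro exI[of _ "[:if 0 \<le> - lin N c a then 1 else 0:]"]) (auto simp: eq)
    next
      case 2
      then have "0 \<le> lin N c (\<lambda>j. L - a j)" if "\<tau> / \<bar>\<sigma>\<bar> * B < L" for L
        using that bd unfolding eq by (simp add: field_simps)
      then show ?thesis by (intro exI[of _ "[:1:]"]) auto
    next
      case 3
      then have "\<not> 0 \<le> lin N c (\<lambda>j. L - a j)" if "\<tau> / \<bar>\<sigma>\<bar> * B < L" for L
        using that bd unfolding eq by (simp add: field_simps)
      then show ?thesis by (intro exI[of _ 0]) auto
    qed
  qed (use tau in auto)
qed
qed

section \<open>Integrating out one variable\<close>

definition shift :: "(nat \<Rightarrow> real) \<Rightarrow> nat set \<Rightarrow> real \<Rightarrow> nat \<Rightarrow> real"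
  where "shift l s t = (\<lambda>j. if j \<in> s then l j - t else l j)"

text \<open>For fixed \<open>w\<close> these are combinations of monomials in \<open>t\<close>, cut
  off to intervals whose end points are linear forms in \<open>w\<close>: a shape that is closed
  under products and has an explicit integral over \<open>t\<close>.\<close>

inductive slice_poly :: "nat set \<Rightarrow> ((nat \<Rightarrow> real) \<Rightarrow> real \<Rightarrow> real) \<Rightarrow> bool" for N where
  base: "pwpoly N c \<Longrightarrow> finite A \<Longrightarrow> finite B \<Longrightarrow>
    slice_poly N (\<lambda>w t. c w * t ^ k * (if (\<forall>\<alpha>\<in>A. lin N \<alpha> w \<le> t) \<and> (\<forall>\<beta>\<in>B. t \<le>
      lin N \<beta> w) then 1 else 0))"
| add: "slice_poly N f \<Longrightarrow> slice_poly N g \<Longrightarrow> slice_poly N (\<lambda>w t. f w t + g w t)"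

lemma slice_poly_mult:
  assumes f: "slice_poly N f" and g: "slice_poly N g"
  shows "slice_poly N (\<lambda>w t. f w t * g w t)"
  using f
proof (induction rule: slice_poly.induct)
  case (base c A B k)
  note 1 = this
  show ?case using g
  proof (induction rule: slice_poly.induct)
    case (base d A' B' k')
    have "slice_poly N (\<lambda>w t. (c w * d w) * t ^ (k + k') *
      (if (\<forall>\<alpha>\<in>A \<union> A'. lin N \<alpha> w \<le> t) \<and> (\<forall>\<beta>\<in>B \<union> B'. t \<le> lin N \<beta> w) then 1 else 0))"
      using 1 base by (intro slice_poly.base pwpoly.mult) auto
    then show ?case by (rule back_subst[of "slice_poly N"]) (auto simp: fun_eq_iff power_add)
  next
    case (add f g)
    then show ?case using slice_poly.add[OF add.IH] by (simp add: algebra_simps)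
  qed
next
  case (add f1 f2)
  then show ?case using slice_poly.add[OF add.IH] by (simp add: algebra_simps)
qed

lemma slice_poly_pwpoly: "pwpoly N c \<Longrightarrow> slice_poly N (\<lambda>w t. c w)"
  using slice_poly.base[of N c "{}" "{}" 0] by simp

lemma slice_poly_const_t: "slice_poly N (\<lambda>w t. a * t)"
  using slice_poly.base[OF pwpoly.const[of N a], of "{}" "{}" 1] by simp

lemma lin_shift: "lin N c (shift w s t) = lin N c w - t * lin N c (\<lambda>j. if j \<in> s then 1 else 0)"
  unfolding lin_def sum_distrib_left sum_subtractf[symmetric]
  by (intro sum.cong refl) (simp add: shift_def algebra_simps)

lemma lin_divide: "lin N (\<lambda>j. c j / a) w = lin N c w / a"
  by (simp add: lin_def sum_divide_distrib)

text \<open>After the shift a linear form is affine in \<open>t\<close> with slope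
  \<open>- \<sigma>\<close>. According to the sign of \<open>\<sigma>\<close>, its half-space
  becomes an upper bound, a lower bound or no condition on \<open>t\<close>, and the bound is the
  linear form with coefficients \<open>c j / \<sigma>\<close>.\<close>

lemma pwpoly_imp_slice_poly:
  assumes "pwpoly N f"
  shows "slice_poly N (\<lambda>w t. f (shift w s t))"
  using assms
proof (induction rule: pwpoly.induct)
  case (const c)
  then show ?case by (intro slice_poly_pwpoly pwpoly.const)
next
  case (coord j)
  show ?case
  proof (cases "j \<in> s")
    case True
    have "slice_poly N (\<lambda>w t. w j + (-1) * t)"
      using coord by (intro slice_poly.add slice_poly_pwpoly slice_poly_const_t pwpoly.coord)
    then show ?thesis using True by (simp add: shift_def)
  next
    case False
    then show ?thesis using coord by (auto simp: shift_def intro: slice_poly_pwpoly pwpoly.coord)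
  qed
next
  case (ind c)
  define \<sigma> where "\<sigma> = lin N c (\<lambda>j. if j \<in> s then 1 else 0)"
  have eq: "lin N c (shift w s t) = lin N c w - t * \<sigma>" for w t by (simp add: lin_shift \<sigma>_def)
  consider "\<sigma> = 0" | "\<sigma> > 0" | "\<sigma> < 0" by linarith
  then show ?case
  proof cases
    case 1
    then show ?thesis unfolding eq using slice_poly_pwpoly[OF pwpoly.ind[of N c]] by simp
  next
    case 2
    have "slice_poly N (\<lambda>w t. 1 * t ^ 0 * (if (\<forall>\<alpha>\<in>{}. lin N \<alpha> w \<le> t) \<and> (\<forall>\<beta>\<in>{\<lambda>j. c j / \<sigma>}. t \<le>
      lin N \<beta> w) then 1 else 0))"
      by (intro slice_poly.base pwpoly.const) auto
    then show ?thesis using 2 by (rule_tac back_subst[of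
      "slice_poly N"]) (auto simp: fun_eq_iff eq lin_divide field_simps)
  next
    case 3
    have "slice_poly N (\<lambda>w t. 1 * t ^ 0 * (if (\<forall>\<alpha>\<in>{\<lambda>j. c j / \<sigma>}. lin N \<alpha> w \<le> t) \<and> (\<forall>\<beta>\<in>{}. t \<le>
      lin N \<beta> w) then 1 else 0))"
      by (intro slice_poly.base pwpoly.const) auto
    then show ?thesis using 3 by (rule_tac back_subst[of
      "slice_poly N"]) (auto simp: fun_eq_iff eq lin_divide field_simps)
  qed
next
  case (add f g)
  show ?case by (rule slice_poly.add[OF add.IH])
next
  case (mult f g)
  show ?case by (rule slice_poly_mult[OF mult.IH])
qed

lemma lin_zero: "lin N (\<lambda>_. 0) w = 0" by (simp add: lin_def)

lemma lin_unit: "finite N \<Longrightarrow> j \<in> N \<Longrightarrow> lin N (\<lambda>i. if i = j then 1 else 0) w = w j"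
  by (simp add: lin_def if_distrib[of "\<lambda>x. x * _"] cong: if_cong)

lemma has_bochner_integral_power_Icc:
  fixes a b :: real assumes "a \<le> b"
  shows "has_bochner_integral lborel (\<lambda>t. t ^ k *
    indicator {a..b} t) ((b ^ Suc k - a ^ Suc k) / real (Suc k))"
proof -
  have deriv: "((\<lambda>x. x ^ Suc k / real (Suc k)) has_real_derivative x ^ k) (at x within {a..b})"
    for x
    using DERIV_cdivide[OF DERIV_pow[of "Suc k" x "{a..b}"], of "real (Suc k)"]
    by (simp del: of_nat_Suc power_Suc)
  have "has_bochner_integral lborel (\<lambda>x. indicator {a..b} x *\<^sub>R (x ^ k))
     (b ^ Suc k / real (Suc k) - a ^ Suc k / real (Suc k))"
    using assms deriv by (intro has_bochner_integral_FTC_Icc)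
      (auto intro!: continuous_intros simp: has_real_derivative_iff_has_vector_derivative)
  then show ?thesis by (simp add: mult.commute diff_divide_distrib)
qed

text \<open>The limits 0 and \<open>w j\<close> are linear forms too and join the others, so the
  domain is an interval from a maximum to a minimum of linear forms. Both, and the condition that
  the interval be non-empty, are piecewise polynomial in \<open>w\<close> again.\<close>

lemma slice_poly_integral:
  assumes N: "finite N" "j \<in> N" and h: "slice_poly N h"
  shows "\<exists>F. pwpoly N F \<and>
    (\<forall>w. has_bochner_integral lborel (\<lambda>t. h w t * indicator {0..w j} t) (F w))"
  using h
proof (induction rule: slice_poly.induct)
  case (base c A B k)
  define A' where "A' = insert (\<lambda>_. 0) A"
  define B' where "B' = insert (\<lambda>i. if i = j then 1 else 0) B"
  define lo where "lo = (\<lambda>w. Max ((\<lambda>\<alpha>. lin N \<alpha> w) ` A'))"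
  define up where "up = (\<lambda>w. Min ((\<lambda>\<alpha>. lin N \<alpha> w) ` B'))"
  have AB: "finite A'" "finite B'" "A' \<noteq> {}" "B' \<noteq> {}" using base by (auto simp: A'_def B'_def)
  have le: "lo w \<le> up w \<longleftrightarrow> (\<forall>\<alpha>\<in>A'. \<forall>\<beta>\<in>B'. lin N \<alpha> w \<le> lin N \<beta> w)" for w
    using AB by (auto simp: lo_def up_def)
  \<comment> \<open>The case distinction matters: for \<open>up w < lo w\<close> the primitive would
    give a spurious value instead of 0.\<close>
  define F where "F = (\<lambda>w. if lo w \<le>
    up w then c w * ((up w ^ Suc k - lo w ^ Suc k) * (1 / real (Suc k))) else 0)"
  have "pwpoly N F"
    unfolding F_def le unfolding lo_def up_def using AB base N
    by (intro pwpoly_if[OF pwpoly_ball[OF _ pwpoly_ball[OF _ pwpoly_le]]] pwpoly.mult pwpoly.const pwpoly_diff pwpoly_power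
        pwpoly_Max_lin pwpoly_Min_lin) auto
  moreover have "has_bochner_integral lborel (\<lambda>t. c w * t ^ k *
       (if (\<forall>\<alpha>\<in>A. lin N \<alpha> w \<le> t) \<and> (\<forall>\<beta>\<in>B. t \<le>
         lin N \<beta> w) then 1 else 0) * indicator {0..w j} t) (F w)" for w
  proof -
    have eq: "c w * t ^ k * (if (\<forall>\<alpha>\<in>A. lin N \<alpha> w \<le> t) \<and> (\<forall>\<beta>\<in>B. t \<le>
      lin N \<beta> w) then 1 else 0) * indicator {0..w j} t
      = c w * (t ^ k * indicator {lo w..up w} t)" for t
    proof -
      have "t \<in> {lo w..up w} \<longleftrightarrow> (\<forall>\<alpha>\<in>A'. lin N \<alpha> w \<le> t) \<and> (\<forall>\<beta>\<in>B'. t \<le> lin N \<beta> w)"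
        using AB by (auto simp: lo_def up_def)
      also have "\<dots> \<longleftrightarrow> (\<forall>\<alpha>\<in>A. lin N \<alpha> w \<le> t) \<and> (\<forall>\<beta>\<in>B. t \<le> lin N \<beta> w) \<and> t \<in> {0..w j}"
        using N by (auto simp: A'_def B'_def lin_zero lin_unit)
      finally show ?thesis by (auto simp: indicator_def)
    qed
    show ?thesis
    proof (cases "lo w \<le> up w")
      case True
      then show ?thesis unfolding eq F_def
        using has_bochner_integral_mult_right[OF has_bochner_integral_power_Icc[OF True], of
          "c w" k] by simp
    next
      case False
      then show ?thesis unfolding eq F_def by (simp add: has_bochner_integral_zero)
    qed
  qed
  ultimately show ?case by blast
next
  case (add f g)
  then obtain F G where "pwpoly N F"
    "\<And>w. has_bochner_integral lborel (\<lambda>t. f w t * indicator {0..w j} t) (F w)"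
    "pwpoly N G" "\<And>w. has_bochner_integral lborel (\<lambda>t. g w t * indicator {0..w j} t) (G w)" by metis
  then show ?case
    by (intro exI[of _ "\<lambda>w. F w + G w"] conjI pwpoly.add allI)
       (simp_all add: distrib_right has_bochner_integral_add)
qed

section \<open>Iterated sums and integrals over polytopes\<close>

text \<open>\<open>l j\<close> is the budget left for the j-th constraint. Giving the variable
  attached to \<open>s\<close> the value \<open>t\<close> spends \<open>t\<close> from the budgets
  of all \<open>j \<in> s\<close>, which is what \<open>shift\<close> does, and the innermost term
  tests that no budget is overdrawn. With \<open>\<Phi>\<close> left open, one induction on the list
  serves volumes, lattice sums and hybrids.\<close>

primrec iter :: "((real \<Rightarrow> ennreal) \<Rightarrow> ennreal) \<Rightarrow> nat set \<Rightarrow> nat set list \<Rightarrow> (nat \<Rightarrow> real) \<Rightarrow> ennreal" where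
  "iter \<Phi> N [] l = (if \<forall>j\<in>N. 0 \<le> l j then 1 else 0)"
| "iter \<Phi> N (s # J) l = \<Phi> (\<lambda>t. iter \<Phi> N J (shift l s t))"

text \<open>Index \<open>i\<close> stands for \<open>d = i + 1\<close>. In the variable
  \<open>t = ln y\<close> the measure dy / y, the continuous analogue of the weight 1/d, is Lebesgue
  measure. For \<open>D = 0\<close> only the integral over \<open>t \<ge> 0\<close> is left.\<close>

definition hybrid :: "nat \<Rightarrow> (real \<Rightarrow> ennreal) \<Rightarrow> ennreal"
  where "hybrid D g = (\<Sum>i<D. ennreal (1 / real (Suc i)) * g (ln (real (Suc i)))) +
    (\<integral>\<^sup>+t. g t * indicator {ln (real (Suc D))..} t \<partial>lborel)"

abbreviation "intop \<equiv> hybrid 0"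

definition sumop :: "(real \<Rightarrow> ennreal) \<Rightarrow> ennreal"
  where "sumop g = (\<Sum>i. ennreal (1 / real (Suc i)) * g (ln (real (Suc i))))"

text \<open>Functions are compared on \<open>t \<ge> 0\<close> only. There \<open>shift\<close>
  never raises a budget, so a negative budget stays negative and the iterated value is 0, as stated
  in \<open>iter_eq_0\<close>.\<close>

definition mono_op :: "((real \<Rightarrow> ennreal) \<Rightarrow> ennreal) \<Rightarrow> bool"
  where "mono_op \<Phi> \<longleftrightarrow> (\<forall>g h. (\<forall>t\<ge>0. g t \<le> h t) \<longrightarrow> \<Phi> g \<le> \<Phi> h) \<and> \<Phi> (\<lambda>_. 0) = 0"

lemma intop_eq: "intop g = (\<integral>\<^sup>+t. g t * indicator {0..} t \<partial>lborel)"
  by (simp add: hybrid_def)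

lemma mono_hybrid: "mono_op (hybrid D)"
proof -
  have "hybrid D g \<le> hybrid D h" if "\<forall>t\<ge>0. g t \<le> h t" for g h
    unfolding hybrid_def
  proof (intro add_mono sum_mono nn_integral_mono mult_left_mono)
    show "g t * indicator {ln (real (Suc D))..} t \<le> h t * indicator {ln (real (Suc D))..} t" for t
    proof (cases "ln (real (Suc D)) \<le> t")
      case True
      then have "0 \<le> t" by (rule order.trans[rotated]) simp
      then show ?thesis using that by (intro mult_right_mono) auto
    qed auto
  qed (use that in auto)
  then show ?thesis by (auto simp: mono_op_def hybrid_def)
qed

lemma mono_sumop: "mono_op sumop"
  unfolding mono_op_def sumop_def
  by (auto intro!: suminf_le mult_left_mono)

lemma mono_opD: "mono_op \<Phi> \<Longrightarrow> (\<And>t. 0 \<le> t \<Longrightarrow> g t \<le> h t) \<Longrightarrow> \<Phi> g \<le> \<Phi> h"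
  by (auto simp: mono_op_def)

lemma mono_op_zero: "mono_op \<Phi> \<Longrightarrow> (\<And>t. 0 \<le> t \<Longrightarrow> g t = 0) \<Longrightarrow> \<Phi> g = 0"
  using mono_opD[of \<Phi> g "\<lambda>_. 0"] unfolding mono_op_def by simp

lemma iter_mono:
  assumes "mono_op \<Phi>" "\<And>j. j \<in> N \<Longrightarrow> l j \<le> l' j"
  shows "iter \<Phi> N J l \<le> iter \<Phi> N J l'"
  using assms(2)
proof (induction J arbitrary: l l')
  case Nil
  then show ?case by (auto intro: order.trans)
next
  case (Cons s J)
  show ?case unfolding iter.simps
    by (intro mono_opD[OF assms(1)] Cons.IH) (auto simp: shift_def Cons.prems)
qed

lemma iter_eq_0:
  assumes "mono_op \<Phi>" "j \<in> N" "l j < 0"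
  shows "iter \<Phi> N J l = 0"
  using assms(3)
proof (induction J arbitrary: l)
  case Nil
  then show ?case using assms(2) by (auto simp: not_le)
next
  case (Cons s J)
  show ?case unfolding iter.simps
    by (intro mono_op_zero[OF assms(1)] Cons.IH) (use Cons.prems in \<open>auto simp: shift_def\<close>)
qed

lemma antimono_iter: "mono_op \<Phi> \<Longrightarrow> antimono (\<lambda>t. iter \<Phi> N J (shift l s t))"
  by (intro antimonoI iter_mono) (auto simp: shift_def)

text \<open>Superlevel sets of an antitone function are intervals. Hence every iterated sum or
  integral is measurable in the next variable, with no argument specific to the operator.\<close>

lemma antimono_measurable:
  fixes g :: "real \<Rightarrow> ennreal"
  assumes "antimono g"
  shows "g \<in> borel_measurable borel"
proof (rule borel_measurableI_greater)
  fix y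
  have "is_interval {x. y < g x}"
    unfolding is_interval_1 by (auto intro: less_le_trans antimonoD[OF assms])
  then show "{x \<in> space borel. y < g x} \<in> sets borel"
    using real_interval_borel_measurable by simp
qed

lemma measurable_iter: "mono_op \<Phi> \<Longrightarrow> (\<lambda>t. iter \<Phi> N J (shift l s t)) \<in> borel_measurable borel"
  by (intro antimono_measurable antimono_iter)

text \<open>Replacing \<open>t\<close> by \<open>t - \<eta>\<close> in one variable raises each
  remaining budget by at most \<open>\<eta>\<close>. So the one-variable losses \<open>c\<close> and
  \<open>\<eta>\<close> accumulate to \<open>c ^ length J\<close> and
  \<open>length J * \<eta>\<close>. Scaling is asked for antitone functions only, because for
  \<open>hybrid\<close> it rests on measurability.\<close>

lemma iter_compare:
  assumes op: "mono_op \<Phi>" "mono_op \<Psi>" and "0 \<le> \<eta>"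
    and scale: "\<And>g a. antimono g \<Longrightarrow> \<Psi> (\<lambda>t. a * g t) = a * \<Psi> g"
    and cmp: "\<And>g. antimono g \<Longrightarrow> \<Phi> g \<le> c * \<Psi> (\<lambda>t. g (t - \<eta>))"
  shows "iter \<Phi> N J l \<le> c ^ length J * iter \<Psi> N J (\<lambda>j. l j + real (length J) * \<eta>)"
proof (induction J arbitrary: l)
  case Nil
  show ?case by auto
next
  case (Cons s J)
  let ?k = "length J"
  have "iter \<Phi> N (s # J) l \<le> \<Phi> (\<lambda>t. c ^ ?k * iter \<Psi> N J (\<lambda>j. shift l s t j + real ?k * \<eta>))"
    unfolding iter.simps by (intro mono_opD[OF op(1)] Cons.IH)
  also have am: "antimono (\<lambda>t. iter \<Psi> N J (\<lambda>j. shift l s t j + real ?k * \<eta>))"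
    by (intro antimonoI iter_mono[OF op(2)]) (auto simp: shift_def)
  then have "\<Phi> (\<lambda>t. c ^ ?k * iter \<Psi> N J (\<lambda>j. shift l s t j + real ?k * \<eta>)) \<le>
     c * \<Psi> (\<lambda>t. c ^ ?k * iter \<Psi> N J (\<lambda>j. shift l s (t - \<eta>) j + real ?k * \<eta>))"
    by (intro cmp) (auto intro!: mult_left_mono simp: antimono_def)
  also have "\<Psi> (\<lambda>t. c ^ ?k * iter \<Psi> N J (\<lambda>j. shift l s (t - \<eta>) j + real ?k * \<eta>)) =
      c ^ ?k * \<Psi> (\<lambda>t. iter \<Psi> N J (\<lambda>j. shift l s (t - \<eta>) j + real ?k * \<eta>))"
    using am by (intro scale) (auto simp: antimono_def)
  also have "\<Psi> (\<lambda>t. iter \<Psi> N J (\<lambda>j. shift l s (t - \<eta>) j + real ?k * \<eta>)) \<le>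
      iter \<Psi> N (s # J) (\<lambda>j. l j + real (length (s # J)) * \<eta>)"
    unfolding iter.simps
    by (intro mono_opD[OF op(2)] iter_mono[OF op(2)]) (use assms(3) in \<open>auto simp: shift_def algebra_simps\<close>)
  finally show ?case by (simp add: mult.assoc mult_left_mono)
qed

lemma hybrid_scale:
  assumes "antimono g"
  shows "hybrid D (\<lambda>t. a * g t) = a * hybrid D g"
proof -
  have [measurable]: "g \<in> borel_measurable borel" by (rule antimono_measurable[OF assms])
  have "(\<integral>\<^sup>+t. a * g t * indicator {ln (real (Suc D))..} t \<partial>lborel) =
     (\<integral>\<^sup>+t. a * (g t * indicator {ln (real (Suc D))..} t) \<partial>lborel)" by (simp add: mult.assoc)
  also have "\<dots> = a * (\<integral>\<^sup>+t. g t * indicator {ln (real (Suc D))..} t \<partial>lborel)"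
    by (intro nn_integral_cmult) measurable
  finally show ?thesis by (simp add: hybrid_def distrib_left sum_distrib_left mult.left_commute)
qed

lemma sumop_scale: "sumop (\<lambda>t. a * g t) = a * sumop g"
  unfolding sumop_def by (simp add: mult.left_commute flip: ennreal_suminf_cmult)

section \<open>Monotone comparison of sums with weights 1/d and integrals\<close>

lemma nn_integral_intervals:
  fixes a :: "nat \<Rightarrow> real"
  assumes [measurable]: "g \<in> borel_measurable borel"
    and a: "\<And>i. a i \<le> a (Suc i)" "filterlim a at_top sequentially"
  shows "(\<integral>\<^sup>+t. g t * indicator {a 0..} t \<partial>lborel) =
    (\<Sum>i. \<integral>\<^sup>+t. g t * indicator {a i..<a (Suc i)} t \<partial>lborel)"
proof -
  have inc: "a i \<le> a j" if "i \<le> j" for i j using that a(1) by (rule lift_Suc_mono_le[rotated])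
  have disj: "disjoint_family (\<lambda>i. {a i..<a (Suc i)})"
    unfolding disjoint_family_on_def
  proof (intro ballI impI)
    fix i j :: nat assume "i \<noteq> j"
    then consider "Suc i \<le> j" | "Suc j \<le> i" by linarith
    then show "{a i..<a (Suc i)} \<inter> {a j..<a (Suc j)} = {}"
      by cases (use inc in fastforce)+
  qed
  have un: "(\<Union>i. {a i..<a (Suc i)}) = {a 0..}"
  proof (intro equalityI subsetI)
    fix t assume "t \<in> {a 0..}"
    then have t: "a 0 \<le> t" by simp
    have "\<exists>n. t < a n" using a(2)
      by (metis eventually_sequentially filterlim_at_top_dense order_refl)
    then obtain n where n: "t < a n" "\<And>m. m < n \<Longrightarrow> \<not> t < a m"
      using exists_least_iff[of "\<lambda>n. t < a n"] by auto
    then obtain m where "n = Suc m" using t by (cases n) auto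
    with n have "a m \<le> t" "t < a (Suc m)" by (auto simp: not_less)
    then show "t \<in> (\<Union>i. {a i..<a (Suc i)})" by auto
  next
    fix t assume "t \<in> (\<Union>i. {a i..<a (Suc i)})"
    then obtain i where "a i \<le> t" by auto
    then show "t \<in> {a 0..}" using inc[of 0 i] by simp
  qed
  have "(\<Sum>i. g t * indicator {a i..<a (Suc i)} t) = g t * indicator {a 0..} t" for t
    using suminf_indicator[OF disj, of t] un by simp
  then have "(\<integral>\<^sup>+t. g t * indicator {a 0..} t \<partial>lborel) =
      (\<integral>\<^sup>+t. (\<Sum>i. g t * indicator {a i..<a (Suc i)} t) \<partial>lborel)" by simp
  also have "\<dots> = (\<Sum>i. \<integral>\<^sup>+t. g t * indicator {a i..<a (Suc i)} t \<partial>lborel)"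
    by (intro nn_integral_suminf) measurable
  finally show ?thesis .
qed

lemma nn_integral_interval_const:
  "p \<le> q \<Longrightarrow> (\<integral>\<^sup>+t. y * indicator {p..<q} t \<partial>lborel) = y * ennreal (q - p)" for p q :: real
  by (simp add: nn_integral_cmult_indicator)

lemma nn_integral_interval_le:
  fixes p q :: real
  assumes "p \<le> q" "\<And>t. p \<le> t \<Longrightarrow> t < q \<Longrightarrow> g t \<le> y"
  shows "(\<integral>\<^sup>+t. g t * indicator {p..<q} t \<partial>lborel) \<le> y * ennreal (q - p)"
  unfolding nn_integral_interval_const[OF assms(1), symmetric]
  by (intro nn_integral_mono) (use assms(2) in \<open>auto simp: indicator_def\<close>)

lemma nn_integral_interval_ge:
  fixes p q :: real
  assumes "p \<le> q" "\<And>t. p \<le> t \<Longrightarrow> t < q \<Longrightarrow> y \<le> g t"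
  shows "y * ennreal (q - p) \<le> (\<integral>\<^sup>+t. g t * indicator {p..<q} t \<partial>lborel)"
  unfolding nn_integral_interval_const[OF assms(1), symmetric]
  by (intro nn_integral_mono) (use assms(2) in \<open>auto simp: indicator_def\<close>)

lemma ln_Suc_diff:
  fixes m :: real assumes "m > 0"
  shows "ln (m + 1) - ln m \<le> 1 / m" "1 / (m + 1) \<le> ln (m + 1) - ln m"
proof -
  have "ln (m + 1) - ln m = ln ((m + 1) / m)" using assms by (simp add: ln_div)
  also have "(m + 1) / m = 1 + 1 / m" using assms by (simp add: field_simps)
  also have "ln \<dots> \<le> 1 / m" using assms by (intro ln_add_one_self_le_self) simp
  finally show "ln (m + 1) - ln m \<le> 1 / m" .
  have "ln m - ln (m + 1) = ln (m / (m + 1))" using assms by (simp add: ln_div)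
  also have "m / (m + 1) = 1 - 1 / (m + 1)" using assms by (simp add: field_simps)
  also have "ln \<dots> \<le> - (1 / (m + 1))" using assms ln_le_minus_one[of "1 - 1 / (m + 1)"]
    by (simp add: field_simps)
  finally show "1 / (m + 1) \<le> ln (m + 1) - ln m" by simp
qed

lemma filterlim_ln_Suc: "filterlim (\<lambda>i. ln (real (Suc (D + i)))) at_top sequentially"
  by (rule filterlim_compose[OF ln_at_top], rule filterlim_compose[OF filterlim_real_sequentially],
      rule filterlim_subseq) (auto simp: strict_mono_def)

lemma sumop_split: "sumop g = (\<Sum>i<D. ennreal (1 / real (Suc i)) * g (ln (real (Suc i)))) +
   (\<Sum>i. ennreal (1 / real (Suc (D + i))) * g (ln (real (Suc (D + i)))))"
  unfolding sumop_def by (subst suminf_offset[of _ D]) (auto simp: add.commute)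

text \<open>On the cell from ln m to ln (m + 1) an antitone \<open>g\<close> is at most
  \<open>g (ln m)\<close>, and the length of the cell is at most the weight 1/m.\<close>

lemma hybrid_le_sumop:
  assumes g: "antimono g"
  shows "hybrid D g \<le> sumop g"
proof -
  have [measurable]: "g \<in> borel_measurable borel" by (rule antimono_measurable[OF g])
  have "(\<integral>\<^sup>+t. g t * indicator {ln (real (Suc (D + 0)))..} t \<partial>lborel) =
    (\<Sum>i. \<integral>\<^sup>+t. g t * indicator {ln (real (Suc (D + i)))..<ln (real (Suc (D + Suc i)))} t \<partial>lborel)"
    by (rule nn_integral_intervals) (auto simp: filterlim_ln_Suc simp del: of_nat_Suc)
  also have "\<dots> \<le> (\<Sum>i. ennreal (1 / real (Suc (D + i))) * g (ln (real (Suc (D + i)))))"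
  proof (intro suminf_le allI summableI)
    fix i
    have "(\<integral>\<^sup>+t. g t * indicator {ln (real (Suc (D + i)))..<ln (real (Suc (D +
      Suc i)))} t \<partial>lborel) \<le>
       g (ln (real (Suc (D + i)))) * ennreal (ln (real (Suc (D + Suc i))) - ln (real (Suc (D +
         i))))"
      by (intro nn_integral_interval_le) (auto intro: antimonoD[OF g] simp del: of_nat_Suc)
    also have "\<dots> \<le> g (ln (real (Suc (D + i)))) * ennreal (1 / real (Suc (D + i)))"
      using ln_Suc_diff(1)[of "real (Suc (D + i))"]
      by (intro mult_left_mono ennreal_leI) (auto simp: algebra_simps)
    finally show "(\<integral>\<^sup>+t. g t * indicator {ln (real (Suc (D + i)))..<ln (real (Suc (D +
      Suc i)))} t \<partial>lborel) \<le>
       ennreal (1 / real (Suc (D + i))) * g (ln (real (Suc (D + i))))" by (simp add: mult.commute)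
  qed
  finally show ?thesis unfolding hybrid_def sumop_split[of g D] by (intro add_left_mono) simp
qed

text \<open>For \<open>m > D\<close> the weight 1/m is at most \<open>1 + 1 / (D + 1)\<close> times
  1/(m + 1), hence at most that factor times the length of the cell from ln m to ln (m + 1). That
  length is at most \<open>1 / (D + 1)\<close>, so moving \<open>t\<close> back by this amount
  brings the whole cell to arguments not exceeding ln m, where \<open>g\<close> is at least
  \<open>g (ln m)\<close>.\<close>

lemma sumop_le_hybrid:
  assumes g: "antimono g"
  shows "sumop g \<le> ennreal (1 + 1 / real (Suc D)) * hybrid D (\<lambda>t. g (t - 1 / real (Suc D)))"
proof -
  define c \<eta> where "c = 1 + 1 / real (Suc D)" and "\<eta> = 1 / real (Suc D)"
  have c: "c \<ge> 1" "\<eta> \<ge> 0" by (auto simp: c_def \<eta>_def)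
  have [measurable]: "g \<in> borel_measurable borel" by (rule antimono_measurable[OF g])
  have 1: "(\<Sum>i<D. ennreal (1 / real (Suc i)) * g (ln (real (Suc i)))) \<le>
     ennreal c * (\<Sum>i<D. ennreal (1 / real (Suc i)) * g (ln (real (Suc i)) - \<eta>))"
  proof -
    have "(\<Sum>i<D. ennreal (1 / real (Suc i)) * g (ln (real (Suc i)))) \<le>
      1 * (\<Sum>i<D. ennreal (1 / real (Suc i)) * g (ln (real (Suc i)) - \<eta>))"
      using c by (auto intro!: sum_mono mult_left_mono antimonoD[OF g])
    also have "\<dots> \<le> ennreal c * (\<Sum>i<D. ennreal (1 / real (Suc i)) * g (ln (real (Suc i)) - \<eta>))"
      using c by (intro mult_right_mono) (auto simp flip: ennreal_1 intro: ennreal_leI)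
    finally show ?thesis .
  qed
  have "(\<Sum>i. ennreal (1 / real (Suc (D + i))) * g (ln (real (Suc (D + i))))) \<le>
    (\<Sum>i. ennreal c * (\<integral>\<^sup>+t. g (t - \<eta>) * indicator {ln (real (Suc (D + i)))..<ln (real (Suc (D +
      Suc i)))} t \<partial>lborel))"
  proof (intro suminf_le allI summableI)
    fix i
    define m where "m = real (Suc (D + i))"
    have m: "m > 0" "real (Suc (D + Suc i)) = m + 1" "m \<ge> real (Suc D)" by (auto simp: m_def)
    have "1 / m \<le> c * (1 / (m + 1))"
    proof -
      have "1 + 1 / m \<le> c" unfolding c_def using m by (intro add_left_mono divide_left_mono) auto
      then have "(1 + 1 / m) * (1 / (m + 1)) \<le> c * (1 / (m + 1))" using m
        by (intro mult_right_mono) auto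
      moreover have "(1 + 1 / m) * (1 / (m + 1)) = 1 / m" using m by (simp add: field_simps)
      ultimately show ?thesis by simp
    qed
    also have "\<dots> \<le> c * (ln (m + 1) - ln m)" using ln_Suc_diff(2)[OF m(1)] c
      by (intro mult_left_mono) auto
    finally have "ennreal (1 / m) * g (ln m) \<le> ennreal (c * (ln (m + 1) - ln m)) * g (ln m)"
      by (intro mult_right_mono ennreal_leI) auto
    also have "\<dots> = ennreal c * (g (ln m) * ennreal (ln (m + 1) - ln m))"
      using c m by (simp add: ennreal_mult mult_ac)
    also have "\<dots> \<le> ennreal c * (\<integral>\<^sup>+t. g (t - \<eta>) * indicator {ln m..<ln (m + 1)} t \<partial>lborel)"
    proof (intro mult_left_mono nn_integral_interval_ge antimonoD[OF g])
      fix t assume "ln m \<le> t" "t < ln (m + 1)"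
      moreover have "1 / m \<le> \<eta>" unfolding \<eta>_def using m by (intro divide_left_mono) auto
      ultimately show "t - \<eta> \<le> ln m" using ln_Suc_diff(1)[OF m(1)] by linarith
    qed (use m in auto)
    finally show "ennreal (1 / real (Suc (D + i))) * g (ln (real (Suc (D + i)))) \<le>
      ennreal c * (\<integral>\<^sup>+t. g (t - \<eta>) * indicator {ln (real (Suc (D + i)))..<ln (real (Suc (D +
        Suc i)))} t \<partial>lborel)"
      unfolding m(2) unfolding m_def[symmetric] .
  qed
  also have "\<dots> = ennreal c * (\<Sum>i. (\<integral>\<^sup>+t. g (t - \<eta>) * indicator {ln (real (Suc (D +
    i)))..<ln (real (Suc (D + Suc i)))} t \<partial>lborel))"
    by simp
  also have "(\<Sum>i. (\<integral>\<^sup>+t. g (t - \<eta>) * indicator {ln (real (Suc (D + i)))..<ln (real (Suc (D +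
    Suc i)))} t \<partial>lborel)) =
     (\<integral>\<^sup>+t. g (t - \<eta>) * indicator {ln (real (Suc (D + 0)))..} t \<partial>lborel)"
    by (rule nn_integral_intervals[symmetric]) (auto simp: filterlim_ln_Suc simp del: of_nat_Suc)
  finally have "sumop g \<le> ennreal c * hybrid D (\<lambda>t. g (t - \<eta>))"
    unfolding hybrid_def sumop_split[of g D] distrib_left add_0_right by (intro add_mono 1)
  then show ?thesis by (simp only: c_def \<eta>_def)
qed

text \<open>Unlike the bound above with \<open>D = 0\<close>, this one has the sharp constant 1.\<close>
lemma sumop_le_intop:
  assumes g: "antimono g"
  shows "sumop g \<le> 1 * intop (\<lambda>t. g (t - 1))"
proof -
  have [measurable]: "g \<in> borel_measurable borel" by (rule antimono_measurable[OF g])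
  \<comment> \<open>The cell for \<open>d = i + 1\<close> ends at 1 + ln d. From the second cell on
    its length is ln (d / (d - 1)), which is at least 1/d; the first cell has length exactly 1, the
    weight of \<open>d = 1\<close>. This is why the shift is by 1.\<close>
  define a where "a = (\<lambda>i. if i = 0 then 0 else 1 + ln (real i))"
  have a: "a 0 = 0" "a (Suc i) = 1 + ln (real (Suc i))" for i by (auto simp: a_def)
  have le: "1 / real (Suc i) \<le> a (Suc i) - a i" for i
  proof (cases i)
    case (Suc j)
    then show ?thesis using ln_Suc_diff(2)[of "real i"] by (simp add: a_def add.commute)
  qed (simp add: a_def)
  have inc: "a i \<le> a (Suc i)" for i
    using le[of i] by (smt (verit) divide_nonneg_nonneg of_nat_0_le_iff)
  have "filterlim (\<lambda>i. 1 + ln (real (Suc (0 + i)))) at_top sequentially"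
    by (intro filterlim_tendsto_add_at_top[OF tendsto_const] filterlim_ln_Suc)
  then have "filterlim (\<lambda>i. a (Suc i)) at_top sequentially" unfolding a by simp
  then have lim: "filterlim a at_top sequentially" by (rule filterlim_sequentially_Suc[THEN iffD1])
  have "sumop g \<le> (\<Sum>i. \<integral>\<^sup>+t. g (t - 1) * indicator {a i..<a (Suc i)} t \<partial>lborel)"
    unfolding sumop_def
  proof (intro suminf_le allI summableI)
    fix i
    have "ennreal (1 / real (Suc i)) * g (ln (real (Suc i))) \<le>
      ennreal (a (Suc i) - a i) * g (ln (real (Suc i)))"
      by (intro mult_right_mono ennreal_leI le) auto
    also have "\<dots> \<le> (\<integral>\<^sup>+t. g (t - 1) * indicator {a i..<a (Suc i)} t \<partial>lborel)"
      unfolding mult.commute[of "ennreal _"]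
      by (intro nn_integral_interval_ge antimonoD[OF g] inc) (auto simp: a simp del: of_nat_Suc)
    finally show "ennreal (1 / real (Suc i)) * g (ln (real (Suc i))) \<le>
      (\<integral>\<^sup>+t. g (t - 1) * indicator {a i..<a (Suc i)} t \<partial>lborel)" .
  qed
  also have "\<dots> = (\<integral>\<^sup>+t. g (t - 1) * indicator {a 0..} t \<partial>lborel)"
    by (intro nn_integral_intervals[symmetric] inc lim) measurable
  finally show ?thesis by (simp add: intop_eq a)
qed

lemma iter_hybrid_le_sumop: "iter (hybrid D) N J l \<le> iter sumop N J l"
  using iter_compare[OF mono_hybrid mono_sumop,
    where \<eta> = 0 and c = 1 and D1 = D and N = N and J = J and l = l]
  by (simp add: sumop_scale hybrid_le_sumop)

lemma iter_sumop_le_hybrid: "iter sumop N J l \<le> ennreal (1 + 1 / real (Suc D)) ^ length J *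
   iter (hybrid D) N J (\<lambda>j. l j + real (length J) * (1 / real (Suc D)))"
  by (intro iter_compare mono_hybrid mono_sumop sumop_le_hybrid hybrid_scale) auto

lemma iter_sumop_le_intop: "iter sumop N J l \<le> iter intop N J (\<lambda>j. l j + real (length J))"
  using iter_compare[OF mono_sumop mono_hybrid,
    where \<eta> = 1 and c = 1 and D1 = 0 and N = N and J = J and l = l]
  by (simp add: sumop_le_intop[simplified] hybrid_scale)

section \<open>Volumes of the polytopes: scaling, positivity, piecewise polynomiality\<close>

lemma iter_intop_Cons:
  "iter intop N (s # J) l = (\<integral>\<^sup>+t. iter intop N J (shift l s t) * indicator {0..} t \<partial>lborel)"
  by (simp only: iter.simps intop_eq)

lemma iter_hybrid_Cons:
  "iter (hybrid D) N (s # J) l =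
     (\<Sum>i<D. ennreal (1 / real (Suc i)) * iter (hybrid D) N J (shift l s (ln (real (Suc i))))) +
     (\<integral>\<^sup>+t. iter (hybrid D) N J (shift l s t) * indicator {ln (real (Suc D))..} t \<partial>lborel)"
  by (simp only: iter.simps hybrid_def)

text \<open>Substituting \<open>c * t\<close> for \<open>t\<close> gives one factor \<open>c\<close>
  per entry of \<open>J\<close>. This homogeneity later makes the normalised integral constant in
  x.\<close>

lemma iter_intop_scale:
  assumes c: "c > 0"
  shows "iter intop N J (\<lambda>j. c * l j) = ennreal c ^ length J * iter intop N J l"
proof (induction J arbitrary: l)
  case Nil
  then show ?case using c by (simp add: zero_le_mult_iff)
next
  case (Cons s J)
  have m[measurable]: "(\<lambda>t. iter intop N J (shift l s t)) \<in> borel_measurable borel" for l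
    by (rule measurable_iter[OF mono_hybrid])
  have "iter intop N (s # J) (\<lambda>j. c * l j) = ennreal \<bar>c\<bar> * 
    (\<integral>\<^sup>+t. iter intop N J (shift (\<lambda>j. c * l j) s (0 + c * t)) * indicator {0..} (0 + c *
      t) \<partial>lborel)"
    unfolding iter_intop_Cons using c by (intro nn_integral_real_affine) auto
  also have "(\<integral>\<^sup>+t. iter intop N J (shift (\<lambda>j. c * l j) s (0 + c * t)) * indicator {0..} (0 + c *
    t) \<partial>lborel) =
     (\<integral>\<^sup>+t. ennreal c ^ length J * (iter intop N J (shift l s t) * indicator {0..} t) \<partial>lborel)"
  proof (intro nn_integral_cong)
    fix t :: real
    have "shift (\<lambda>j. c * l j) s (0 + c * t) = (\<lambda>j. c * shift l s t j)"
      by (auto simp: shift_def algebra_simps)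
    moreover have "indicator {0..} (0 + c * t) = (indicator {0..} t :: ennreal)"
      using c by (auto simp: indicator_def zero_le_mult_iff)
    ultimately show "iter intop N J (shift (\<lambda>j. c * l j) s (0 + c * t)) * indicator {0..} (0 + c *
      t) =
      ennreal c ^ length J * (iter intop N J (shift l s t) * indicator {0..} t)"
      by (simp add: Cons.IH mult.assoc)
  qed
  also have "\<dots> = ennreal c ^ length J * iter intop N (s # J) l"
    unfolding iter_intop_Cons by (intro nn_integral_cmult) measurable
  finally show ?case using c by (simp add: mult.assoc)
qed

text \<open>While the first variable stays below \<open>c / 2\<close>, every budget keeps at least
  \<open>c / 2\<close>; in this way the polytope contains a box of positive volume.\<close>

lemma iter_intop_pos: "0 < c \<Longrightarrow> 0 < iter intop N J (\<lambda>_. c)"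
proof (induction J arbitrary: c)
  case (Cons s J)
  have "0 < iter intop N J (\<lambda>_. c / 2) * ennreal (c / 2 - 0)"
    using Cons by (simp add: ennreal_zero_less_mult_iff)
  also have "\<dots> \<le> (\<integral>\<^sup>+t. iter intop N J (shift (\<lambda>_. c) s t) * indicator {0..<c / 2} t \<partial>lborel)"
    using Cons.prems by (intro nn_integral_interval_ge iter_mono mono_hybrid) (auto simp: shift_def)
  also have "\<dots> \<le> iter intop N (s # J) (\<lambda>_. c)"
    unfolding iter_intop_Cons by (intro nn_integral_mono) (auto simp: indicator_def)
  finally show ?case .
qed auto

text \<open>Since \<open>s\<close> is non-empty, some budget \<open>l j\<close> with
  \<open>j \<in> s\<close> caps the outer variable: beyond it the inner value is 0. The outer
  integral is therefore over \<open>{0..l j}\<close>, as in \<open>slice_poly_integral\<close>, and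
  all values are finite.\<close>

lemma iter_intop_pwpoly:
  assumes N: "finite N" and J: "\<And>s. s \<in> set J \<Longrightarrow> s \<noteq> {} \<and> s \<subseteq> N"
  shows "\<exists>F. pwpoly N F \<and> (\<forall>l. 0 \<le> F l \<and> iter intop N J l = ennreal (F l))"
  using J
proof (induction J)
  case Nil
  have "pwpoly N (\<lambda>l. if \<forall>j\<in>N. 0 \<le> lin N (\<lambda>i. if i = j then 1 else 0) l then 1 else 0)"
    by (intro pwpoly_ball N pwpoly.ind)
  then show ?case
    by (intro exI[of _ "\<lambda>l. if \<forall>j\<in>N. 0 \<le> lin N (\<lambda>i. if i = j then 1 else 0) l then 1 else 0"])
      (auto simp: lin_unit N)
next
  case (Cons s J)
  then obtain F where F: "pwpoly N F" "\<And>l. 0 \<le> F l" "\<And>l. iter intop N J l = ennreal (F l)"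
    by fastforce
  obtain j where j: "j \<in> s" "j \<in> N" using Cons.prems[of s] by auto
  obtain G where G: "pwpoly N G"
    "\<And>l. has_bochner_integral lborel (\<lambda>t. F (shift l s t) * indicator {0..l j} t) (G l)"
    using slice_poly_integral[OF N j(2) pwpoly_imp_slice_poly[OF F(1), of s]] by blast
  have "0 \<le> G l \<and> iter intop N (s # J) l = ennreal (G l)" for l
  proof
    have int: "integrable lborel (\<lambda>t. F (shift l s t) * indicator {0..l j} t)"
      and eq: "integral\<^sup>L lborel (\<lambda>t. F (shift l s t) * indicator {0..l j} t) = G l"
      using G(2)[of l] by (auto simp: has_bochner_integral_iff)
    show "0 \<le> G l" unfolding eq[symmetric] by (intro integral_nonneg_AE) (auto simp: F(2))
    have "iter intop N (s # J) l = (\<integral>\<^sup>+t. ennreal (F (shift l s t) * indicator {0..l j} t) \<partial>lborel)"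
      unfolding iter_intop_Cons
    proof (intro nn_integral_cong)
      fix t :: real
      have "iter intop N J (shift l s t) = 0" if "t > l j"
        using that j by (intro iter_eq_0[OF mono_hybrid j(2)]) (auto simp: shift_def)
      then show "iter intop N J (shift l s t) * indicator {0..} t =
        ennreal (F (shift l s t) * indicator {0..l j} t)"
        by (auto simp: indicator_def F not_le)
    qed
    also have "\<dots> = ennreal (G l)"
      unfolding eq[symmetric] by (intro nn_integral_eq_integral int) (auto simp: F(2))
    finally show "iter intop N (s # J) l = ennreal (G l)" .
  qed
  then show ?case using G(1) by blast
qed

section \<open>Hybrids as finite combinations of volumes with bounded offsets\<close>

inductive shift_comb :: "nat set \<Rightarrow> nat set list set \<Rightarrow> real \<Rightarrow> ((nat \<Rightarrow> real) \<Rightarrow> ennreal) \<Rightarrow> bool"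
  for N KS B where
  zero: "shift_comb N KS B (\<lambda>_. 0)"
| base: "0 \<le> \<kappa> \<Longrightarrow> K \<in> KS \<Longrightarrow> (\<And>j. 0 \<le> b j \<and> b j \<le> B) \<Longrightarrow>
    shift_comb N KS B (\<lambda>l. ennreal \<kappa> * iter intop N K (\<lambda>j. l j - b j))"
| add: "shift_comb N KS B f \<Longrightarrow> shift_comb N KS B g \<Longrightarrow> shift_comb N KS B (\<lambda>l. f l + g l)"

lemma shift_comb_sum: "finite A \<Longrightarrow> (\<And>i. i \<in> A \<Longrightarrow> shift_comb N KS B (f i)) \<Longrightarrow>
  shift_comb N KS B (\<lambda>l. \<Sum>i\<in>A. f i l)"
  by (induction A rule: finite_induct) (simp_all add: shift_comb.zero shift_comb.add)

lemma shift_comb_mono: "shift_comb N KS B f \<Longrightarrow> KS \<subseteq> KS' \<Longrightarrow> B \<le> B' \<Longrightarrow> shift_comb N KS' B' f"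
proof (induction rule: shift_comb.induct)
  case (base \<kappa> K b)
  have "0 \<le> b j \<and> b j \<le> B'" for j using base(3)[of j] base(5) by auto
  with base show ?case by (intro shift_comb.base) auto
next
  case (add f g)
  show ?case by (intro shift_comb.add add.IH add.prems)
qed (rule shift_comb.zero)

lemma shift_comb_shift:
  assumes "shift_comb N KS B f" "0 \<le> c" "0 \<le> t"
  shows "shift_comb N KS (B + t) (\<lambda>l. ennreal c * f (shift l s t))"
  using assms(1)
proof (induction rule: shift_comb.induct)
  case zero
  then show ?case using shift_comb.zero by simp
next
  case (base \<kappa> K b)
  have "shift_comb N KS (B + t) (\<lambda>l. ennreal (c * \<kappa>) * iter intop N K (\<lambda>j. l j - (b j +
    (if j \<in> s then t else 0))))"
    using base assms by (intro shift_comb.base) (auto simp: add_mono add_increasing2)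
  moreover have "(\<lambda>j. l j - (b j + (if j \<in> s then t else 0))) = (\<lambda>j. shift l s t j - b j)" for l
    by (auto simp: shift_def)
  ultimately show ?case using base(1) assms(2) by (simp add: ennreal_mult mult.assoc)
next
  case (add f g)
  then show ?case using shift_comb.add[OF add.IH] by (simp add: distrib_left)
qed

lemma shift_comb_measurable:
  "shift_comb N KS B f \<Longrightarrow> (\<lambda>t. f (shift l s t)) \<in> borel_measurable borel"
proof (induction rule: shift_comb.induct)
  case (base \<kappa> K b)
  have "(\<lambda>j. shift l s t j - b j) = shift (\<lambda>j. l j - b j) s t" for t by (auto simp: shift_def)
  then have [measurable]: "(\<lambda>t. iter intop N K (\<lambda>j. shift l s t j - b j)) \<in> borel_measurable borel"
    using measurable_iter[OF mono_hybrid] by simp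
  show ?case by measurable
qed measurable

text \<open>Translating \<open>t\<close> by \<open>\<tau>\<close> turns the integral from
  \<open>\<tau>\<close> into one from 0, at the price of lowering the budgets in \<open>s\<close> by
  \<open>\<tau>\<close> once more.\<close>

lemma shift_comb_integral:
  assumes "shift_comb N KS B f" "0 \<le> \<tau>"
  shows "shift_comb N ((#) s ` KS) (B + \<tau>) (\<lambda>l. \<integral>\<^sup>+t. f (shift l s t) * indicator {\<tau>..} t \<partial>lborel)"
  using assms(1)
proof (induction rule: shift_comb.induct)
  case zero
  then show ?case using shift_comb.zero by simp
next
  case (base \<kappa> K b)
  have "shift_comb N ((#) s ` KS) (B + \<tau>) (\<lambda>l. ennreal \<kappa> * iter intop N (s # K) (\<lambda>j. l j - (b j +
    (if j \<in> s then \<tau> else 0))))"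
    using base assms by (intro shift_comb.base) (auto simp: add_mono add_increasing2)
  moreover have "ennreal \<kappa> * iter intop N (s # K) (\<lambda>j. l j - (b j + (if j \<in> s then \<tau> else 0))) =
      (\<integral>\<^sup>+t. ennreal \<kappa> * iter intop N K (\<lambda>j. shift l s t j - b j) * indicator {\<tau>..} t \<partial>lborel)"
        for l
  proof -
    have shift_eq: "(\<lambda>j. shift l s t j - b j) = shift (\<lambda>j. l j - b j) s t" for t
      by (auto simp: shift_def)
    have [measurable]: "(\<lambda>t. iter intop N K (\<lambda>j. shift l s t j - b j)) \<in> borel_measurable borel"
      unfolding shift_eq using measurable_iter[OF mono_hybrid] by simp
    have "(\<integral>\<^sup>+t. ennreal \<kappa> * iter intop N K (\<lambda>j. shift l s t j - b j) * indicator {\<tau>..} t \<partial>lborel) =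
       ennreal \<bar>1\<bar> * (\<integral>\<^sup>+t. ennreal \<kappa> * iter intop N K (\<lambda>j. shift l s (\<tau> + 1 * t) j - b j) *
         indicator {\<tau>..} (\<tau> + 1 * t) \<partial>lborel)"
      by (rule nn_integral_real_affine) auto
    also have "\<dots> = (\<integral>\<^sup>+t. ennreal \<kappa> * (iter intop N K (shift (\<lambda>j. l j - (b j +
      (if j \<in> s then \<tau> else 0))) s t) * indicator {0..} t) \<partial>lborel)"
    proof -
      have "(\<lambda>j. shift l s (\<tau> + 1 * t) j - b j) =
        shift (\<lambda>j. l j - (b j + (if j \<in> s then \<tau> else 0))) s t" for t
        by (auto simp: shift_def)
      then show ?thesis by (auto simp: indicator_def mult.assoc intro!: nn_integral_cong)
    qed
    also have "\<dots> = ennreal \<kappa> * iter intop N (s # K) (\<lambda>j. l j - (b j + (if j \<in> s then \<tau> else 0)))"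
      unfolding iter_intop_Cons using measurable_iter[OF mono_hybrid]
      by (intro nn_integral_cmult borel_measurable_times) auto
    finally show ?thesis by simp
  qed
  ultimately show ?case by simp
next
  case (add f g)
  have "(\<integral>\<^sup>+t. (f (shift l s t) + g (shift l s t)) * indicator {\<tau>..} t \<partial>lborel) =
     (\<integral>\<^sup>+t. f (shift l s t) * indicator {\<tau>..} t \<partial>lborel) + (\<integral>\<^sup>+t. g (shift l s t) *
       indicator {\<tau>..} t \<partial>lborel)" for l
    unfolding distrib_right using add.hyps[THEN shift_comb_measurable]
    by (intro nn_integral_add borel_measurable_times) auto
  then show ?case using shift_comb.add[OF add.IH] by simp
qed

text \<open>When every \<open>hybrid\<close> is expanded, each variable either is fixed at some ln d
  with \<open>d \<le> D\<close> and leaves the list, or stays as an integration variable starting at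
  ln (D + 1). In both cases it adds at most ln (D + 1) to the offsets. The lists that remain are the
  subsequences of \<open>J\<close>.\<close>

lemma shift_comb_iter_hybrid:
  "shift_comb N (set (subseqs J)) (real (length J) * ln (real (Suc D))) (iter (hybrid D) N J)"
proof (induction J)
  case Nil
  have "shift_comb N {[]} 0 (\<lambda>l. ennreal 1 * iter intop N [] (\<lambda>j. l j - 0))"
    by (intro shift_comb.base) auto
  moreover have "(\<lambda>l. ennreal 1 * iter intop N [] (\<lambda>j. l j - 0)) = iter (hybrid D) N []"
    by (auto simp: fun_eq_iff)
  ultimately show ?case by simp
next
  case (Cons s J)
  let ?B = "real (length J) * ln (real (Suc D))" and ?B' =
    "real (length (s # J)) * ln (real (Suc D))"
  have sub: "set (subseqs J) \<subseteq> set (subseqs (s # J))"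
    "(#) s ` set (subseqs J) \<subseteq> set (subseqs (s # J))"
    by (auto simp: Let_def)
  have B': "?B' = ?B + ln (real (Suc D))" by (simp add: algebra_simps)
  have "shift_comb N (set (subseqs (s # J))) ?B' (\<lambda>l. ennreal (1 / real (Suc i)) *
    iter (hybrid D) N J (shift l s (ln (real (Suc i)))))"
    if "i < D" for i
    using that unfolding B'
    by (intro shift_comb_mono[OF shift_comb_shift[OF Cons.IH] sub(1)]) (auto simp del: of_nat_Suc)
  moreover have "shift_comb N (set (subseqs (s # J))) ?B' (\<lambda>l. \<integral>\<^sup>+t. iter (hybrid D) N J (shift l s t) * indicator {ln (real (Suc D))..} t \<partial>lborel)"
    unfolding B' by (intro shift_comb_mono[OF shift_comb_integral[OF Cons.IH] sub(2)]) (auto simp del: of_nat_Suc)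
  ultimately have "shift_comb N (set (subseqs (s # J))) ?B' (\<lambda>l. 
     (\<Sum>i<D. ennreal (1 / real (Suc i)) * iter (hybrid D) N J (shift l s (ln (real (Suc i))))) +
     (\<integral>\<^sup>+t. iter (hybrid D) N J (shift l s t) * indicator {ln (real (Suc D))..} t \<partial>lborel))"
    by (intro shift_comb.add shift_comb_sum) auto
  then show ?case unfolding iter_hybrid_Cons[symmetric] .
qed

text \<open>The number of terms of \<open>f\<close> is arbitrary, but only finitely many lists occur
  in them. Summing the thresholds and degrees from \<open>pwpoly_diag\<close> over \<open>KS\<close>
  gives \<open>C\<close> and \<open>d\<close> that depend on neither \<open>f\<close> nor
  \<open>B\<close>, hence later not on the cut-off of the hybrid.\<close>

lemma shift_comb_poly:
  assumes N: "finite N" and KS: "finite KS" "\<And>K s. K \<in> KS \<Longrightarrow> s \<in> set K \<Longrightarrow> s \<noteq> {} \<and> s \<subseteq> N"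
  shows "\<exists>C\<ge>0. \<exists>d. \<forall>B f a A. shift_comb N KS B f \<longrightarrow> 0 \<le> B \<longrightarrow> 0 \<le> A \<longrightarrow> (\<forall>j\<in>N. \<bar>a j\<bar> \<le> A) \<longrightarrow>
    (\<exists>p. degree p \<le> d \<and> (\<forall>L. C * (A + B) < L \<longrightarrow>
      0 \<le> poly p L \<and> f (\<lambda>j. L - a j) = ennreal (poly p L)))"
proof -
  have "\<exists>C d. 0 \<le> C \<and> (\<forall>A a. 0 \<le> A \<longrightarrow> (\<forall>j\<in>N. \<bar>a j\<bar> \<le> A) \<longrightarrow>
    (\<exists>p. degree p \<le> d \<and> (\<forall>L. C * A < L \<longrightarrow>
      0 \<le> poly p L \<and> iter intop N K (\<lambda>j. L - a j) = ennreal (poly p L))))"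
    if K: "K \<in> KS" for K
  proof -
    obtain F where F: "pwpoly N F" "\<And>l. 0 \<le> F l" "\<And>l. iter intop N K l = ennreal (F l)"
      using iter_intop_pwpoly[OF N, of K] KS(2)[OF K] by blast
    obtain C d where C: "0 \<le> C" and *: "\<forall>a B. (\<forall>j\<in>N. \<bar>a j\<bar> \<le> B) \<longrightarrow> 0 \<le> B \<longrightarrow>
       (\<exists>p. degree p \<le> d \<and> (\<forall>L. C * B < L \<longrightarrow> F (\<lambda>j. L - a j) = poly p L))"
      using pwpoly_diag[OF N F(1)] by blast
    show ?thesis
    proof (intro exI[of _ C] exI[of _ d] conjI allI impI)
      show "0 \<le> C" by fact
      fix A :: real and a assume "0 \<le> A" "\<forall>j\<in>N. \<bar>a j\<bar> \<le> A"
      then obtain p where p: "degree p \<le> d" "\<And>L. C * A < L \<Longrightarrow>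
        F (\<lambda>j. L - a j) = poly p L" using * by blast
      show "\<exists>p. degree p \<le> d \<and> (\<forall>L. C * A < L \<longrightarrow>
        0 \<le> poly p L \<and> iter intop N K (\<lambda>j. L - a j) = ennreal (poly p L))"
        using p(1) F(2,3) by (intro exI[of _ p] conjI allI impI) (simp_all add: p(2)[symmetric])
    qed
  qed
  then obtain C d where C: "\<And>K. K \<in> KS \<Longrightarrow> 0 \<le> C K" and Cd: "\<And>K A a. K \<in> KS \<Longrightarrow> 0 \<le> A \<Longrightarrow>
    (\<forall>j\<in>N. \<bar>a j\<bar> \<le> A) \<Longrightarrow>
    (\<exists>p. degree p \<le> d K \<and> (\<forall>L. C K * A < L \<longrightarrow>
      0 \<le> poly p L \<and> iter intop N K (\<lambda>j. L - a j) = ennreal (poly p L)))"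
    by metis
  define C' where "C' = (\<Sum>K\<in>KS. C K)"
  define d' where "d' = (\<Sum>K\<in>KS. d K)"
  have C': "0 \<le> C'" using C by (auto simp: C'_def intro: sum_nonneg)
  have le: "C K \<le> C'" "d K \<le> d'" if "K \<in> KS" for K
    using that C KS(1) by (auto simp: C'_def d'_def intro: member_le_sum)
  have "\<exists>p. degree p \<le> d' \<and> (\<forall>L. C' * (A + B) < L \<longrightarrow>
    0 \<le> poly p L \<and> f (\<lambda>j. L - a j) = ennreal (poly p L))"
    if "shift_comb N KS B f" and AB: "0 \<le> B" "0 \<le> A" "\<forall>j\<in>N. \<bar>a j\<bar> \<le> A" for B f a A
    using that(1)
  proof (induction rule: shift_comb.induct)
    case zero
    show ?case by (intro exI[of _ 0]) auto
  next
    case (base \<kappa> K b)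
    have "\<bar>a j + b j\<bar> \<le> A + B" if "j \<in> N" for j
      using AB(3) that base(3)[of j] by (smt (verit))
    then obtain p where p: "degree p \<le> d K" "\<And>L. C K * (A + B) < L \<Longrightarrow> 0 \<le> poly p L"
       "\<And>L. C K * (A + B) < L \<Longrightarrow> iter intop N K (\<lambda>j. L - (a j + b j)) = ennreal (poly p L)"
      using Cd[OF base(2), of "A + B" "\<lambda>j. a j + b j"] AB by auto
    have "C K * (A + B) \<le> C' * (A + B)" using le[OF base(2)] AB by (intro mult_right_mono) auto
    then show ?case using p base(1) le[OF base(2)]
      by (intro exI[of _ "smult \<kappa> p"] conjI) (auto simp: ennreal_mult diff_diff_eq)
  next
    case (add f g)
    then obtain p q where "degree p \<le> d'" "\<forall>L. C' * (A + B) < L \<longrightarrow>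
      0 \<le> poly p L \<and> f (\<lambda>j. L - a j) = ennreal (poly p L)"
      "degree q \<le> d'" "\<forall>L. C' * (A + B) < L \<longrightarrow> 0 \<le> poly q L \<and> g (\<lambda>j. L - a j) = ennreal (poly q L)"
        by blast
    then show ?case by (intro exI[of _ "p + q"]) (auto intro: degree_add_le)
  qed
  then show ?thesis using C' by blast
qed

section \<open>Coefficient bounds and limits of polynomials\<close>

text \<open>Equivalence of norms on a finite-dimensional space, by induction on the degree:
  synthetic division at \<open>x\<close> writes \<open>p\<close> as a constant plus
  \<open>t - x\<close> times a quotient, and on the right half of the interval \<open>t - x\<close>
  is bounded below, so the quotient is bounded there.\<close>

lemma poly_coeff_bound:
  fixes x y :: real
  assumes "x < y"
  shows "\<exists>C\<ge>0. \<forall>p M. degree p \<le> d \<longrightarrow> (\<forall>t\<in>{x..y}. \<bar>poly p t\<bar> \<le> M) \<longrightarrow> (\<forall>i. \<bar>coeff p i\<bar> \<le> C * M)"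
  using assms
proof (induction d arbitrary: x)
  case 0
  have "\<bar>coeff p i\<bar> \<le> 1 * M" if "degree p \<le> 0" "\<forall>t\<in>{x..y}. \<bar>poly p t\<bar> \<le> M" for p M i
  proof -
    have "degree p = 0" using that(1) by simp
    then obtain c where p: "p = [:c:]" by (rule degree_eq_zeroE)
    have "\<bar>c\<bar> \<le> M" using that(2) 0 p by auto
    then show ?thesis by (cases i) (auto simp: p)
  qed
  then show ?case by (intro exI[of _ 1]) auto
next
  case (Suc d)
  define z where "z = (x + y) / 2"
  have z: "x < z" "z < y" using Suc.prems by (auto simp: z_def)
  obtain C where C: "C \<ge> 0" "\<And>p M i. degree p \<le> d \<Longrightarrow> (\<forall>t\<in>{z..y}. \<bar>poly p t\<bar> \<le> M) \<Longrightarrow>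
    \<bar>coeff p i\<bar> \<le> C * M"
    using Suc.IH[OF z(2)] by metis
  define C' where "C' = 1 + (1 + \<bar>x\<bar>) * C * (2 / (z - x))"
  have C': "C' \<ge> 0" unfolding C'_def using C(1) z
    by (intro add_nonneg_nonneg mult_nonneg_nonneg) auto
  have "\<bar>coeff p i\<bar> \<le> C' * M" if p: "degree p \<le> Suc d" and M: "\<forall>t\<in>{x..y}. \<bar>poly p t\<bar> \<le> M" for p M i
  proof -
    define q where "q = synthetic_div p x"
    have deg: "degree q \<le> d" using p by (simp add: q_def degree_synthetic_div)
    have peq: "p = [:-x, 1:] * q + [:poly p x:]"
      using synthetic_div_correct'[of x p] by (simp add: q_def)
    have M0: "\<bar>poly p x\<bar> \<le> M" using M Suc.prems by auto
    have "\<bar>poly q t\<bar> \<le> 2 / (z - x) * M" if t: "t \<in> {z..y}" for t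
    proof -
      have tx: "t - x > 0" "z - x \<le> t - x" using t z by auto
      have "poly p t = (t - x) * poly q t + poly p x"
        by (subst peq) (simp add: algebra_simps)
      then have eq: "(t - x) * poly q t = poly p t - poly p x" by simp
      have "\<bar>poly p t\<bar> \<le> M" using M t z by auto
      then have "\<bar>(t - x) * poly q t\<bar> \<le> 2 * M" unfolding eq using M0 by linarith
      then have "(t - x) * \<bar>poly q t\<bar> \<le> 2 * M" using tx by (simp add: abs_mult)
      moreover have "(z - x) * \<bar>poly q t\<bar> \<le> (t - x) * \<bar>poly q t\<bar>" using tx
        by (intro mult_right_mono) auto
      ultimately have "(z - x) * \<bar>poly q t\<bar> \<le> 2 * M" by simp
      then show ?thesis using z by (simp add: field_simps)
    qed
    then have cq: "\<bar>coeff q i\<bar> \<le> C * (2 / (z - x) * M)" for i by (intro C(2) deg) auto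
    have "M \<ge> 0" using M0 by linarith
    have "coeff p i = (if i = 0 then poly p x else coeff q (i - 1)) - x * coeff q i"
      by (subst peq) (cases i; simp)
    then have "\<bar>coeff p i\<bar> \<le> \<bar>poly p x\<bar> + \<bar>coeff q (i - 1)\<bar> + \<bar>x\<bar> * \<bar>coeff q i\<bar>"
      unfolding abs_mult[symmetric] by (cases i) auto
    also have "\<dots> \<le> M + C * (2 / (z - x) * M) + \<bar>x\<bar> * (C * (2 / (z - x) * M))"
      by (intro add_mono M0 cq mult_left_mono) auto
    also have "\<dots> = C' * M" unfolding C'_def
      by (simp only: distrib_right distrib_left mult_1_left mult_ac add_ac)
    finally show ?thesis .
  qed
  then show ?case using C' by blast
qed

text \<open>Translation by \<open>\<tau>\<close> reduces to the interval from 0 to 1, so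
  \<open>C\<close> does not depend on where the window lies. The first bound carries smallness from
  a window back to smaller arguments; the second absorbs the shift of \<open>L\<close> that the
  comparison with \<open>hybrid\<close> costs.\<close>

lemma poly_growth:
  "\<exists>C\<ge>0. \<forall>(p :: real poly) \<tau> M. degree p \<le> d \<longrightarrow> (\<forall>t\<in>{\<tau>..\<tau> + 1}. \<bar>poly p t\<bar> \<le> M) \<longrightarrow>
    (\<forall>t. \<bar>poly p t\<bar> \<le> C * M * (1 + \<bar>t - \<tau>\<bar>) ^ d) \<and>
    (\<forall>h. 0 \<le> h \<longrightarrow> h \<le> 1 \<longrightarrow> \<bar>poly p (\<tau> + h) - poly p \<tau>\<bar> \<le> C * M * h)"
proof -
  obtain C where C: "C \<ge> 0" "\<And>(p :: real poly) M i. degree p \<le> d \<Longrightarrow> (\<forall>t\<in>{0..1}. \<bar>poly p t\<bar> \<le> M) \<Longrightarrow>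
    \<bar>coeff p i\<bar> \<le> C * M"
    using poly_coeff_bound[of 0 1 d] by auto
  have "(\<forall>t. \<bar>poly p t\<bar> \<le> (real (Suc d) * C) * M * (1 + \<bar>t - \<tau>\<bar>) ^ d) \<and>
    (\<forall>h. 0 \<le> h \<longrightarrow> h \<le> 1 \<longrightarrow> \<bar>poly p (\<tau> + h) - poly p \<tau>\<bar> \<le> (real (Suc d) * C) * M * h)"
    if p: "degree p \<le> d" and M: "\<forall>t\<in>{\<tau>..\<tau> + 1}. \<bar>poly p t\<bar> \<le> M" for p :: "real poly" and \<tau> M
  proof -
    define q where "q = pcompose p [:\<tau>, 1:]"
    have q: "poly q t = poly p (\<tau> + t)" for t by (simp add: q_def poly_pcompose)
    have dq: "degree q \<le> d" using p by (simp add: q_def degree_pcompose)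
    have cq: "\<bar>coeff q i\<bar> \<le> C * M" for i
      by (intro C(2) dq) (use M in \<open>auto simp: q\<close>)
    have CM: "0 \<le> C * M" using cq[of 0] by linarith
    have pq: "poly q t = (\<Sum>i\<le>d. coeff q i * t ^ i)" for t
    proof -
      have "poly q t = (\<Sum>i\<le>degree q. coeff q i * t ^ i)" by (rule poly_altdef)
      also have "\<dots> = (\<Sum>i\<le>d. coeff q i * t ^ i)"
        using dq by (intro sum.mono_neutral_left) (auto simp: coeff_eq_0)
      finally show ?thesis .
    qed
    show ?thesis
    proof (intro conjI allI impI)
      fix t
      have "\<bar>poly p t\<bar> = \<bar>\<Sum>i\<le>d. coeff q i * (t - \<tau>) ^ i\<bar>" using q[of "t - \<tau>"] by (simp add: pq)
      also have "\<dots> \<le> (\<Sum>i\<le>d. C * M * (1 + \<bar>t - \<tau>\<bar>) ^ d)"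
      proof (intro order.trans[OF sum_abs] sum_mono)
        fix i assume "i \<in> {..d}"
        have "\<bar>t - \<tau>\<bar> ^ i \<le> (1 + \<bar>t - \<tau>\<bar>) ^ i" by (intro power_mono) auto
        also have "\<dots> \<le> (1 + \<bar>t - \<tau>\<bar>) ^ d" using \<open>i \<in> {..d}\<close> by (intro power_increasing) auto
        finally show "\<bar>coeff q i * (t - \<tau>) ^ i\<bar> \<le> C * M * (1 + \<bar>t - \<tau>\<bar>) ^ d"
          unfolding abs_mult power_abs by (intro mult_mono cq CM) auto
      qed
      also have "\<dots> = (real (Suc d) * C) * M * (1 + \<bar>t - \<tau>\<bar>) ^ d" by simp
      finally show "\<bar>poly p t\<bar> \<le> (real (Suc d) * C) * M * (1 + \<bar>t - \<tau>\<bar>) ^ d" .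
    next
      fix h :: real assume h: "0 \<le> h" "h \<le> 1"
      have "poly p (\<tau> + h) - poly p \<tau> = (\<Sum>i\<le>d. coeff q i * h ^ i) - (\<Sum>i\<le>d. coeff q i * 0 ^ i)"
        using q[of h] q[of 0] by (simp only: pq) simp
      also have "\<dots> = (\<Sum>i\<le>d. coeff q i * (h ^ i - 0 ^ i))"
        by (simp add: sum_subtractf algebra_simps)
      finally have "\<bar>poly p (\<tau> + h) - poly p \<tau>\<bar> = \<bar>\<Sum>i\<le>d. coeff q i * (h ^ i - 0 ^ i)\<bar>" by simp
      also have "\<dots> \<le> (\<Sum>i\<le>d. C * M * h)"
      proof (intro order.trans[OF sum_abs] sum_mono)
        fix i
        have "\<bar>h ^ i - 0 ^ i\<bar> \<le> h"
        proof (cases i)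
          case (Suc k)
          have "h * h ^ k \<le> h * 1" using h by (intro mult_left_mono power_le_one) auto
          then show ?thesis using Suc h by simp
        qed (use h in simp)
        then show "\<bar>coeff q i * (h ^ i - 0 ^ i)\<bar> \<le> C * M * h"
          unfolding abs_mult by (intro mult_mono cq CM) auto
      qed
      also have "\<dots> = (real (Suc d) * C) * M * h" by simp
      finally show "\<bar>poly p (\<tau> + h) - poly p \<tau>\<bar> \<le> (real (Suc d) * C) * M * h" .
    qed
  qed
  then show ?thesis using C(1) by (intro exI[of _ "real (Suc d) * C"]) auto
qed

lemma poly_power_geometric_bounded:
  fixes \<rho> c :: real
  assumes "0 < \<rho>" "\<rho> < 1" "0 \<le> c"
  shows "\<exists>K\<ge>0. \<forall>m::nat. \<rho> ^ m * (1 + c * (real m + 2)) ^ d \<le> K"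
proof -
  \<comment> \<open>Chosen so that \<open>exp (a * m * (d + 1))\<close> is the inverse of
    \<open>\<rho> ^ m\<close>; \<open>Suc d\<close> also avoids a division by 0. The constant
    \<open>K\<close> below is made for \<open>1 + c * (m + 2) \<le> K * (1 + a * m)\<close>, after
    which \<open>1 + a * m \<le> exp (a * m)\<close> finishes.\<close>
  define a where "a = - ln \<rho> / real (Suc d)"
  have a: "a > 0" using assms by (simp add: a_def divide_neg_pos)
  define K where "K = 1 + 2 * c + c / a"
  have K: "K \<ge> 1" using assms a by (simp add: K_def)
  have "\<rho> ^ m * (1 + c * (real m + 2)) ^ d \<le> K ^ d" for m :: nat
  proof -
    have "1 + c * (real m + 2) \<le> K * (1 + a * real m)"
    proof -
      have "K * (1 + a * real m) = 1 + 2 * c + c / a + (1 + 2 * c) * (a * real m) + c * real m"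
        using a by (simp add: K_def algebra_simps)
      then show ?thesis using assms a by (simp add: algebra_simps)
    qed
    also have "\<dots> \<le> K * exp (a * real m)" using K by (intro mult_left_mono exp_ge_add_one_self) auto
    finally have "(1 + c * (real m + 2)) ^ d \<le> (K * exp (a * real m)) ^ d"
      using assms by (intro power_mono) auto
    also have "\<dots> = K ^ d * exp (a * real m * real d)"
      by (simp add: power_mult_distrib exp_of_nat_mult[symmetric] mult_ac)
    also have "\<dots> \<le> K ^ d * exp (a * real m * real (Suc d))"
      using K a by (intro mult_left_mono) (auto intro!: mult_left_mono)
    also have "a * real m * real (Suc d) = - ln \<rho> * real m" by (simp add: a_def del: of_nat_Suc)
    also have "exp (- ln \<rho> * real m) = inverse (\<rho> ^ m)"
      using assms by (simp add: exp_minus exp_of_nat2_mult)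
    finally show ?thesis using assms by (simp add: field_simps)
  qed
  then show ?thesis using K by (intro exI[of _ "K ^ d"]) auto
qed

text \<open>The windows of \<open>k\<close> and \<open>k + 1\<close> share the interval from
  \<open>c * (k + 2)\<close> to \<open>c * (k + 3)\<close>, of length at least 1. There
  \<open>P (k + 1) - P k\<close> is of order \<open>\<theta> ^ k\<close>, and by
  \<open>poly_growth\<close> it is at most that times a power of \<open>k\<close> on everything from
  0 to \<open>c * (k + 2)\<close>. So the differences are summable coefficientwise, with a geometric
  tail, and \<open>P k\<close> is close to the limit at all \<open>L\<close> up to
  \<open>c * (k + 2)\<close>.\<close>

lemma poly_approx:
  fixes S :: "real \<Rightarrow> real" and P :: "nat \<Rightarrow> real poly"
  assumes c: "c \<ge> 1" and \<theta>: "0 < \<theta>" "\<theta> < 1" and B: "B \<ge> 0" and deg: "\<And>k. degree (P k) \<le> d"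
    and approx: "\<And>k L. c * (real k + 1) \<le> L \<Longrightarrow> L \<le> c * (real k + 3) \<Longrightarrow>
      \<bar>S L - poly (P k) L\<bar> \<le> B * \<theta> ^ k"
  shows "\<exists>Q \<mu> K. \<mu> > 0 \<and> (\<forall>L\<ge>c. \<bar>S L - poly Q L\<bar> \<le> K * exp (- \<mu> * L))"
proof -
  define R where "R = (\<lambda>k. P (Suc k) - P k)"
  \<comment> \<open>Half of the decay is given up: one factor \<open>\<rho> ^ k\<close> absorbs the
    power of \<open>k\<close>, the other remains.\<close>
  define \<rho> where "\<rho> = sqrt \<theta>"
  have \<rho>: "0 < \<rho>" "\<rho> < 1" "\<rho> * \<rho> = \<theta>" using \<theta> by (auto simp: \<rho>_def)
  have degR: "degree (R k) \<le> d" for k unfolding R_def by (intro degree_diff_le deg)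
  obtain C where C: "C \<ge> 0" "\<And>(p::real poly) \<tau> M t. degree p \<le> d \<Longrightarrow> (\<forall>t\<in>{\<tau>..\<tau> + 1}. \<bar>poly p t\<bar> \<le> M) \<Longrightarrow>
     \<bar>poly p t\<bar> \<le> C * M * (1 + \<bar>t - \<tau>\<bar>) ^ d" using poly_growth[of d] by blast
  obtain C1 where C1: "C1 \<ge> 0" "\<And>(p::real poly) M i. degree p \<le> d \<Longrightarrow> (\<forall>t\<in>{0..1}. \<bar>poly p t\<bar> \<le> M) \<Longrightarrow>
    \<bar>coeff p i\<bar> \<le> C1 * M"
    using poly_coeff_bound[of 0 1 d] by auto
  obtain K0 where K0: "K0 \<ge> 0" "\<And>m. \<rho> ^ m * (1 + c * (real m + 2)) ^ d \<le> K0"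
    using poly_power_geometric_bounded[OF \<rho>(1,2), of c d] c by auto
  define K1 where "K1 = C * (2 * B) * K0"
  have K1: "K1 \<ge> 0" using C(1) B K0(1) by (auto simp: K1_def)
  have R_bound: "\<bar>poly (R k) t\<bar> \<le> K1 * \<rho> ^ k" if t: "0 \<le> t" "t \<le> c * (real k + 2)" for k t
  proof -
    have "\<bar>poly (R k) u\<bar> \<le> 2 * B * \<theta> ^ k" if u: "u \<in> {c * (real k + 2)..c * (real k + 2) + 1}" for u
    proof -
      have u': "c * (real k + 2) \<le> u" "u \<le> c * (real k + 3)" using u c by (auto simp: algebra_simps)
      have "c * (real k + 1) \<le> c * (real k + 2)" "c * (real k + 3) \<le> c * (real (Suc k) + 3)"
        using c by (auto intro: mult_left_mono)
      then have "\<bar>S u - poly (P k) u\<bar> \<le> B * \<theta> ^ k" "\<bar>S u - poly (P (Suc k)) u\<bar> \<le> B * \<theta> ^ Suc k"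
        using u' by (intro approx; simp add: algebra_simps)+
      moreover have "B * \<theta> ^ Suc k \<le> B * \<theta> ^ k" using B \<theta>
        by (intro mult_left_mono power_decreasing) auto
      ultimately show ?thesis unfolding R_def poly_diff by linarith
    qed
    then have "\<bar>poly (R k) t\<bar> \<le> C * (2 * B * \<theta> ^ k) * (1 + \<bar>t - c * (real k + 2)\<bar>) ^ d"
      by (intro C(2) degR) auto
    also have "\<dots> \<le> C * (2 * B * \<theta> ^ k) * (1 + c * (real k + 2)) ^ d"
      using t C(1) B \<theta> by (intro mult_left_mono power_mono) auto
    also have "\<dots> = C * (2 * B) * (\<rho> ^ k * (1 + c * (real k + 2)) ^ d) * \<rho> ^ k"
      unfolding \<rho>(3)[symmetric] power_mult_distrib by (simp only: mult_ac)
    also have "\<dots> \<le> K1 * \<rho> ^ k" unfolding K1_def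
      using C(1) B \<rho> by (intro mult_right_mono mult_left_mono K0) auto
    finally show ?thesis .
  qed
  have geo: "summable (\<lambda>k. \<rho> ^ k)" using \<rho> by (simp add: summable_geometric)
  have "summable (\<lambda>k. coeff (R k) i)" for i
  proof (rule summable_comparison_test[OF _ summable_mult[OF geo]])
    have "\<bar>coeff (R k) i\<bar> \<le> C1 * (K1 * \<rho> ^ k)" for k
    proof (intro C1(2) degR ballI R_bound)
      fix t :: real assume "t \<in> {0..1}"
      moreover have "1 * 1 \<le> c * (real k + 2)" using c by (intro mult_mono) auto
      ultimately show "0 \<le> t" "t \<le> c * (real k + 2)" by auto
    qed
    then show "\<exists>N. \<forall>k\<ge>N. norm (coeff (R k) i) \<le> (C1 * K1) * \<rho> ^ k" by (simp add: mult.assoc)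
  qed
  then have lim: "(\<lambda>k. \<Sum>m<k. coeff (R m) i) \<longlonglongrightarrow> (\<Sum>m. coeff (R m) i)" for i
    by (rule summable_LIMSEQ)
  have tele: "(\<Sum>m<k. poly (R m) t) = poly (P k) t - poly (P 0) t" for k t
    by (induction k) (auto simp: R_def)
  have tele_c: "coeff (P k) i = coeff (P 0) i + (\<Sum>m<k. coeff (R m) i)" for k i
    by (induction k) (auto simp: R_def)
  define q where "q = (\<lambda>i. coeff (P 0) i + (\<Sum>m. coeff (R m) i))"
  have limc: "(\<lambda>k. coeff (P k) i) \<longlonglongrightarrow> q i" for i
    unfolding q_def using tendsto_add[OF tendsto_const lim[of i], of "coeff (P 0) i"]
      by (simp add: tele_c[symmetric])
  define Q where "Q = (\<Sum>i\<le>d. monom (q i) i)"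
  have limP: "(\<lambda>k. poly (P k) t) \<longlonglongrightarrow> poly Q t" for t
  proof -
    have "poly (P k) t = (\<Sum>i\<le>d. coeff (P k) i * t ^ i)" for k
    proof -
      have "poly (P k) t = (\<Sum>i\<le>degree (P k). coeff (P k) i * t ^ i)" by (rule poly_altdef)
      also have "\<dots> = (\<Sum>i\<le>d. coeff (P k) i * t ^ i)"
        using deg[of k] by (intro sum.mono_neutral_left) (auto simp: coeff_eq_0)
      finally show ?thesis .
    qed
    moreover have "poly Q t = (\<Sum>i\<le>d. q i * t ^ i)" by (simp add: Q_def poly_sum poly_monom)
    moreover have "(\<lambda>k. \<Sum>i\<le>d. coeff (P k) i * t ^ i) \<longlonglongrightarrow> (\<Sum>i\<le>d. q i * t ^ i)"
      by (intro tendsto_intros limc)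
    ultimately show ?thesis by simp
  qed
  have PQ: "\<bar>poly Q t - poly (P k) t\<bar> \<le> K1 * \<rho> ^ k / (1 - \<rho>)" if t: "0 \<le> t" "t \<le> c * (real k + 2)"
    for k t
  proof (rule LIMSEQ_le_const2)
    show "(\<lambda>n. \<bar>poly (P (n + k)) t - poly (P k) t\<bar>) \<longlonglongrightarrow> \<bar>poly Q t - poly (P k) t\<bar>"
      by (intro tendsto_intros LIMSEQ_ignore_initial_segment limP)
    show "\<exists>N. \<forall>n\<ge>N. \<bar>poly (P (n + k)) t - poly (P k) t\<bar> \<le> K1 * \<rho> ^ k / (1 - \<rho>)"
    proof (intro exI[of _ 0] allI impI)
      fix n
      have "poly (P (n + k)) t - poly (P k) t = (\<Sum>m<n. poly (R (m + k)) t)"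
        by (induction n) (auto simp: R_def)
      then have "\<bar>poly (P (n + k)) t - poly (P k) t\<bar> \<le> (\<Sum>m<n. \<bar>poly (R (m + k)) t\<bar>)" by simp
      also have "\<dots> \<le> (\<Sum>m<n. K1 * \<rho> ^ k * \<rho> ^ m)"
      proof (intro sum_mono)
        fix m
        have "c * (real k + 2) \<le> c * (real (m + k) + 2)" using c by (intro mult_left_mono) auto
        then have "\<bar>poly (R (m + k)) t\<bar> \<le> K1 * \<rho> ^ (m + k)" using t by (intro R_bound) auto
        then show "\<bar>poly (R (m + k)) t\<bar> \<le> K1 * \<rho> ^ k * \<rho> ^ m" by (simp add: power_add mult_ac)
      qed
      also have "\<dots> = K1 * \<rho> ^ k * (\<Sum>m<n. \<rho> ^ m)" by (simp add: sum_distrib_left)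
      also have "\<dots> \<le> K1 * \<rho> ^ k * (1 / (1 - \<rho>))"
        using sum_le_suminf[OF geo, of "{..<n}"] \<rho> K1
        by (intro mult_left_mono) (auto simp: suminf_geometric)
      finally show "\<bar>poly (P (n + k)) t - poly (P k) t\<bar> \<le> K1 * \<rho> ^ k / (1 - \<rho>)" by simp
    qed
  qed
  define K where "K = B + K1 / (1 - \<rho>)"
  have K: "K \<ge> 0" using B K1 \<rho> by (auto simp: K_def)
  have "\<bar>S L - poly Q L\<bar> \<le> (K / \<rho> ^ 2) * exp (- (- ln \<rho> / c) * L)" if L: "L \<ge> c" for L
  proof -
    \<comment> \<open>With this \<open>k\<close>, \<open>c * (k + 1) \<le> L < c * (k + 2)\<close>:
      \<open>L\<close> lies in the window of \<open>P k\<close> and in the range where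
      \<open>P k\<close> has been compared with \<open>Q\<close>. The subtraction is exact because
      \<open>L \<ge> c\<close>.\<close>
    define k where "k = nat \<lfloor>L / c\<rfloor> - 1"
    have "1 \<le> L / c" using L c by simp
    then have "1 \<le> \<lfloor>L / c\<rfloor>" by simp
    then have rk: "real k = of_int \<lfloor>L / c\<rfloor> - 1"
      by (simp add: k_def of_nat_diff nat_le_iff le_nat_iff)
    have "real k + 1 \<le> L / c" "L / c < real k + 2" unfolding rk by linarith+
    then have k: "c * (real k + 1) \<le> L" "L \<le> c * (real k + 2)" using c by (auto simp: field_simps)
    have "c * (real k + 2) \<le> c * (real k + 3)" using c by (intro mult_left_mono) auto
    then have "\<bar>S L - poly (P k) L\<bar> \<le> B * \<theta> ^ k" using k by (intro approx) auto
    also have "\<dots> \<le> B * \<rho> ^ k"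
    proof -
      have "\<theta> \<le> \<rho>" using \<rho> mult_left_mono[of \<rho> 1 \<rho>] by simp
      then show ?thesis using B \<theta> by (intro mult_left_mono power_mono) auto
    qed
    finally have "\<bar>S L - poly Q L\<bar> \<le> B * \<rho> ^ k + K1 * \<rho> ^ k / (1 - \<rho>)"
      using PQ[of L k] k L c by linarith
    also have "\<dots> = K * \<rho> ^ k" by (simp add: K_def algebra_simps)
    also have "\<dots> \<le> K * (exp (- (- ln \<rho> / c) * L) / \<rho> ^ 2)"
    proof (intro mult_left_mono K)
      have "\<rho> ^ k = \<rho> powr real k" using \<rho> by (simp add: powr_realpow)
      also have "\<dots> \<le> \<rho> powr (L / c - 2)"
        using \<open>L / c < real k + 2\<close> \<rho> by (intro powr_mono') auto
      also have "\<dots> = exp (- (- ln \<rho> / c) * L) / \<rho> ^ 2"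
      proof -
        have "\<rho> powr (L / c - 2) = \<rho> powr (L / c) / \<rho> powr 2" by (rule powr_diff)
        also have "\<rho> powr 2 = \<rho> ^ 2" using \<rho> by simp
        finally show ?thesis using \<rho> by (simp add: powr_def mult.commute)
      qed
      finally show "\<rho> ^ k \<le> exp (- (- ln \<rho> / c) * L) / \<rho> ^ 2" .
    qed
    finally show ?thesis by simp
  qed
  moreover have "- ln \<rho> / c > 0" using \<rho> c by (simp add: divide_neg_pos)
  ultimately show ?thesis by blast
qed

section \<open>Multiplicative functions of several variables\<close>

locale index_set =
  fixes N :: "nat set"
  assumes finite_N: "finite N" and N_nonempty: "N \<noteq> {}"
begin

definition posv :: "(nat \<Rightarrow> nat) set" where "posv = N \<rightarrow>\<^sub>E {1..}"
definition pbox :: "nat \<Rightarrow> (nat \<Rightarrow> nat) set" where "pbox X = N \<rightarrow>\<^sub>E {1..X}"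
definition expv :: "(nat \<Rightarrow> nat) set" where "expv = N \<rightarrow>\<^sub>E UNIV"
definition ebox :: "nat \<Rightarrow> (nat \<Rightarrow> nat) set" where "ebox Y = N \<rightarrow>\<^sub>E {..Y}"
definition expo :: "nat \<Rightarrow> (nat \<Rightarrow> nat) \<Rightarrow> nat \<Rightarrow> nat" where "expo p m = (\<lambda>j\<in>N. multiplicity p (m j))"
definition supp_primes :: "(nat \<Rightarrow> nat) \<Rightarrow> nat set"
  where "supp_primes m = {p. prime p \<and> (\<exists>j\<in>N. p dvd m j)}"
definition mfun :: "(nat \<Rightarrow> (nat \<Rightarrow> nat) \<Rightarrow> real) \<Rightarrow> (nat \<Rightarrow> nat) \<Rightarrow> real" where
  "mfun a m = (\<Prod>p\<in>supp_primes m. a p (expo p m))"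
text \<open>With this normalisation, primes outside \<open>supp_primes\<close> contribute a factor
  1, so the product in \<open>mfun\<close> may run over any larger finite set of primes.\<close>

definition unital :: "(nat \<Rightarrow> (nat \<Rightarrow> nat) \<Rightarrow> real) \<Rightarrow> bool" where "unital a \<longleftrightarrow> (\<forall>p. a p (\<lambda>j\<in>N. 0) = 1)"
definition lower :: "(nat \<Rightarrow> nat) \<Rightarrow> nat set \<Rightarrow> nat \<Rightarrow> nat \<Rightarrow> nat"
  where "lower k s e = (\<lambda>j. if j \<in> s then k j - e else k j)"
definition quot :: "(nat \<Rightarrow> nat) \<Rightarrow> nat set \<Rightarrow> nat \<Rightarrow> nat \<Rightarrow> nat"
  where "quot m s d = (\<lambda>j. if j \<in> s then m j div d else m j)"
text \<open>If \<open>a p\<close> is the coefficient function of a power series in the variables \<open>X\<^sub>j\<close>, then \<open>step s a p\<close> is that of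
  its product with \<open>1 - (\<Prod>j\<in>s. X\<^sub>j) / p\<close>.\<close>
definition step :: "nat set \<Rightarrow> (nat \<Rightarrow> (nat \<Rightarrow> nat) \<Rightarrow> real) \<Rightarrow> nat \<Rightarrow> (nat \<Rightarrow> nat) \<Rightarrow> real" where
  "step s a p k = a p k - (if \<forall>j\<in>s. 1 \<le> k j then a p (lower k s 1) / real p else 0)"
primrec steps :: "nat set list \<Rightarrow> (nat \<Rightarrow> (nat \<Rightarrow> nat) \<Rightarrow> real) \<Rightarrow> nat \<Rightarrow> (nat \<Rightarrow> nat) \<Rightarrow> real" where
  "steps [] a = a"
| "steps (s # J) a = step s (steps J a)"

definition primes_upto :: "nat \<Rightarrow> nat set" where "primes_upto X = {p. prime p \<and> p \<le> X}"

lemma finite_primes_upto [simp]: "finite (primes_upto X)"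
  by (rule finite_subset[of _ "{..X}"]) (auto simp: primes_upto_def)

lemma posv_pos: "m \<in> posv \<Longrightarrow> j \<in> N \<Longrightarrow> 0 < m j"
  unfolding posv_def by (drule (1) PiE_mem) simp

lemma pbox_subset_posv: "pbox X \<subseteq> posv"
  unfolding pbox_def posv_def by (intro PiE_mono) auto

lemma finite_pbox [simp]: "finite (pbox X)"
  unfolding pbox_def by (intro finite_PiE finite_N) auto

lemma finite_ebox [simp]: "finite (ebox Y)"
  unfolding ebox_def by (intro finite_PiE finite_N) auto

lemma finite_supp_primes: "m \<in> posv \<Longrightarrow> finite (supp_primes m)"
proof -
  assume m: "m \<in> posv"
  have "supp_primes m \<subseteq> (\<Union>j\<in>N. {..m j})"
  proof
    fix p assume "p \<in> supp_primes m"
    then obtain j where "j \<in> N" "p dvd m j" by (auto simp: supp_primes_def)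
    then show "p \<in> (\<Union>j\<in>N. {..m j})" using posv_pos[OF m] dvd_imp_le[of p "m j"] by auto
  qed
  then show ?thesis by (rule finite_subset) (use finite_N in auto)
qed

lemma supp_primes_pbox: "m \<in> pbox X \<Longrightarrow> supp_primes m \<subseteq> primes_upto X"
proof
  fix p assume m: "m \<in> pbox X" and "p \<in> supp_primes m"
  then obtain j where j: "prime p" "j \<in> N" "p dvd m j" by (auto simp: supp_primes_def)
  have "0 < m j" "m j \<le> X" using m j(2) by (auto simp: pbox_def PiE_iff)
  then show "p \<in> primes_upto X" using j dvd_imp_le[of p "m j"] by (auto simp: primes_upto_def)
qed

lemma expo_mem: "expo p m \<in> expv" by (simp add: expo_def expv_def)

lemma expo_zero: "prime p \<Longrightarrow> p \<notin> supp_primes m \<Longrightarrow> expo p m = (\<lambda>j\<in>N. 0)"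
  unfolding expo_def supp_primes_def
    by (intro restrict_ext) (auto intro: not_dvd_imp_multiplicity_0)

lemma mfun_eq:
  assumes "unital a" "finite P" "\<And>p. p \<in> P \<Longrightarrow> prime p" "supp_primes m \<subseteq> P"
  shows "mfun a m = (\<Prod>p\<in>P. a p (expo p m))"
  unfolding mfun_def using assms expo_zero by (intro prod.mono_neutral_left) (auto simp: unital_def)

lemma unital_step: "unital a \<Longrightarrow> s \<noteq> {} \<Longrightarrow> s \<subseteq> N \<Longrightarrow> unital (step s a)"
  by (force simp: unital_def step_def)

lemma unital_steps: "unital a \<Longrightarrow> (\<And>s. s \<in> set J \<Longrightarrow> s \<noteq> {} \<and> s \<subseteq> N) \<Longrightarrow> unital (steps J a)"
  by (induction J) (auto intro: unital_step)

section \<open>Convolution identities: dividing out one zeta factor at a time\<close>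

lemma step_telescope:
  assumes "s \<noteq> {}" "\<And>j. j \<in> s \<Longrightarrow> u \<le> k j"
  shows "(\<Sum>e<u. step s a p (lower k s e) / real p ^ e) = a p k - a p (lower k s u) / real p ^ u"
  using assms(2)
proof (induction u)
  case 0
  have "lower k s 0 = k" by (auto simp: lower_def)
  then show ?case by simp
next
  case (Suc u)
  have "\<forall>j\<in>s. 1 \<le> lower k s u j" using Suc.prems by (force simp: lower_def)
  moreover have "lower (lower k s u) s 1 = lower k s (Suc u)" by (auto simp: lower_def)
  ultimately have "step s a p (lower k s u) = a p (lower k s u) - a p (lower k s (Suc u)) / real p"
    by (simp add: step_def)
  moreover have "(\<Sum>e<u. step s a p (lower k s e) / real p ^ e) =
    a p k - a p (lower k s u) / real p ^ u"
    using Suc.prems Suc_leD by (intro Suc.IH) blast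
  ultimately show ?case by (simp add: diff_divide_distrib)
qed

text \<open>Multiplication by the geometric series undoes \<open>step\<close>. The series stops at
  the least exponent in \<open>s\<close>: after that many subtractions some coordinate is 0, so
  \<open>step\<close> removes nothing more and the telescoping sum closes.\<close>

lemma step_inverse:
  assumes s: "s \<noteq> {}" "finite s"
  shows "a p k = (\<Sum>e\<le>Min (k ` s). step s a p (lower k s e) / real p ^ e)"
proof -
  define u where "u = Min (k ` s)"
  have le: "u \<le> k j" if "j \<in> s" for j using s that by (auto simp: u_def)
  have "u \<in> k ` s" unfolding u_def using s by (intro Min_in) auto
  then obtain j where j: "j \<in> s" "k j = u" by auto
  then have "\<not> (\<forall>j\<in>s. 1 \<le> lower k s u j)" by (force simp: lower_def)
  then have "step s a p (lower k s u) = a p (lower k s u)" by (auto simp: step_def)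
  then show ?thesis
    using step_telescope[OF s(1) le] by (simp add: u_def[symmetric] lessThan_Suc_atMost[symmetric])
qed

text \<open>The local identity \<open>step_inverse\<close> is multiplied out over the primes:
  choosing an exponent \<open>g p\<close> up to the minimum over \<open>s\<close> for each prime
  amounts to choosing a common divisor \<open>d\<close> of the \<open>m j\<close> with
  \<open>j \<in> s\<close>. In terms of Dirichlet series, one factor zeta at 1 plus the sum of the
  variables in \<open>s\<close> is split off.\<close>

lemma mfun_step:
  assumes m: "m \<in> posv" and s: "s \<noteq> {}" "s \<subseteq> N" and a: "unital a"
  shows "mfun a m = (\<Sum>d | \<forall>j\<in>s. d dvd m j. mfun (step s a) (quot m s d) / real d)"
proof -
  define P where "P = supp_primes m"
  define v where "v = (\<lambda>p. Min (expo p m ` s))"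
  define J where "J = (\<lambda>g. \<Prod>p\<in>P. p ^ g p :: nat)"
  have fs: "finite s" using s finite_N by (auto intro: finite_subset)
  have P: "finite P" "\<And>p. p \<in> P \<Longrightarrow>
    prime p" using finite_supp_primes[OF m] by (auto simp: P_def supp_primes_def)
  have mpos: "0 < m j" if "j \<in> N" for j using posv_pos[OF m that] .
  have Jpos: "0 < J g" for g using P by (auto simp: J_def prime_gt_0_nat intro!: prod_pos)
  have Jmult: "multiplicity p (J g) = (if p \<in> P then g p else 0)" if "prime p" for p g
    unfolding J_def using P that by (intro multiplicity_prod_prime_powers) auto
  have v_le: "v p \<le> multiplicity p (m j)" if "j \<in> s" for p j
  proof -
    have "v p \<le> expo p m j" unfolding v_def using that fs by (intro Min_le) auto
    then show ?thesis using that s by (auto simp: expo_def)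
  qed
  have dP: "p \<in> P" if "\<forall>j\<in>s. d dvd m j" "prime p" "p dvd d" for p d
    using that s by (auto simp: P_def supp_primes_def intro: dvd_trans)
  have dpos: "0 < d" if "\<forall>j\<in>s. d dvd m j" for d
    using that s mpos by (metis all_not_in_conv dvd_0_left_iff gr0I less_irrefl subsetD)
  have Jd: "J (\<lambda>p\<in>P. multiplicity p d) = d" if "\<forall>j\<in>s. d dvd m j" for d
  proof (rule multiplicity_eq_nat[OF Jpos dpos[OF that]])
    fix p :: nat assume "prime p"
    have "multiplicity p d = 0" if "p \<notin> P"
      using dP[OF \<open>\<forall>j\<in>s. d dvd m j\<close> \<open>prime p\<close>] that not_dvd_imp_multiplicity_0[of p d] by blast
    then show "multiplicity p (J (\<lambda>p\<in>P. multiplicity p d)) = multiplicity p d"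
      using Jmult[OF \<open>prime p\<close>] by simp
  qed
  have "mfun a m = (\<Prod>p\<in>P. \<Sum>e\<in>{..v p}. step s a p (lower (expo p m) s e) / real p ^ e)"
    unfolding mfun_def P_def[symmetric] v_def by (intro prod.cong refl step_inverse s fs)
  also have "\<dots> = (\<Sum>g\<in>PiE P (\<lambda>p. {..v p}). \<Prod>p\<in>P. step s a p (lower (expo p m) s (g p)) / real p ^ g p)"
    by (intro prod_sum_PiE P) auto
  also have "\<dots> = (\<Sum>d | \<forall>j\<in>s. d dvd m j. mfun (step s a) (quot m s d) / real d)"
  proof (rule sum.reindex_bij_witness[of _ "\<lambda>d. \<lambda>p\<in>P. multiplicity p d" J])
    fix g assume g: "g \<in> PiE P (\<lambda>p. {..v p})"
    show "(\<lambda>p\<in>P. multiplicity p (J g)) = g"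
      using g P by (intro ext) (auto simp: Jmult PiE_iff extensional_def restrict_def)
    have dvd: "\<forall>j\<in>s. J g dvd m j"
    proof
      fix j assume j: "j \<in> s"
      show "J g dvd m j"
      proof (rule multiplicity_le_imp_dvd)
        fix p :: nat assume "prime p"
        show "multiplicity p (J g) \<le> multiplicity p (m j)"
          using g v_le[OF j, of p] by (auto simp: Jmult[OF \<open>prime p\<close>] PiE_iff intro: order.trans)
      qed (use Jpos[of g] in simp)
    qed
    then show "J g \<in> {d. \<forall>j\<in>s. d dvd m j}" by simp
    define d where "d = J g"
    have d: "\<forall>j\<in>s. d dvd m j" "0 < d" using dvd Jpos by (auto simp: d_def)
    have sub: "supp_primes (quot m s d) \<subseteq> P"
    proof
      fix p assume "p \<in> supp_primes (quot m s d)"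
      then obtain j where j: "prime p" "j \<in> N" "p dvd quot m s d j" by (auto simp: supp_primes_def)
      have "quot m s d j dvd m j" using d by (auto simp: quot_def div_dvd_iff_mult)
      then show "p \<in> P" using j by (auto simp: P_def supp_primes_def intro: dvd_trans)
    qed
    have expo_quot: "expo p (quot m s d) = lower (expo p m) s (g p)" if "p \<in> P" for p
    proof
      fix j
      show "expo p (quot m s d) j = lower (expo p m) s (g p) j"
      proof (cases "j \<in> s")
        case True
        then obtain q where q: "m j = d * q" using d by auto
        have "j \<in> N" using True s by auto
        then have "q \<noteq> 0" using mpos[of j] q by auto
        then have "multiplicity p (m j) = g p + multiplicity p q"
          using d(2) that Jmult[OF P(2)[OF that], of g]
            prime_elem_multiplicity_mult_distrib[OF prime_imp_prime_elem[OF P(2)[OF that]], of d q]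
          by (simp add: q d_def[symmetric])
        then show ?thesis using True \<open>j \<in> N\<close> q d(2) by (simp add: expo_def quot_def lower_def)
      next
        case False
        then show ?thesis by (simp add: expo_def quot_def lower_def restrict_def)
      qed
    qed
    have "mfun (step s a) (quot m s d) = (\<Prod>p\<in>P. step s a p (expo p (quot m s d)))"
      by (intro mfun_eq unital_step a s P sub)
    also have "\<dots> = (\<Prod>p\<in>P. step s a p (lower (expo p m) s (g p)))"
      by (intro prod.cong refl) (simp add: expo_quot)
    finally show "mfun (step s a) (quot m s (J g)) / real (J g) =
      (\<Prod>p\<in>P. step s a p (lower (expo p m) s (g p)) / real p ^ g p)"
      by (simp add: prod_dividef d_def J_def of_nat_prod)
  next
    fix d assume "d \<in> {d. \<forall>j\<in>s. d dvd m j}"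
    then have d: "\<forall>j\<in>s. d dvd m j" by simp
    show "J (\<lambda>p\<in>P. multiplicity p d) = d" by (rule Jd[OF d])
    show "(\<lambda>p\<in>P. multiplicity p d) \<in> PiE P (\<lambda>p. {..v p})"
    proof (rule restrict_PiE_iff[THEN iffD2], intro ballI)
      fix p assume "p \<in> P"
      have "multiplicity p d \<le> expo p m j" if "j \<in> s" for j
        using that d s mpos[of j] by (auto simp: expo_def intro!: dvd_imp_multiplicity_le)
      then show "multiplicity p d \<in> {..v p}" using s fs by (auto simp: v_def)
    qed
  qed
  finally show ?thesis .
qed

text \<open>The local coefficients can be negative, so the convolution is rearranged in finite real
  sums. By \<open>iter_sumop_eq_trunc_sum\<close> the cut-off at \<open>X\<close> loses nothing
  while the budgets are below ln (X + 1).\<close>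

primrec trunc_sum :: "nat \<Rightarrow> nat set list \<Rightarrow> (nat \<Rightarrow> real) \<Rightarrow> real" where
  "trunc_sum X [] l = (if \<forall>j\<in>N. 0 \<le> l j then 1 else 0)"
| "trunc_sum X (s # J) l = (\<Sum>d=1..X. trunc_sum X J (shift l s (ln (real d))) / real d)"

lemma trunc_sum_eq_0: "j \<in> N \<Longrightarrow> l j < 0 \<Longrightarrow> trunc_sum X J l = 0"
proof (induction J arbitrary: l)
  case (Cons s J)
  have "trunc_sum X J (shift l s (ln (real d))) = 0" if "d \<in> {1..X}" for d
    using Cons.prems that by (intro Cons.IH) (auto simp: shift_def intro: less_le_trans[OF _ ln_ge_zero])
  then show ?case by simp
qed force

lemma trunc_sum_nonneg: "0 \<le> trunc_sum X J l"
  by (induction J arbitrary: l) (auto intro!: sum_nonneg)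

lemma iter_sumop_eq_trunc_sum:
  assumes J: "\<And>s. s \<in> set J \<Longrightarrow> s \<noteq> {} \<and> s \<subseteq> N" and l: "\<And>j. j \<in> N \<Longrightarrow> l j < ln (real (Suc X))"
  shows "iter sumop N J l = ennreal (trunc_sum X J l)"
  using J l
proof (induction J arbitrary: l)
  case Nil
  then show ?case by simp
next
  case (Cons s J)
  obtain j where j: "j \<in> s" "j \<in> N" using Cons.prems(1)[of s] by auto
  have "iter sumop N (s # J) l =
    (\<Sum>i. ennreal (1 / real (Suc i)) * iter sumop N J (shift l s (ln (real (Suc i)))))"
    by (simp only: iter.simps sumop_def)
  also have "\<dots> = (\<Sum>i<X. ennreal (1 / real (Suc i)) *
    iter sumop N J (shift l s (ln (real (Suc i)))))"
  proof (rule suminf_finite)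
    fix i assume "i \<notin> {..<X}"
    then have "ln (real (Suc X)) \<le> ln (real (Suc i))" by simp
    then have "iter sumop N J (shift l s (ln (real (Suc i)))) = 0"
      using Cons.prems(2)[OF j(2)] j less_le_trans
      by (intro iter_eq_0[OF mono_sumop j(2)]) (fastforce simp: shift_def simp del: of_nat_Suc)
    then show "ennreal (1 / real (Suc i)) * iter sumop N J (shift l s (ln (real (Suc i)))) = 0"
      by simp
  qed auto
  also have "\<dots> = (\<Sum>i<X. ennreal (trunc_sum X J (shift l s (ln (real (Suc i)))) / real (Suc i)))"
  proof (intro sum.cong refl)
    fix i
    have "iter sumop N J (shift l s (ln (real (Suc i)))) =
      ennreal (trunc_sum X J (shift l s (ln (real (Suc i)))))"
    proof (rule Cons.IH)
      fix j assume "j \<in> N"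
      moreover have "0 \<le> ln (real (Suc i))" by simp
      ultimately show "shift l s (ln (real (Suc i))) j < ln (real (Suc X))"
        using Cons.prems(2)[of j] unfolding shift_def
          by (cases "j \<in> s"; simp only: if_True if_False; linarith)
    qed (use Cons.prems in auto)
    then show "ennreal (1 / real (Suc i)) * iter sumop N J (shift l s (ln (real (Suc i)))) =
      ennreal (trunc_sum X J (shift l s (ln (real (Suc i)))) / real (Suc i))"
      using trunc_sum_nonneg by (simp add: ennreal_mult'[symmetric] del: of_nat_Suc)
  qed
  also have "\<dots> = ennreal (\<Sum>i<X. trunc_sum X J (shift l s (ln (real (Suc i)))) / real (Suc i))"
    by (intro sum_ennreal) (auto intro: trunc_sum_nonneg divide_nonneg_nonneg)
  also have "(\<Sum>i<X. trunc_sum X J (shift l s (ln (real (Suc i)))) / real (Suc i)) =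
    trunc_sum X (s # J) l"
    unfolding trunc_sum.simps by (rule sum.reindex_bij_witness[of _ "\<lambda>d. d - 1" Suc]) auto
  finally show ?case .
qed

text \<open>In \<open>mfun_step\<close>, write \<open>m j\<close> as \<open>d\<close> times a new
  coordinate for \<open>j \<in> s\<close>. Pairs for which such a product exceeds \<open>X\<close>
  do not come from the box, but they may be added, since their budget is negative and
  \<open>g\<close> vanishes. This decouples the quotient from \<open>d\<close>.\<close>

lemma sum_mfun_step:
  assumes s: "s \<noteq> {}" "s \<subseteq> N" and a: "unital a" and l: "\<And>j. j \<in> N \<Longrightarrow> l j < ln (real (Suc X))"
    and g: "\<And>u j. j \<in> N \<Longrightarrow> u j < 0 \<Longrightarrow> g u = 0"
  shows "(\<Sum>m\<in>pbox X. mfun a m * g (\<lambda>j. l j - ln (real (m j)))) =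
    (\<Sum>m\<in>pbox X. mfun (step s a) m *
      (\<Sum>d=1..X. g (shift (\<lambda>j. l j - ln (real (m j))) s (ln (real d))) / real d))"
proof -
  obtain j0 where j0: "j0 \<in> s" "j0 \<in> N" using s by auto
  define A where "A = (SIGMA m:pbox X. {d. \<forall>j\<in>s. d dvd m j})"
  define B where "B = {(m, d). m \<in> pbox X \<and> d \<in> {1..X} \<and> (\<forall>j\<in>s. m j * d \<le> X)}"
  define G where "G = (\<lambda>(m, d). mfun (step s a) m *
    (g (shift (\<lambda>j. l j - ln (real (m j))) s (ln (real d))) / real d))"
  have fin: "finite {d. \<forall>j\<in>s. d dvd m j}" if "m \<in> pbox X" for m
  proof (rule finite_subset)
    show "{d. \<forall>j\<in>s. d dvd m j} \<subseteq> {d. d dvd m j0}" using j0 by auto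
    show "finite {d. d dvd m j0}" using that j0
      by (intro finite_divisors_nat) (auto simp: pbox_def PiE_iff)
  qed
  have "(\<Sum>m\<in>pbox X. mfun a m * g (\<lambda>j. l j - ln (real (m j)))) =
    (\<Sum>m\<in>pbox X. \<Sum>d | \<forall>j\<in>s. d dvd m j. mfun (step s a) (quot m s d) / real d *
      g (\<lambda>j. l j - ln (real (m j))))"
    using mfun_step[OF subsetD[OF pbox_subset_posv] s a]
      by (intro sum.cong refl) (simp add: sum_distrib_right)
  also have "\<dots> = (\<Sum>(m, d)\<in>A. mfun (step s a) (quot m s d) / real d * g (\<lambda>j. l j - ln (real (m j))))"
    unfolding A_def by (intro sum.Sigma ballI fin) auto
  also have "\<dots> = (\<Sum>x\<in>B. G x)"
  proof (rule sum.reindex_bij_witness[of _ "\<lambda>(m, d). (\<lambda>j. if j \<in> s then m j * d else m j, d)"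
    "\<lambda>(m, d). (quot m s d, d)"])
    fix x assume x: "x \<in> A"
    obtain m d where xe: "x = (m, d)" by (cases x)
    have m: "m \<in> pbox X" "\<And>j. j \<in> s \<Longrightarrow> d dvd m j" using x by (auto simp: A_def xe)
    have mj: "0 < m j" "m j \<le> X" if "j \<in> N" for j using m(1) that by (auto simp: pbox_def PiE_iff)
    have d: "0 < d" "d \<le> X" using m(2)[OF j0(1)] mj[OF j0(2)]
      by (auto intro: dvd_pos_nat dest: dvd_imp_le)
    have eq: "quot m s d j * d = m j" if "j \<in> s" for j using m(2)[OF that] that
      by (simp add: quot_def)
    have eq': "(\<lambda>j. if j \<in> s then quot m s d j * d else quot m s d j) = m" using eq
      by (auto simp: quot_def)
    show "(case (case x of (m, d) \<Rightarrow> (quot m s d, d)) of (m, d) \<Rightarrow> (\<lambda>j. if j \<in> s then m j *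
      d else m j, d)) = x"
      using eq' by (simp add: xe)
    have pos: "0 < quot m s d j" "quot m s d j \<le> X" if "j \<in> N" for j
    proof -
      show "0 < quot m s d j" using eq[of j] mj[OF that]
        by (cases "j \<in> s") (auto simp: quot_def intro: gr0I)
      show "quot m s d j \<le> X" using mj[OF that]
        by (auto simp: quot_def intro: order.trans[OF div_le_dividend])
    qed
    have "quot m s d \<in> pbox X"
    proof -
      have "quot m s d j = undefined" if "j \<notin> N" for j
        using that m(1) s by (auto simp: quot_def pbox_def PiE_iff extensional_def)
      then show ?thesis using pos by (simp add: pbox_def PiE_iff extensional_def Suc_le_eq)
    qed
    then show "(case x of (m, d) \<Rightarrow> (quot m s d, d)) \<in> B" using d eq mj s by (auto simp: xe B_def)
    have "shift (\<lambda>j. l j - ln (real (quot m s d j))) s (ln (real d)) j = l j - ln (real (m j))"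
      if "j \<in> N" for j
    proof (cases "j \<in> s")
      case True
      have "ln (real (m j)) = ln (real (quot m s d j)) + ln (real d)"
        unfolding eq[OF True, symmetric] of_nat_mult using pos[OF that] d
          by (intro ln_mult_pos) auto
      then show ?thesis using True by (simp add: shift_def)
    qed (simp add: shift_def quot_def)
    moreover have "shift (\<lambda>j. l j - ln (real (quot m s d j))) s (ln (real d)) j =
      l j - ln (real (m j))" if "j \<notin> N" for j
      using that s by (auto simp: shift_def quot_def)
    ultimately have "shift (\<lambda>j. l j - ln (real (quot m s d j))) s (ln (real d)) =
      (\<lambda>j. l j - ln (real (m j)))" by blast
    then show "G (case x of (m, d) \<Rightarrow> (quot m s d, d)) =
      (case x of (m, d) \<Rightarrow> mfun (step s a) (quot m s d) / real d * g (\<lambda>j. l j - ln (real (m j))))"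
      by (simp add: xe G_def)
  next
    fix x assume x: "x \<in> B"
    obtain m d where xe: "x = (m, d)" by (cases x)
    have m: "m \<in> pbox X" "0 < d" "d \<le> X" "\<And>j. j \<in> s \<Longrightarrow> m j * d \<le> X" using x by (auto simp: B_def xe)
    have "quot (\<lambda>j. if j \<in> s then m j * d else m j) s d = m" using m(2) by (auto simp: quot_def)
    then show "(case (case x of (m, d) \<Rightarrow> (\<lambda>j. if j \<in> s then m j * d else m j, d)) of (m,
      d) \<Rightarrow> (quot m s d, d)) = x"
      by (simp add: xe)
    have "(\<lambda>j. if j \<in> s then m j * d else m j) \<in> pbox X"
      using m s by (auto simp: pbox_def PiE_iff extensional_def Suc_le_eq)
    then show "(case x of (m, d) \<Rightarrow> (\<lambda>j. if j \<in> s then m j * d else m j, d)) \<in> A"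
      by (auto simp: xe A_def)
  qed
  also have "\<dots> = (\<Sum>x\<in>pbox X \<times> {1..X}. G x)"
  proof (rule sum.mono_neutral_left)
    show "\<forall>x\<in>pbox X \<times> {1..X} - B. G x = 0"
    proof
      fix x assume x: "x \<in> pbox X \<times> {1..X} - B"
      obtain m d where xe: "x = (m, d)" by (cases x)
      obtain j where j: "j \<in> s" "X < m j * d" using x by (auto simp: xe B_def not_le)
      have jN: "j \<in> N" using j s by auto
      have pos: "0 < m j" "0 < d" using x jN by (auto simp: xe pbox_def PiE_iff)
      have "real (Suc X) \<le> real (m j * d)" using j(2) by (intro of_nat_mono) simp
      then have "ln (real (Suc X)) \<le> ln (real (m j * d))" by (intro ln_mono) auto
      also have "\<dots> = ln (real (m j)) + ln (real d)" unfolding of_nat_mult using pos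
        by (intro ln_mult_pos) auto
      finally have "l j - ln (real (m j)) - ln (real d) < 0" using l[OF jN] by linarith
      then have "g (shift (\<lambda>j. l j - ln (real (m j))) s (ln (real d))) = 0"
        using j by (intro g[OF jN]) (simp add: shift_def)
      then show "G x = 0" by (simp add: G_def xe)
    qed
  qed (auto simp: B_def)
  also have "\<dots> = (\<Sum>m\<in>pbox X. \<Sum>d=1..X. G (m, d))" by (simp add: sum.cartesian_product)
  finally show ?thesis by (simp add: G_def sum_distrib_left)
qed

lemma sum_mfun_steps:
  assumes a: "unital a" and l: "\<And>j. j \<in> N \<Longrightarrow> l j < ln (real (Suc X))"
    and J: "\<And>s. s \<in> set J \<Longrightarrow> s \<noteq> {} \<and> s \<subseteq> N"
  shows "(\<Sum>m\<in>pbox X. mfun a m * trunc_sum X [] (\<lambda>j. l j - ln (real (m j)))) =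
    (\<Sum>m\<in>pbox X. mfun (steps J a) m * trunc_sum X J (\<lambda>j. l j - ln (real (m j))))"
  using J
proof (induction J)
  case (Cons s J)
  have "(\<Sum>m\<in>pbox X. mfun (steps J a) m * trunc_sum X J (\<lambda>j. l j - ln (real (m j)))) =
    (\<Sum>m\<in>pbox X. mfun (steps (s # J) a) m * trunc_sum X (s # J) (\<lambda>j. l j - ln (real (m j))))"
    unfolding trunc_sum.simps steps.simps using Cons.prems
    by (intro sum_mfun_step unital_steps a l) (auto intro: trunc_sum_eq_0)
  then show ?case using Cons by simp
qed simp

section \<open>The local coefficients of 1/lcm\<close>

definition maxn :: "(nat \<Rightarrow> nat) \<Rightarrow> nat" where "maxn k = Max (k ` N)"
definition lcm_local :: "nat \<Rightarrow> (nat \<Rightarrow> nat) \<Rightarrow> real" where "lcm_local p k = 1 / real p ^ maxn k"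

lemma maxn_zero: "maxn (\<lambda>j\<in>N. 0) = 0"
proof -
  have "(\<lambda>j\<in>N. 0::nat) ` N = {0}" using N_nonempty by auto
  then show ?thesis by (simp add: maxn_def)
qed

lemma maxn_ge: "j \<in> N \<Longrightarrow> k j \<le> maxn k"
  using finite_N by (simp add: maxn_def)

lemma maxn_le_iff: "maxn k \<le> c \<longleftrightarrow> (\<forall>j\<in>N. k j \<le> c)"
  using finite_N N_nonempty by (simp add: maxn_def)

lemma maxn_attained: "\<exists>j\<in>N. k j = maxn k"
proof -
  have "maxn k \<in> k ` N" unfolding maxn_def using finite_N N_nonempty by (intro Max_in) auto
  then show ?thesis by auto
qed

lemma unital_lcm_local: "unital lcm_local"
  by (simp add: unital_def lcm_local_def maxn_zero)

lemma Lcm_eq_prod: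
  assumes m: "m \<in> posv" and P: "finite P" "\<And>p. p \<in> P \<Longrightarrow> prime p" "supp_primes m \<subseteq> P"
  shows "Lcm (m ` N) = (\<Prod>p\<in>P. p ^ maxn (expo p m))"
proof (rule dvd_antisym)
  have "0 \<notin> m ` N" using posv_pos[OF m] by force
  then have Lcm0: "Lcm (m ` N) \<noteq> 0" using finite_N by (simp add: Lcm_0_iff)
  have pos: "(\<Prod>p\<in>P. p ^ maxn (expo p m)) \<noteq> 0" using P by (force simp: prime_gt_0_nat)
  have mult: "multiplicity q (\<Prod>p\<in>P. p ^ maxn (expo p m)) = (if q \<in> P then maxn (expo q m) else 0)"
    if "prime q" for q
    using P that by (intro multiplicity_prod_prime_powers) auto
  have z: "multiplicity q (m j) = 0" if "prime q" "q \<notin> P" "j \<in> N" for q j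
    using that P(3) by (auto simp: supp_primes_def intro: not_dvd_imp_multiplicity_0)
  show "Lcm (m ` N) dvd (\<Prod>p\<in>P. p ^ maxn (expo p m))"
  proof (intro Lcm_least)
    fix x assume "x \<in> m ` N"
    then obtain j where j: "j \<in> N" "x = m j" by auto
    show "x dvd (\<Prod>p\<in>P. p ^ maxn (expo p m))"
    proof (rule multiplicity_le_imp_dvd)
      show "x \<noteq> 0" using posv_pos[OF m j(1)] j by simp
      fix q :: nat assume q: "prime q"
      show "multiplicity q x \<le> multiplicity q (\<Prod>p\<in>P. p ^ maxn (expo p m))"
        using maxn_ge[OF j(1), of "expo q m"] z[OF q _ j(1)] j unfolding mult[OF q]
          by (auto simp: expo_def)
    qed
  qed
  show "(\<Prod>p\<in>P. p ^ maxn (expo p m)) dvd Lcm (m ` N)"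
  proof (rule multiplicity_le_imp_dvd[OF pos])
    fix q :: nat assume q: "prime q"
    obtain j where j: "j \<in> N" "expo q m j = maxn (expo q m)" using maxn_attained by blast
    have "multiplicity q (m j) \<le> multiplicity q (Lcm (m ` N))"
      using Lcm0 j by (intro dvd_imp_multiplicity_le) (auto intro: dvd_Lcm)
    then show "multiplicity q (\<Prod>p\<in>P. p ^ maxn (expo p m)) \<le> multiplicity q (Lcm (m ` N))"
      using j unfolding mult[OF q] by (auto simp: expo_def)
  qed
qed

lemma mfun_lcm_local: "m \<in> posv \<Longrightarrow> mfun lcm_local m = 1 / real (Lcm (m ` N))"
  using Lcm_eq_prod[OF _ finite_supp_primes]
    by (simp add: mfun_def lcm_local_def prod_dividef supp_primes_def)

end

section \<open>Unordered sums as limits along growing boxes\<close>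

lemma exhaust_tendsto:
  assumes f: "(f has_sum S) A" and fin: "\<And>Y. finite (F Y)" and sub: "\<And>Y. F Y \<subseteq> A"
    and mono: "\<And>Y Y'. Y \<le> Y' \<Longrightarrow> F Y \<subseteq> F Y'"
    and cover: "\<And>G. finite G \<Longrightarrow> G \<subseteq> A \<Longrightarrow> \<exists>Y. G \<subseteq> F Y"
  shows "(\<lambda>Y::nat. sum f (F Y)) \<longlonglongrightarrow> S"
proof -
  have "filterlim F (finite_subsets_at_top A) sequentially"
    unfolding filterlim_finite_subsets_at_top
  proof (intro allI impI)
    fix G assume "finite G \<and> G \<subseteq> A"
    then obtain Y where "G \<subseteq> F Y" using cover by blast
    then show "\<forall>\<^sub>F Y in sequentially. finite (F Y) \<and> G \<subseteq> F Y \<and> F Y \<subseteq> A"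
      unfolding eventually_sequentially using fin sub mono by blast
  qed
  then show ?thesis using f unfolding has_sum_def by (rule filterlim_compose[rotated])
qed

lemma exhaust_bounded:
  fixes f :: "'a \<Rightarrow> real"
  assumes pos: "\<And>x. x \<in> A \<Longrightarrow> 0 \<le> f x" and fin: "\<And>Y. finite (F Y)" and sub: "\<And>Y. F Y \<subseteq> A"
    and cover: "\<And>G. finite G \<Longrightarrow> G \<subseteq> A \<Longrightarrow> \<exists>Y. G \<subseteq> F Y"
    and bound: "\<And>Y::nat. sum f (F Y) \<le> C"
  shows "f summable_on A" "infsum f A \<le> C"
proof -
  have le: "sum f G \<le> C" if G: "finite G" "G \<subseteq> A" for G
  proof -
    obtain Y where Y: "G \<subseteq> F Y" using cover[OF G] by blast
    have "sum f G \<le> sum f (F Y)" using sub[of Y] pos by (intro sum_mono2 fin Y) blast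
    then show ?thesis using bound[of Y] by simp
  qed
  show *: "f summable_on A"
    by (rule nonneg_bdd_above_summable_on[OF pos]) (auto intro!: bdd_aboveI2[of _ _ C] le)
  show "infsum f A \<le> C" by (rule infsum_le_finite_sums[OF * le])
qed

lemma sum_power_geometric_bounded:
  fixes \<rho> :: real assumes \<rho>: "0 < \<rho>" "\<rho> < 1"
  shows "\<exists>C\<ge>0. \<forall>Y. (\<Sum>K\<le>Y. (real K + 1) ^ n * \<rho> ^ K) \<le> C"
proof -
  define \<sigma> where "\<sigma> = sqrt \<rho>"
  have \<sigma>: "0 < \<sigma>" "\<sigma> < 1" "\<sigma> * \<sigma> = \<rho>" using \<rho> by (auto simp: \<sigma>_def)
  obtain K0 where K0: "K0 \<ge> 0" "\<And>m. \<sigma> ^ m * (1 + 1 * (real m + 2)) ^ n \<le> K0"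
    using poly_power_geometric_bounded[OF \<sigma>(1,2), of 1 n] by auto
  have geo: "summable (\<lambda>k. \<sigma> ^ k)" using \<sigma> by (simp add: summable_geometric)
  have "(\<Sum>K\<le>Y. (real K + 1) ^ n * \<rho> ^ K) \<le> K0 * (1 / (1 - \<sigma>))" for Y
  proof -
    have "(\<Sum>K\<le>Y. (real K + 1) ^ n * \<rho> ^ K) \<le> (\<Sum>K\<le>Y. K0 * \<sigma> ^ K)"
    proof (intro sum_mono)
      fix K
      have "\<sigma> ^ K * (real K + 1) ^ n \<le> \<sigma> ^ K * (1 + 1 * (real K + 2)) ^ n"
        using \<sigma> by (intro mult_left_mono power_mono) auto
      then have "\<sigma> ^ K * (real K + 1) ^ n \<le> K0" using K0(2)[of K] by linarith
      then have "(\<sigma> ^ K * (real K + 1) ^ n) * \<sigma> ^ K \<le> K0 * \<sigma> ^ K" using \<sigma>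
        by (intro mult_right_mono) auto
      then show "(real K + 1) ^ n * \<rho> ^ K \<le> K0 * \<sigma> ^ K"
        unfolding \<sigma>(3)[symmetric] power_mult_distrib by (simp only: mult_ac)
    qed
    also have "\<dots> = K0 * (\<Sum>K\<le>Y. \<sigma> ^ K)" by (simp add: sum_distrib_left)
    also have "\<dots> \<le> K0 * (1 / (1 - \<sigma>))"
      using sum_le_suminf[OF geo, of "{..Y}"] \<sigma> K0
        by (intro mult_left_mono) (auto simp: suminf_geometric)
    finally show ?thesis .
  qed
  then show ?thesis using K0 \<sigma> by (intro exI[of _ "K0 * (1 / (1 - \<sigma>))"]) auto
qed

lemma powr_prod_real:
  fixes f :: "'a \<Rightarrow> real"
  assumes "\<And>x. x \<in> A \<Longrightarrow> 0 \<le> f x"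
  shows "(\<Prod>x\<in>A. f x) powr c = (\<Prod>x\<in>A. f x powr c)"
proof (cases "finite A")
  case True
  then show ?thesis using assms
    by (induction A rule: finite_induct) (auto simp: powr_mult prod_nonneg)
qed simp

context index_set
begin

section \<open>Bounds for the local coefficients and the Euler factors\<close>

lemma ebox_subset_expv: "ebox Y \<subseteq> expv" unfolding ebox_def expv_def by (intro PiE_mono) auto

lemma ebox_mono: "Y \<le> Y' \<Longrightarrow> ebox Y \<subseteq> ebox Y'" unfolding ebox_def by (intro PiE_mono) auto

lemma pbox_mono: "X \<le> X' \<Longrightarrow> pbox X \<subseteq> pbox X'" unfolding pbox_def by (intro PiE_mono) auto

lemma ebox_iff: "k \<in> ebox Y \<longleftrightarrow> k \<in> expv \<and> maxn k \<le> Y"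
  by (auto simp: ebox_def expv_def PiE_iff maxn_le_iff)

lemma pbox_iff: "m \<in> pbox X \<longleftrightarrow> m \<in> posv \<and> maxn m \<le> X"
  by (auto simp: pbox_def posv_def PiE_iff maxn_le_iff)

lemma ebox_cover: "finite G \<Longrightarrow> G \<subseteq> expv \<Longrightarrow> \<exists>Y. G \<subseteq> ebox Y"
  by (intro exI[of _ "Max (insert 0 (maxn ` G))"]) (auto simp: ebox_iff)

lemma pbox_cover: "finite G \<Longrightarrow> G \<subseteq> posv \<Longrightarrow> \<exists>X. G \<subseteq> pbox X"
  by (intro exI[of _ "Max (insert 0 (maxn ` G))"]) (auto simp: pbox_iff)

lemma card_ebox: "card (ebox Y) = Suc Y ^ card N"
  unfolding ebox_def using finite_N by (simp add: card_funcsetE)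

lemma maxn_eq_0_iff: "k \<in> expv \<Longrightarrow> maxn k = 0 \<longleftrightarrow> k = (\<lambda>j\<in>N. 0)"
  using maxn_le_iff[of k 0] by (auto simp: expv_def PiE_iff extensional_def fun_eq_iff maxn_zero)

lemma maxn_lower: "maxn k \<le> Suc (maxn (lower k s 1))"
proof -
  obtain j where "j \<in> N" "k j = maxn k" using maxn_attained by blast
  then show ?thesis using maxn_ge[of j "lower k s 1"] by (auto simp: lower_def split: if_splits)
qed

lemma lower_mem: "s \<subseteq> N \<Longrightarrow> k \<in> expv \<Longrightarrow> lower k s e \<in> expv"
  by (auto simp: expv_def PiE_iff extensional_def lower_def)

text \<open>Lowering exponents by 1 lowers their maximum by at most 1, and the factor 1/p in
  \<open>step\<close> makes up for it; so each step at most doubles the bound.\<close>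

lemma steps_bound:
  assumes "1 \<le> p"
  shows "\<bar>steps J lcm_local p k\<bar> \<le> 2 ^ length J / real p ^ maxn k"
proof (induction J arbitrary: k)
  case Nil
  then show ?case by (simp add: lcm_local_def)
next
  case (Cons s J)
  have p: "real p \<ge> 1" using assms by simp
  have "\<bar>steps J lcm_local p (lower k s 1)\<bar> / real p \<le>
    (2 ^ length J / real p ^ maxn (lower k s 1)) / real p"
    using p by (intro divide_right_mono Cons.IH) auto
  also have "\<dots> = 2 ^ length J / real p ^ Suc (maxn (lower k s 1))" by (simp add: field_simps)
  also have "\<dots> \<le> 2 ^ length J / real p ^ maxn k"
    using p maxn_lower by (intro divide_left_mono power_increasing) auto
  finally have "\<bar>steps J lcm_local p (lower k s 1)\<bar> / real p \<le> 2 ^ length J / real p ^ maxn k" .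
  moreover have "\<bar>steps (s # J) lcm_local p k\<bar> \<le>
    \<bar>steps J lcm_local p k\<bar> + \<bar>steps J lcm_local p (lower k s 1)\<bar> / real p"
    by (auto simp: step_def intro: order.trans[OF abs_triangle_ineq4])
  ultimately show ?case using Cons.IH[of k] by simp
qed

text \<open>Here \<open>k\<close> is the indicator of a set of coordinates. A step with exactly this
  set removes 1/p, because the lowered vector is zero and has coefficient 1. A step with a proper
  subset changes the value by O(1/p^2), any other step not at all. Since the list is distinct, 1/p
  is removed at most once.\<close>

lemma steps_bound_1:
  assumes "1 \<le> p" and k: "k \<in> expv" "maxn k = 1"
    and J: "distinct J" "\<And>s. s \<in> set J \<Longrightarrow> s \<noteq> {} \<and> s \<subseteq> N"
  shows "\<bar>steps J lcm_local p k - (if {j \<in> N. k j = 1} \<in> set J then 0 else 1 / real p)\<bar> \<le>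
    2 ^ length J / real p ^ 2"
  using J
proof (induction J)
  case Nil
  then show ?case using k by (simp add: lcm_local_def)
next
  case (Cons s J)
  define \<sigma> where "\<sigma> = {j \<in> N. k j = 1}"
  let ?e = "if \<sigma> \<in> set J then 0 else 1 / real p"
  have p: "real p \<ge> 1" using assms by simp
  have s: "s \<noteq> {}" "s \<subseteq> N" "s \<notin> set J" using Cons.prems by auto
  have IH: "\<bar>steps J lcm_local p k - ?e\<bar> \<le> 2 ^ length J / real p ^ 2"
    unfolding \<sigma>_def using Cons by auto
  have k01: "k j = 0 \<or> k j = 1" if "j \<in> N" for j using maxn_ge[OF that, of k] k by auto
  have iff: "(\<forall>j\<in>s. 1 \<le> k j) \<longleftrightarrow> s \<subseteq> \<sigma>" using k01 s by (fastforce simp: \<sigma>_def)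
  have dbl: "2 ^ length J / real p ^ 2 \<le> 2 ^ length (s # J) / real p ^ 2"
    using p by (intro divide_right_mono) auto
  consider "\<not> s \<subseteq> \<sigma>" | "s = \<sigma>" | "s \<subset> \<sigma>" by blast
  then have "\<bar>steps (s # J) lcm_local p k - (if \<sigma> \<in> set (s # J) then 0 else 1 / real p)\<bar> \<le>
    2 ^ length (s # J) / real p ^ 2"
  proof cases
    case 1
    then have "\<not> (\<forall>j\<in>s. 1 \<le> k j)" using iff by blast
    then have "steps (s # J) lcm_local p k = steps J lcm_local p k"
      unfolding steps.simps step_def by (simp only: if_False diff_0_right)
    moreover have "s \<noteq> \<sigma>" using 1 by auto
    ultimately show ?thesis using IH dbl by auto
  next
    case 2
    have "lower k s 1 = (\<lambda>j\<in>N. 0)"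
      using k01 k(1) 2 s by (fastforce simp: lower_def \<sigma>_def expv_def PiE_iff extensional_def)
    moreover have "unital (steps J lcm_local)" using Cons.prems
      by (intro unital_steps unital_lcm_local) auto
    ultimately have "steps (s # J) lcm_local p k = steps J lcm_local p k - 1 / real p"
      using iff 2 by (simp add: step_def unital_def)
    then show ?thesis using IH dbl 2 s by auto
  next
    case 3
    then obtain j where j: "j \<in> N" "k j = 1" "j \<notin> s" by (auto simp: \<sigma>_def)
    have "1 \<le> maxn (lower k s 1)" using maxn_ge[OF j(1), of "lower k s 1"] j
      by (simp add: lower_def)
    then have "2 ^ length J / real p ^ maxn (lower k s 1) \<le> 2 ^ length J / real p ^ 1"
      using p by (intro divide_left_mono power_increasing) auto
    then have "\<bar>steps J lcm_local p (lower k s 1)\<bar> \<le> 2 ^ length J / real p"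
      using steps_bound[OF assms(1), of J "lower k s 1"] by simp
    then have "\<bar>steps J lcm_local p (lower k s 1)\<bar> / real p \<le> 2 ^ length J / real p / real p"
      using p by (intro divide_right_mono) auto
    then have *: "\<bar>steps J lcm_local p (lower k s 1) / real p\<bar> \<le> 2 ^ length J / real p ^ 2"
      using p by (simp add: power2_eq_square)
    have "steps (s # J) lcm_local p k =
      steps J lcm_local p k - steps J lcm_local p (lower k s 1) / real p"
      using iff 3 unfolding steps.simps step_def by simp
    moreover have "(\<sigma> \<in> set (s # J)) = (\<sigma> \<in> set J)" using 3 by auto
    ultimately have "\<bar>steps (s # J) lcm_local p k - (if \<sigma> \<in> set (s # J) then 0 else 1 / real p)\<bar> \<le>
        \<bar>steps J lcm_local p k - ?e\<bar> + \<bar>steps J lcm_local p (lower k s 1) / real p\<bar>"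
      by (cases "\<sigma> \<in> set J"; simp only: if_True if_False; linarith)
    also have "\<dots> \<le> 2 ^ length J / real p ^ 2 + 2 ^ length J / real p ^ 2" by (intro add_mono IH *)
    finally show ?thesis by simp
  qed
  then show ?case by (simp only: \<sigma>_def)
qed

definition enum_ok :: "nat set list \<Rightarrow> bool" where "enum_ok J \<longleftrightarrow> distinct J \<and> set J = Pow N - {{}}"

lemma enum_okD: "enum_ok J \<Longrightarrow> s \<in> set J \<Longrightarrow> s \<noteq> {} \<and> s \<subseteq> N"
  by (auto simp: enum_ok_def)

lemma enum_ok_length: "enum_ok J \<Longrightarrow> length J = 2 ^ card N - 1"
  using distinct_card[of J] finite_N by (simp add: enum_ok_def card_Diff_singleton card_Pow)

definition eta :: "nat set list \<Rightarrow> nat \<Rightarrow> (nat \<Rightarrow> nat) \<Rightarrow> real" where "eta J = steps J lcm_local"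

lemma unital_eta: "enum_ok J \<Longrightarrow> unital (eta J)"
  unfolding eta_def using enum_okD by (intro unital_steps unital_lcm_local) auto

text \<open>The terms of order \<open>1 / p\<close> cancel; this is what makes the Euler product of \<open>eta\<close> converge
  absolutely to the left of the origin.\<close>
lemma eta_bound:
  assumes J: "enum_ok J" and p: "1 \<le> p" and k: "k \<in> expv" "1 \<le> maxn k"
  shows "\<bar>eta J p k\<bar> \<le> 2 ^ length J / real p ^ max (maxn k) 2"
proof (cases "maxn k = 1")
  case True
  have "{j \<in> N. k j = 1} \<in> set J" using maxn_attained[of k] True J by (auto simp: enum_ok_def)
  moreover have "distinct J" using J by (simp add: enum_ok_def)
  ultimately have "\<bar>steps J lcm_local p k\<bar> \<le> 2 ^ length J / real p ^ 2"
    using steps_bound_1[OF p k(1) True, of J] enum_okD[OF J] by simp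
  moreover have "max (maxn k) 2 = 2" using True by simp
  ultimately show ?thesis by (simp only: eta_def)
next
  case False
  then have "max (maxn k) 2 = maxn k" using k by auto
  then show ?thesis using steps_bound[OF p, of J k] by (simp add: eta_def)
qed

text \<open>Multiplied over the primes, the extra factor becomes the lcm to the power 1/4. Any
  exponent below 1/2 would keep the sum over primes convergent; the critical vectors are those with
  maximum 2, where \<open>eta\<close> is O(1/p^2).\<close>

definition wt :: "nat set list \<Rightarrow> nat \<Rightarrow> (nat \<Rightarrow> nat) \<Rightarrow> real" where
  "wt J p k = \<bar>eta J p k\<bar> * real p powr (real (maxn k) / 4)"

lemma wt_bound:
  assumes J: "enum_ok J" and p: "2 \<le> p" and k: "k \<in> expv" "1 \<le> maxn k"
  shows "wt J p k \<le> 2 ^ length J * 4 * real p powr (-3/2) * (2 powr (-3/4)) ^ maxn k"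
proof -
  define K where "K = real (maxn k)"
  define K2 where "K2 = real (max (maxn k) 2)"
  \<comment> \<open>The surplus left after setting aside \<open>p\<close> to the power -3/2 for the
    sum over primes. As \<open>p \<ge> 2\<close>, it yields geometric decay in \<open>maxn k\<close>
    uniformly in \<open>p\<close>; the factor 4 covers the small values of
    \<open>maxn k\<close>.\<close>
  define e where "e = K2 - K / 4 - 3/2"
  have p2: "2 \<le> real p" using p by simp
  have e: "0 \<le> e" "3/4 * K - 3/2 \<le> e"
    unfolding e_def K_def K2_def using k by (cases "maxn k \<le> 2"; auto simp: max_def field_simps)+
  have "wt J p k \<le> 2 ^ length J / real p ^ max (maxn k) 2 * real p powr (K / 4)"
    unfolding wt_def K_def using p by (intro mult_right_mono eta_bound J k) auto
  also have "real p ^ max (maxn k) 2 = real p powr K2" unfolding K2_def using p2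
    by (subst powr_realpow) auto
  also have "2 ^ length J / real p powr K2 * real p powr (K / 4) =
    2 ^ length J * (real p powr (-3/2) * real p powr (- e))"
    unfolding e_def using p2 by (simp add: powr_add[symmetric] powr_diff powr_minus field_simps)
  also have "\<dots> \<le> 2 ^ length J * (real p powr (-3/2) * (4 * (2 powr (-3/4)) ^ maxn k))"
  proof (intro mult_left_mono)
    have "real p powr (- e) \<le> 2 powr (- e)" using e p2 by (intro powr_mono2') auto
    also have "\<dots> \<le> 2 powr (2 + (-3/4) * K)" using e by (intro powr_mono) auto
    also have "\<dots> = 2 powr 2 * (2 powr (-3/4)) powr K" unfolding powr_add by (simp add: powr_powr)
    also have "\<dots> = 4 * (2 powr (-3/4)) ^ maxn k" unfolding K_def by (subst powr_realpow) auto
    finally show "real p powr (- e) \<le> 4 * (2 powr (-3/4)) ^ maxn k" .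
  qed auto
  finally show ?thesis by (simp add: mult_ac)
qed

lemma sum_maxn_le:
  assumes "\<And>K. 0 \<le> F K"
  shows "(\<Sum>k\<in>ebox Y. F (maxn k)) \<le> (\<Sum>K\<le>Y. (real K + 1) ^ card N * F K)"
proof -
  have "(\<Sum>k\<in>ebox Y. F (maxn k)) = (\<Sum>K\<le>Y. \<Sum>k | k \<in> ebox Y \<and> maxn k = K. F (maxn k))"
    by (rule sum.group[symmetric]) (auto simp: ebox_iff)
  also have "\<dots> \<le> (\<Sum>K\<le>Y. (real K + 1) ^ card N * F K)"
  proof (intro sum_mono)
    fix K
    have "card {k \<in> ebox Y. maxn k = K} \<le> card (ebox K)" by (intro card_mono) (auto simp: ebox_iff)
    then have "real (card {k \<in> ebox Y. maxn k = K}) \<le> (real K + 1) ^ card N"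
      unfolding card_ebox by (metis of_nat_Suc of_nat_le_iff of_nat_power add.commute)
    then show "(\<Sum>k | k \<in> ebox Y \<and> maxn k = K. F (maxn k)) \<le> (real K + 1) ^ card N * F K"
      using assms by (simp add: mult_right_mono)
  qed
  finally show ?thesis .
qed

lemma wt_sum_bound:
  assumes J: "enum_ok J"
  shows "\<exists>C\<ge>0. \<forall>p Y. 2 \<le> p \<longrightarrow> (\<Sum>k | k \<in> ebox Y \<and> 1 \<le> maxn k. wt J p k) \<le> C * real p powr (-3/2)"
proof -
  define \<rho> :: real where "\<rho> = 2 powr (-3/4)"
  have \<rho>: "0 < \<rho>" "\<rho> < 1" by (auto simp: \<rho>_def powr_less_one)
  obtain C where C: "C \<ge> 0" "\<And>Y. (\<Sum>K\<le>Y. (real K + 1) ^ card N * \<rho> ^ K) \<le> C"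
    using sum_power_geometric_bounded[OF \<rho>, of "card N"] by blast
  have "(\<Sum>k | k \<in> ebox Y \<and> 1 \<le> maxn k. wt J p k) \<le> (2 ^ length J * 4 * C) * real p powr (-3/2)"
    if p: "2 \<le> p" for p Y
  proof -
    let ?c = "2 ^ length J * 4 * real p powr (-3/2)"
    have "(\<Sum>k | k \<in> ebox Y \<and> 1 \<le> maxn k. wt J p k) \<le> (\<Sum>k | k \<in> ebox Y \<and> 1 \<le>
      maxn k. ?c * \<rho> ^ maxn k)"
      unfolding \<rho>_def by (intro sum_mono wt_bound J p) (auto simp: ebox_iff)
    also have "\<dots> \<le> (\<Sum>k\<in>ebox Y. ?c * \<rho> ^ maxn k)" using \<rho> by (intro sum_mono2) auto
    also have "\<dots> = ?c * (\<Sum>k\<in>ebox Y. \<rho> ^ maxn k)" by (simp add: sum_distrib_left)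
    also have "\<dots> \<le> ?c * C"
      using \<rho> by (intro mult_left_mono order.trans[OF sum_maxn_le C(2)]) auto
    finally show ?thesis by (simp add: mult_ac)
  qed
  then show ?thesis using C(1) by (intro exI[of _ "2 ^ length J * 4 * C"]) auto
qed

lemma sum_ebox_split:
  "(\<Sum>k\<in>ebox Y. f k) = f (\<lambda>j\<in>N. 0) + (\<Sum>k | k \<in> ebox Y \<and> 1 \<le> maxn k. f k)"
proof -
  have "ebox Y = insert (\<lambda>j\<in>N. 0) {k \<in> ebox Y. 1 \<le> maxn k}"
    using maxn_eq_0_iff by (auto simp: ebox_iff expv_def maxn_zero not_less_eq_eq)
  then have "(\<Sum>k\<in>ebox Y. f k) = sum f (insert (\<lambda>j\<in>N. 0) {k \<in> ebox Y. 1 \<le> maxn k})" by simp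
  also have "\<dots> = f (\<lambda>j\<in>N. 0) + (\<Sum>k | k \<in> ebox Y \<and> 1 \<le> maxn k. f k)"
    by (subst sum.insert) (auto simp: maxn_zero)
  finally show ?thesis .
qed

lemma eta_le_wt: "1 \<le> p \<Longrightarrow> \<bar>eta J p k\<bar> \<le> wt J p k"
  using ge_one_powr_ge_zero[of "real p" "real (maxn k) / 4"] mult_left_mono[of 1
    "real p powr (real (maxn k) / 4)" "\<bar>eta J p k\<bar>"]
  by (simp add: wt_def)

lemma wt_zero: "enum_ok J \<Longrightarrow> 1 \<le> p \<Longrightarrow> wt J p (\<lambda>j\<in>N. 0) = 1"
  using unital_eta[of J] by (simp add: wt_def unital_def maxn_zero)

lemma eta_local_abs_summable:
  assumes J: "enum_ok J" and p: "2 \<le> p"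
  shows "(\<lambda>k. norm (eta J p k)) summable_on expv"
proof -
  obtain C where C0: "C \<ge> 0" "\<forall>p Y. 2 \<le> p \<longrightarrow>
    (\<Sum>k | k \<in> ebox Y \<and> 1 \<le> maxn k. wt J p k) \<le> C * real p powr (-3/2)"
    using wt_sum_bound[OF J] by (elim exE conjE)
  note C = C0(1) C0(2)[rule_format]
  show ?thesis
  proof (rule exhaust_bounded(1)[where F = ebox])
    show "(\<Sum>k\<in>ebox Y. norm (eta J p k)) \<le> 1 + C * real p powr (-3/2)" for Y
    proof -
      have "(\<Sum>k\<in>ebox Y. norm (eta J p k)) \<le> (\<Sum>k\<in>ebox Y. wt J p k)"
        using p by (intro sum_mono) (simp add: eta_le_wt)
      also have "\<dots> = 1 + (\<Sum>k | k \<in> ebox Y \<and> 1 \<le> maxn k. wt J p k)"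
        unfolding sum_ebox_split using wt_zero[OF J] p by simp
      finally show ?thesis using C(2)[OF p, of Y] by linarith
    qed
  qed (use ebox_subset_expv ebox_cover in \<open>simp_all\<close>)
qed

lemma eta_local_sum_bound:
  assumes J: "enum_ok J"
  shows "\<exists>C\<ge>0. \<forall>p\<ge>2. \<bar>infsum (eta J p) expv - 1\<bar> \<le> C * real p powr (-3/2)"
proof -
  obtain C where C0: "C \<ge> 0" "\<forall>p Y. 2 \<le> p \<longrightarrow>
    (\<Sum>k | k \<in> ebox Y \<and> 1 \<le> maxn k. wt J p k) \<le> C * real p powr (-3/2)"
    using wt_sum_bound[OF J] by (elim exE conjE)
  note C = C0(1) C0(2)[rule_format]
  have "\<bar>infsum (eta J p) expv - 1\<bar> \<le> C * real p powr (-3/2)" if p: "2 \<le> p" for p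
  proof (rule LIMSEQ_le_const2)
    have "(eta J p has_sum infsum (eta J p) expv) expv"
      by (rule has_sum_infsum[OF abs_summable_summable[OF eta_local_abs_summable[OF J p]]])
    then have "(\<lambda>Y. sum (eta J p) (ebox Y)) \<longlonglongrightarrow> infsum (eta J p) expv"
      by (rule exhaust_tendsto[OF _ finite_ebox ebox_subset_expv ebox_mono ebox_cover])
    then show "(\<lambda>Y. \<bar>sum (eta J p) (ebox Y) - 1\<bar>) \<longlonglongrightarrow> \<bar>infsum (eta J p) expv - 1\<bar>"
      by (intro tendsto_intros)
    have "\<bar>sum (eta J p) (ebox Y) - 1\<bar> \<le> C * real p powr (-3/2)" for Y
    proof -
      have "sum (eta J p) (ebox Y) - 1 = (\<Sum>k | k \<in> ebox Y \<and> 1 \<le> maxn k. eta J p k)"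
        unfolding sum_ebox_split using unital_eta[OF J] by (simp add: unital_def)
      also have "\<bar>\<dots>\<bar> \<le> (\<Sum>k | k \<in> ebox Y \<and> 1 \<le> maxn k. wt J p k)"
        using p by (intro order.trans[OF sum_abs] sum_mono eta_le_wt) auto
      finally show ?thesis using C(2)[OF p, of Y] by linarith
    qed
    then show "\<exists>N. \<forall>Y\<ge>N. \<bar>sum (eta J p) (ebox Y) - 1\<bar> \<le> C * real p powr (-3/2)" by blast
  qed
  then show ?thesis using C(1) by blast
qed

text \<open>Raising the exponents in \<open>s\<close> by 1 is a bijection from \<open>expv\<close>
  onto the vectors positive on \<open>s\<close>. In terms of power series this evaluates the product
  at the point where all variables are 1.\<close>

lemma has_sum_step:
  assumes s: "s \<noteq> {}" "s \<subseteq> N" and a: "(a p has_sum A) expv" and p: "0 < p"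
  shows "(step s a p has_sum (1 - 1 / real p) * A) expv"
proof -
  define T where "T = {k \<in> expv. \<forall>j\<in>s. 1 \<le> k j}"
  have "((\<lambda>k. a p k / real p) has_sum A / real p) expv"
    using has_sum_cmult_left[OF a, of "1 / real p"] by simp
  also have "((\<lambda>k. a p k / real p) has_sum A / real p) expv \<longleftrightarrow>
    ((\<lambda>k. a p (lower k s 1) / real p) has_sum A / real p) T"
  proof (rule has_sum_reindex_bij_witness[of _ "\<lambda>k. lower k s 1"
    "\<lambda>k j. if j \<in> s then Suc (k j) else k j"])
    fix k assume k: "k \<in> expv"
    show "lower (\<lambda>j. if j \<in> s then Suc (k j) else k j) s 1 = k" by (auto simp: lower_def)
    then show "a p (lower (\<lambda>j. if j \<in> s then Suc (k j) else k j) s 1) / real p = a p k / real p"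
      by simp
    show "(\<lambda>j. if j \<in> s then Suc (k j) else k j) \<in> T"
      using k s by (auto simp: T_def expv_def PiE_iff extensional_def)
  next
    fix k assume "k \<in> T"
    then show "(\<lambda>j. if j \<in> s then Suc (lower k s 1 j) else lower k s 1 j) = k"
      by (force simp: T_def lower_def fun_eq_iff)
    show "lower k s 1 \<in> expv" using \<open>k \<in> T\<close> s by (auto simp: T_def intro: lower_mem)
  qed simp
  also have "\<dots> \<longleftrightarrow> ((\<lambda>k. if \<forall>j\<in>s. 1 \<le>
    k j then a p (lower k s 1) / real p else 0) has_sum A / real p) expv"
    by (rule has_sum_cong_neutral) (auto simp: T_def)
  finally have "((\<lambda>k. a p k - (if \<forall>j\<in>s. 1 \<le>
    k j then a p (lower k s 1) / real p else 0)) has_sum A - A / real p) expv"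
    using has_sum_add[OF a has_sum_uminusI] by simp
  then show ?thesis by (simp add: step_def[abs_def] algebra_simps)
qed

lemma has_sum_steps:
  assumes J: "\<And>s. s \<in> set J \<Longrightarrow> s \<noteq> {} \<and> s \<subseteq> N" and a: "(a p has_sum A) expv" and p: "0 < p"
  shows "(steps J a p has_sum (1 - 1 / real p) ^ length J * A) expv"
  using J
proof (induction J)
  case (Cons s J)
  have "(step s (steps J a) p has_sum (1 - 1 / real p) * ((1 - 1 / real p) ^ length J * A)) expv"
    using Cons p by (intro has_sum_step) auto
  then show ?case by (simp add: mult.assoc)
qed (use a in simp)

text \<open>Vectors are grouped by their maximum: the number of those with maximum \<open>K\<close>
  is the difference of two box cardinalities, \<open>(K + 1) ^ card N - K ^ card N\<close>. For
  \<open>K = 0\<close> this is 1 because \<open>N\<close> is non-empty.\<close>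

lemma euler_term_sums:
  assumes p: "2 \<le> p"
  shows "\<exists>S. (lcm_local p has_sum S) expv \<and> euler_term (card N) p sums S"
proof -
  obtain C where C: "C \<ge> 0" "\<And>Y. (\<Sum>K\<le>Y. (real K + 1) ^ card N * (1 / 2) ^ K) \<le> C"
    using sum_power_geometric_bounded[of "1/2" "card N"] by auto
  have "lcm_local p summable_on expv"
  proof (rule exhaust_bounded(1)[where F = ebox])
    show "(\<Sum>k\<in>ebox Y. lcm_local p k) \<le> C" for Y
    proof -
      have "(\<Sum>k\<in>ebox Y. lcm_local p k) \<le> (\<Sum>k\<in>ebox Y. (1 / 2) ^ maxn k)"
        unfolding lcm_local_def power_one_over using p
        by (intro sum_mono divide_left_mono power_mono) auto
      also have "\<dots> \<le> C" by (intro order.trans[OF sum_maxn_le C(2)]) auto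
      finally show ?thesis .
    qed
  qed (use ebox_subset_expv ebox_cover in \<open>simp_all add: lcm_local_def\<close>)
  then obtain S where S: "(lcm_local p has_sum S) expv" by (auto simp: summable_on_def)
  have "(\<lambda>Y. sum (lcm_local p) (ebox Y)) \<longlonglongrightarrow> S"
    by (rule exhaust_tendsto[OF S finite_ebox ebox_subset_expv ebox_mono ebox_cover])
  moreover have "sum (lcm_local p) (ebox Y) = (\<Sum>K\<le>Y. euler_term (card N) p K)" for Y
  proof (induction Y)
    case 0
    have "ebox 0 = {\<lambda>j\<in>N. 0}" using maxn_eq_0_iff by (auto simp: ebox_iff maxn_zero expv_def)
    moreover have "card N > 0" using finite_N N_nonempty by (simp add: card_gt_0_iff)
    ultimately show ?case using maxn_zero
      by (simp add: lcm_local_def euler_term_def del: restrict_apply)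
  next
    case (Suc Y)
    have sub: "ebox Y \<subseteq> ebox (Suc Y)" by (rule ebox_mono) simp
    have "sum (lcm_local p) (ebox (Suc Y)) =
      sum (lcm_local p) (ebox (Suc Y) - ebox Y) + sum (lcm_local p) (ebox Y)"
      by (rule sum.subset_diff[OF sub]) simp
    also have "sum (lcm_local p) (ebox (Suc Y) - ebox Y) =
      (\<Sum>k\<in>ebox (Suc Y) - ebox Y. 1 / real p ^ Suc Y)"
    proof (intro sum.cong refl)
      fix k assume "k \<in> ebox (Suc Y) - ebox Y"
      then have "maxn k = Suc Y" by (auto simp: ebox_iff)
      then show "lcm_local p k = 1 / real p ^ Suc Y" by (simp add: lcm_local_def)
    qed
    also have "\<dots> = real (card (ebox (Suc Y) - ebox Y)) / real p ^ Suc Y" by simp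
    also have "card (ebox (Suc Y) - ebox Y) = Suc (Suc Y) ^ card N - Suc Y ^ card N"
      using sub by (simp add: card_Diff_subset card_ebox)
    also have "real (Suc (Suc Y) ^ card N - Suc Y ^ card N) =
      real (Suc Y + 1) ^ card N - real (Suc Y) ^ card N"
      by (subst of_nat_diff) (auto intro: power_mono)
    finally show ?case using Suc.IH by (simp add: euler_term_def)
  qed
  ultimately have "euler_term (card N) p sums S" by (simp add: sums_def_le)
  then show ?thesis using S by blast
qed

lemma infsum_eta_local:
  assumes J: "enum_ok J" and p: "prime p"
  shows "infsum (eta J p) expv = euler_factor (card N) p" "0 < euler_factor (card N) p"
    "summable (euler_term (card N) p)"
proof -
  have p2: "2 \<le> p" using prime_ge_2_nat[OF p] .
  obtain S where S: "(lcm_local p has_sum S) expv" "euler_term (card N) p sums S"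
    using euler_term_sums[OF p2] by blast
  have eq: "euler_factor (card N) p = (1 - 1 / real p) ^ length J * S"
    using p S(2) J by (simp add: euler_factor_def sums_iff enum_ok_length)
  show "infsum (eta J p) expv = euler_factor (card N) p"
    unfolding eq eta_def using enum_okD[OF J] p2 by (intro infsumI has_sum_steps S(1)) auto
  show "summable (euler_term (card N) p)" using S(2) by (rule sums_summable)
  have "0 \<le> euler_term (card N) p k" for k
    by (auto simp: euler_term_def intro!: divide_nonneg_nonneg power_mono)
  then have "euler_term (card N) p 0 \<le> S"
    using sum_le_suminf[OF sums_summable[OF S(2)], of "{0}"] S(2) by (simp add: sums_iff)
  moreover have "euler_term (card N) p 0 = 1"
    using finite_N N_nonempty by (simp add: euler_term_def card_gt_0_iff)
  ultimately show "0 < euler_factor (card N) p" unfolding eq using p2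
    by (intro mult_pos_pos zero_less_power) auto
qed

section \<open>Global sums of \<open>eta\<close> and the Euler product\<close>

lemma expo_ebox:
  assumes m: "m \<in> pbox X" and p: "2 \<le> p"
  shows "expo p m \<in> ebox X"
proof -
  have "multiplicity p (m j) \<le> X" if "j \<in> N" for j
  proof -
    have mj: "0 < m j" "m j \<le> X" using m that by (auto simp: pbox_def PiE_iff)
    have "multiplicity p (m j) < 2 ^ multiplicity p (m j)" by (rule less_exp)
    also have "\<dots> \<le> p ^ multiplicity p (m j)" using p by (intro power_mono) auto
    also have "\<dots> \<le> m j" using mj by (intro dvd_imp_le multiplicity_dvd)
    finally show ?thesis using mj by simp
  qed
  then show ?thesis by (auto simp: ebox_def expo_def)
qed

lemma expo_inj:
  assumes m: "m \<in> posv" "m' \<in> posv" and P: "supp_primes m \<subseteq> P" "supp_primes m' \<subseteq> P"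
    and eq: "\<And>p. p \<in> P \<Longrightarrow> expo p m = expo p m'"
  shows "m = m'"
proof
  fix j
  show "m j = m' j"
  proof (cases "j \<in> N")
    case True
    show ?thesis
    proof (rule multiplicity_eq_nat)
      fix p :: nat assume p: "prime p"
      have "expo p m = expo p m'" proof (cases "p \<in> P")
        case False
        then have "p \<notin> supp_primes m" "p \<notin> supp_primes m'" using P by auto
        then show ?thesis using expo_zero[OF p] by simp
      qed (rule eq)
      then show "multiplicity p (m j) = multiplicity p (m' j)" using True
        by (metis expo_def restrict_apply')
    qed (use m posv_pos True in auto)
  qed (use m in \<open>auto simp: posv_def PiE_iff extensional_def\<close>)
qed

lemma mfun_weight:
  assumes J: "enum_ok J" and m: "m \<in> pbox X"
  shows "\<bar>mfun (eta J) m\<bar> * real (Lcm (m ` N)) powr (1/4) = (\<Prod>p\<in>primes_upto X. wt J p (expo p m))"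
proof -
  have P: "\<And>p. p \<in> primes_upto X \<Longrightarrow> prime p" by (simp add: primes_upto_def)
  have "real (Lcm (m ` N)) powr (1/4) = (\<Prod>p\<in>primes_upto X. (real p ^ maxn (expo p m)) powr (1/4))"
    using Lcm_eq_prod[OF subsetD[OF pbox_subset_posv m] finite_primes_upto P supp_primes_pbox[OF m]]
    by (simp add: powr_prod_real)
  also have "\<dots> = (\<Prod>p\<in>primes_upto X. real p powr (real (maxn (expo p m)) / 4))"
    using P prime_gt_0_nat by (intro prod.cong refl) (auto simp: powr_realpow[symmetric] powr_powr)
  finally show ?thesis
    using mfun_eq[OF unital_eta[OF J] finite_primes_upto P supp_primes_pbox[OF m]]
    by (simp add: wt_def abs_prod prod.distrib)
qed

text \<open>The box embeds into the choices of one exponent vector per prime, so the sum is at most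
  a product over primes of local sums 1 + O(p^(-3/2)), which an exponential bounds. In Rankin's
  manner the weight later pays for cutting off \<open>m\<close> at \<open>D\<close>, with a gain of
  D^(-1/4).\<close>

lemma mfun_weight_bound:
  assumes J: "enum_ok J"
  shows "\<exists>C\<ge>0. \<forall>X. (\<Sum>m\<in>pbox X. \<bar>mfun (eta J) m\<bar> * real (Lcm (m ` N)) powr (1/4)) \<le> C"
proof -
  obtain C where C0: "C \<ge> 0" "\<forall>p Y. 2 \<le> p \<longrightarrow>
    (\<Sum>k | k \<in> ebox Y \<and> 1 \<le> maxn k. wt J p k) \<le> C * real p powr (-3/2)"
    using wt_sum_bound[OF J] by (elim exE conjE)
  note C = C0(1) C0(2)[rule_format]
  have sm: "summable (\<lambda>p. real p powr (-3/2))" using summable_real_powr_iff[of "-3/2"] by simp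
  have "(\<Sum>m\<in>pbox X. \<bar>mfun (eta J) m\<bar> * real (Lcm (m ` N)) powr (1/4)) \<le>
    exp (C * (\<Sum>p. real p powr (-3/2)))" for X
  proof -
    let ?P = "primes_upto X"
    let ?\<phi> = "\<lambda>m. \<lambda>p\<in>?P. expo p m"
    have P: "2 \<le> p" if "p \<in> ?P" for p using that prime_ge_2_nat by (auto simp: primes_upto_def)
    have wt0: "0 \<le> wt J p k" for p k by (simp add: wt_def)
    have inj: "inj_on ?\<phi> (pbox X)"
    proof (rule inj_onI)
      fix m m' assume m: "m \<in> pbox X" "m' \<in> pbox X" and eq: "?\<phi> m = ?\<phi> m'"
      show "m = m'"
      proof (rule expo_inj[of _ _ ?P])
        show "expo p m = expo p m'" if "p \<in> ?P" for p using fun_cong[OF eq, of p] that by simp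
      qed (use m pbox_subset_posv supp_primes_pbox in blast)+
    qed
    have "(\<Sum>m\<in>pbox X. \<bar>mfun (eta J) m\<bar> * real (Lcm (m ` N)) powr (1/4)) =
      (\<Sum>m\<in>pbox X. \<Prod>p\<in>?P. wt J p (?\<phi> m p))"
      by (intro sum.cong refl) (simp add: mfun_weight[OF J])
    also have "\<dots> = (\<Sum>g\<in>?\<phi> ` pbox X. \<Prod>p\<in>?P. wt J p (g p))"
      by (simp add: sum.reindex[OF inj])
    also have "\<dots> \<le> (\<Sum>g\<in>PiE ?P (\<lambda>_. ebox X). \<Prod>p\<in>?P. wt J p (g p))"
    proof (rule sum_mono2)
      show "?\<phi> ` pbox X \<subseteq> PiE ?P (\<lambda>_. ebox X)" using expo_ebox P by auto
    qed (auto intro!: finite_PiE prod_nonneg wt0)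
    also have "\<dots> = (\<Prod>p\<in>?P. \<Sum>k\<in>ebox X. wt J p k)" by (rule prod_sum_PiE[symmetric]) auto
    also have "\<dots> \<le> (\<Prod>p\<in>?P. exp (C * real p powr (-3/2)))"
    proof (intro prod_mono conjI sum_nonneg wt0)
      fix p assume "p \<in> ?P"
      then have p: "2 \<le> p" by (rule P)
      have "(\<Sum>k\<in>ebox X. wt J p k) = 1 + (\<Sum>k | k \<in> ebox X \<and> 1 \<le> maxn k. wt J p k)"
        unfolding sum_ebox_split using wt_zero[OF J] p by simp
      also have "\<dots> \<le> 1 + C * real p powr (-3/2)" using C(2)[OF p] by simp
      also have "\<dots> \<le> exp (C * real p powr (-3/2))" by (rule exp_ge_add_one_self)
      finally show "(\<Sum>k\<in>ebox X. wt J p k) \<le> exp (C * real p powr (-3/2))" .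
    qed
    also have "\<dots> = exp (C * (\<Sum>p\<in>?P. real p powr (-3/2)))" by (simp add: exp_sum sum_distrib_left)
    also have "\<dots> \<le> exp (C * (\<Sum>p. real p powr (-3/2)))"
      using C(1) sum_le_suminf[OF sm, of ?P] by (simp add: mult_left_mono)
    finally show ?thesis .
  qed
  then show ?thesis by (intro exI[of _ "exp (C * (\<Sum>p. real p powr (-3/2)))"]) auto
qed

lemma maxn_le_Lcm: "m \<in> posv \<Longrightarrow> maxn m \<le> Lcm (m ` N)" and Lcm_pos: "m \<in> posv \<Longrightarrow> 0 < Lcm (m ` N)"
proof -
  assume m: "m \<in> posv"
  have "0 \<notin> m ` N" using posv_pos[OF m] by force
  then have "Lcm (m ` N) \<noteq> 0" using finite_N by (simp add: Lcm_0_iff)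
  then show pos: "0 < Lcm (m ` N)" by simp
  obtain j where j: "j \<in> N" "m j = maxn m" using maxn_attained by blast
  then show "maxn m \<le> Lcm (m ` N)" using pos
    by (intro dvd_imp_le) (auto intro: dvd_Lcm simp: j(2)[symmetric])
qed

lemma mfun_eta_abs_summable:
  assumes J: "enum_ok J"
  shows "(\<lambda>m. norm (mfun (eta J) m)) summable_on posv"
proof -
  obtain C where C: "\<And>X. (\<Sum>m\<in>pbox X. \<bar>mfun (eta J) m\<bar> * real (Lcm (m ` N)) powr (1/4)) \<le> C"
    using mfun_weight_bound[OF J] by blast
  show ?thesis
  proof (rule exhaust_bounded(1)[where F = pbox])
    show "(\<Sum>m\<in>pbox X. norm (mfun (eta J) m)) \<le> C" for X
    proof -
      have "(\<Sum>m\<in>pbox X. norm (mfun (eta J) m)) \<le>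
        (\<Sum>m\<in>pbox X. \<bar>mfun (eta J) m\<bar> * real (Lcm (m ` N)) powr (1/4))"
      proof (intro sum_mono)
        fix m assume "m \<in> pbox X"
        then have "1 \<le> real (Lcm (m ` N))" using Lcm_pos pbox_subset_posv
          by (simp add: Suc_le_eq subset_iff)
        then have "1 \<le> real (Lcm (m ` N)) powr (1/4)" by (intro ge_one_powr_ge_zero) auto
        then show "norm (mfun (eta J) m) \<le> \<bar>mfun (eta J) m\<bar> * real (Lcm (m ` N)) powr (1/4)"
          using mult_left_mono[of 1 _ "\<bar>mfun (eta J) m\<bar>"] by simp
      qed
      then show ?thesis using C[of X] by linarith
    qed
  qed (use pbox_subset_posv pbox_cover in \<open>simp_all\<close>)
qed

text \<open>Unique factorisation identifies tuples whose primes are at most \<open>X\<close> with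
  families of exponent vectors, and absolute convergence allows the finite product of infinite sums
  to be multiplied out.\<close>

lemma infsum_smooth:
  assumes J: "enum_ok J"
  shows "infsum (mfun (eta J)) {m \<in> posv. supp_primes m \<subseteq> primes_upto X} =
    (\<Prod>p\<in>primes_upto X. infsum (eta J p) expv)"
proof -
  let ?P = "primes_upto X"
  have P: "\<And>p. p \<in> ?P \<Longrightarrow> prime p" by (simp add: primes_upto_def)
  have "(\<Prod>p\<in>?P. infsum (eta J p) expv) = infsum (\<lambda>g. \<Prod>p\<in>?P. eta J p (g p)) (PiE ?P (\<lambda>_. expv))"
    using P by (intro infsum_prod_PiE_abs[symmetric] eta_local_abs_summable J) (auto intro: prime_ge_2_nat)
  also have "\<dots> = infsum (mfun (eta J)) {m \<in> posv. supp_primes m \<subseteq> ?P}"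
  proof (rule infsum_reindex_bij_witness[of _ "\<lambda>m. \<lambda>p\<in>?P. expo p m" "\<lambda>g. \<lambda>j\<in>N. \<Prod>p\<in>?P. p ^ g p j"])
    fix g assume g: "g \<in> PiE ?P (\<lambda>_. expv)"
    let ?m = "\<lambda>j\<in>N. \<Prod>p\<in>?P. p ^ g p j"
    have mult: "multiplicity q (?m j) = (if q \<in> ?P then g q j else 0)" if "prime q" "j \<in> N" for q j
      using that P multiplicity_prod_prime_powers[OF finite_primes_upto P that(1),
        where f = "\<lambda>p. g p j"] by simp
    have "0 < ?m j" if "j \<in> N" for j using that P prime_gt_0_nat by (auto intro!: prod_pos)
    then have mH: "?m \<in> posv" by (auto simp: posv_def Suc_le_eq)
    have expo: "expo p ?m = g p" if "p \<in> ?P" for p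
    proof
      fix j
      have "g p \<in> expv" using g that by auto
      then show "expo p ?m j = g p j" using mult[OF P[OF that], of j] that
        by (cases "j \<in> N") (auto simp: expo_def expv_def PiE_iff extensional_def)
    qed
    show "(\<lambda>p\<in>?P. expo p ?m) = g"
      using g expo by (intro ext) (auto simp: PiE_iff extensional_def restrict_def)
    have sub: "supp_primes ?m \<subseteq> ?P"
    proof
      fix q assume "q \<in> supp_primes ?m"
      then obtain j where j: "prime q" "j \<in> N" "q dvd ?m j" by (auto simp: supp_primes_def)
      have "multiplicity q (?m j) \<noteq> 0"
        using j posv_pos[OF mH j(2)] prime_multiplicity_gt_zero_iff[of q "?m j"]
          by (auto simp: prime_imp_prime_elem)
      then show "q \<in> ?P" using mult[OF j(1,2)] by (auto split: if_splits)
    qed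
    show "?m \<in> {m \<in> posv. supp_primes m \<subseteq> ?P}" using mH sub by simp
    show "mfun (eta J) ?m = (\<Prod>p\<in>?P. eta J p (g p))"
      using mfun_eq[OF unital_eta[OF J] finite_primes_upto P sub] expo by simp
  next
    fix m assume m: "m \<in> {m \<in> posv. supp_primes m \<subseteq> ?P}"
    show "(\<lambda>p\<in>?P. expo p m) \<in> PiE ?P (\<lambda>_. expv)" using expo_mem by auto
    let ?m = "\<lambda>j\<in>N. \<Prod>p\<in>?P. p ^ (\<lambda>p\<in>?P. expo p m) p j"
    have mult: "multiplicity q (?m j) = (if q \<in> ?P then expo q m j else 0)" if "prime q" "j \<in> N"
      for q j
      using that P multiplicity_prod_prime_powers[OF finite_primes_upto P that(1),
        where f = "\<lambda>p. (\<lambda>p\<in>?P. expo p m) p j"] by simp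
    show "?m = m"
    proof
      fix j
      show "?m j = m j"
      proof (cases "j \<in> N")
        case True
        show ?thesis
        proof (rule multiplicity_eq_nat)
          fix q :: nat assume q: "prime q"
          show "multiplicity q (?m j) = multiplicity q (m j)"
          proof (cases "q \<in> ?P")
            case False
            then have "expo q m = (\<lambda>j\<in>N. 0)" using m by (intro expo_zero[OF q]) auto
            from fun_cong[OF this, of j] show ?thesis
              unfolding mult[OF q True] using False True by (simp add: expo_def)
          qed (use True in \<open>simp only: mult[OF q True], simp add: expo_def\<close>)
        qed (use True P prime_gt_0_nat m posv_pos in \<open>auto intro!: prod_pos\<close>)
      qed (use m in \<open>auto simp: posv_def PiE_iff extensional_def\<close>)
    qed
  qed
  finally show ?thesis by simp
qed

text \<open>The tuples with all primes at most \<open>X\<close> include the box of side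
  \<open>X\<close>, so what they miss is bounded by a tail of the absolutely convergent
  series.\<close>

lemma infsum_euler_product:
  assumes J: "enum_ok J"
  shows "(\<lambda>X. \<Prod>p\<in>primes_upto X. infsum (eta J p) expv) \<longlonglongrightarrow> infsum (mfun (eta J)) posv"
proof -
  define A where "A = (\<lambda>X. {m \<in> posv. supp_primes m \<subseteq> primes_upto X})"
  have abs: "(\<lambda>m. norm (mfun (eta J) m)) summable_on posv" by (rule mfun_eta_abs_summable[OF J])
  have sub: "pbox X \<subseteq> A X" "A X \<subseteq> posv" for X using supp_primes_pbox pbox_subset_posv[of X]
    by (auto simp: A_def)
  let ?f = "\<lambda>m. norm (mfun (eta J) m)"
  have "(\<lambda>X. sum ?f (pbox X)) \<longlonglongrightarrow> infsum ?f posv"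
    by (rule exhaust_tendsto[OF has_sum_infsum[OF abs] finite_pbox pbox_subset_posv pbox_mono pbox_cover])
  then have lim0: "(\<lambda>X. infsum ?f posv - sum ?f (pbox X)) \<longlonglongrightarrow> 0"
    using tendsto_diff[OF tendsto_const, of "\<lambda>X. sum ?f (pbox X)" "infsum ?f posv" sequentially
      "infsum ?f posv"] by simp
  have le: "norm (infsum (mfun (eta J)) (A X) - infsum (mfun (eta J)) posv) \<le>
    infsum ?f posv - sum ?f (pbox X)" for X
  proof -
    have s1: "(\<lambda>m. norm (mfun (eta J) m)) summable_on B" if "B \<subseteq> posv" for B
      using abs that by (rule summable_on_subset_banach)
    have "infsum (mfun (eta J)) (posv - A X) =
      infsum (mfun (eta J)) posv - infsum (mfun (eta J)) (A X)"
      using sub by (intro infsum_Diff abs_summable_summable[OF s1]) auto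
    then have "norm (infsum (mfun (eta J)) (A X) - infsum (mfun (eta J)) posv) =
      norm (infsum (mfun (eta J)) (posv - A X))"
      by (simp add: norm_minus_commute)
    also have "\<dots> \<le> infsum ?f (posv - A X)" by (intro norm_infsum_bound s1) auto
    also have "\<dots> \<le> infsum ?f (posv - pbox X)" using sub by (intro infsum_mono2 s1) auto
    also have "\<dots> = infsum ?f posv - infsum ?f (pbox X)"
      using pbox_subset_posv by (intro infsum_Diff abs) auto
    finally show ?thesis by simp
  qed
  have "(\<lambda>X. infsum (mfun (eta J)) (A X) - infsum (mfun (eta J)) posv) \<longlonglongrightarrow> 0"
    by (rule Lim_null_comparison[OF always_eventually[OF allI[OF le]] lim0])
  then have "(\<lambda>X. infsum (mfun (eta J)) (A X)) \<longlonglongrightarrow> infsum (mfun (eta J)) posv"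
    by (rule LIM_zero_cancel)
  then show ?thesis unfolding A_def infsum_smooth[OF J] .
qed

text \<open>The factors are 1 + O(p^(-3/2)) at primes and 1 elsewhere, and all are positive. A
  convergent product without zero factors has a non-zero limit, which gives strict
  positivity.\<close>

lemma C_const_eq:
  assumes J: "enum_ok J"
  shows "convergent_prod (euler_factor (card N))" "C_const (card N) = infsum (mfun (eta J)) posv"
    "0 < C_const (card N)"
proof -
  let ?f = "euler_factor (card N)"
  obtain C where C0: "C \<ge> 0" "\<forall>p\<ge>2. \<bar>infsum (eta J p) expv - 1\<bar> \<le> C * real p powr (-3/2)"
    using eta_local_sum_bound[OF J] by (elim exE conjE)
  note C = C0(1) C0(2)[rule_format]
  have pos: "0 < ?f p" for p
    using infsum_eta_local(2)[OF J, of p] by (cases "prime p") (auto simp: euler_factor_def)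
  have "summable (\<lambda>p. \<bar>?f p - 1\<bar>)"
  proof (rule summable_comparison_test)
    show "summable (\<lambda>p. C * real p powr (-3/2))"
      using summable_real_powr_iff[of "-3/2"] by (intro summable_mult) simp
    have "\<bar>?f p - 1\<bar> \<le> C * real p powr (-3/2)" for p
    proof (cases "prime p")
      case True
      then show ?thesis using C(2)[of p] infsum_eta_local(1)[OF J True] prime_ge_2_nat[OF True]
        by simp
    qed (use C(1) in \<open>simp add: euler_factor_def\<close>)
    then show "\<exists>M. \<forall>p\<ge>M. norm \<bar>?f p - 1\<bar> \<le> C * real p powr (-3/2)" by auto
  qed
  moreover have "?f p - 1 \<noteq> -1" for p using pos[of p] by simp
  ultimately have "convergent_prod (\<lambda>p. 1 + (?f p - 1))" by (rule summable_imp_convergent_prod_real)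
  then show cp: "convergent_prod ?f" by simp
  have lim: "(\<lambda>X. \<Prod>p\<le>X. ?f p) \<longlonglongrightarrow> C_const (card N)"
    unfolding C_const_def by (rule convergent_prod_LIMSEQ[OF cp])
  have "(\<Prod>p\<le>X. ?f p) = (\<Prod>p\<in>primes_upto X. infsum (eta J p) expv)" for X
  proof -
    have "(\<Prod>p\<in>primes_upto X. infsum (eta J p) expv) = (\<Prod>p\<in>primes_upto X. ?f p)"
      by (intro prod.cong refl infsum_eta_local(1) J) (simp add: primes_upto_def)
    also have "\<dots> = (\<Prod>p\<le>X. ?f p)"
      by (rule prod.mono_neutral_left) (auto simp: primes_upto_def euler_factor_def)
    finally show ?thesis by simp
  qed
  then show "C_const (card N) = infsum (mfun (eta J)) posv"
    using LIMSEQ_unique[OF lim] infsum_euler_product[OF J] by simp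
  have "0 \<le> C_const (card N)" using pos
    by (intro LIMSEQ_le_const[OF lim] exI[of _ 0] allI impI prod_nonneg less_imp_le) auto
  moreover have "C_const (card N) \<noteq> 0"
    using convergent_prod_to_zero_iff[OF cp] lim pos by (metis less_irrefl)
  ultimately show "0 < C_const (card N)" by simp
qed

end

section \<open>The asymptotic expansion\<close>

lemma one_plus_power_le:
  fixes x :: real assumes "0 \<le> x" "x \<le> 1"
  shows "(1 + x) ^ r - 1 \<le> 2 ^ r * x"
proof (induction r)
  case (Suc r)
  have "(1 + x) ^ Suc r - 1 = ((1 + x) ^ r - 1) + x * (1 + x) ^ r" by (simp add: algebra_simps)
  also have "\<dots> \<le> 2 ^ r * x + x * 2 ^ r"
    using assms by (intro add_mono Suc.IH mult_left_mono power_mono) auto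
  also have "\<dots> = 2 ^ Suc r * x" by simp
  finally show ?case .
qed (use assms in simp)

context index_set
begin

text \<open>The passage from \<open>ennreal\<close> to the reals loses nothing when
  \<open>enum_ok J\<close> holds: the value is then finite, by \<open>iter_sumop_le_intop\<close>
  and \<open>iter_intop_finite\<close>.\<close>

definition lat_sum :: "nat set list \<Rightarrow> (nat \<Rightarrow> real) \<Rightarrow> real"
  where "lat_sum J l = enn2real (iter sumop N J l)"
definition vol :: "nat set list \<Rightarrow> real" where "vol J = enn2real (iter intop N J (\<lambda>_. 1))"

lemma lat_sum_nonneg: "0 \<le> lat_sum J l" by (simp add: lat_sum_def)

lemma iter_intop_finite:
  assumes "enum_ok J" shows "iter intop N J l < top"
  using iter_intop_pwpoly[OF finite_N enum_okD[OF assms]] by (metis ennreal_less_top)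

lemma iter_sumop_eq:
  assumes "enum_ok J" shows "iter sumop N J l = ennreal (lat_sum J l)"
  unfolding lat_sum_def using le_less_trans[OF iter_sumop_le_intop iter_intop_finite[OF assms]]
    by simp

lemma vol_pos: "enum_ok J \<Longrightarrow> 0 < vol J"
  unfolding vol_def using iter_intop_pos[of 1 N J] iter_intop_finite[of J "\<lambda>_. 1"]
    by (simp add: enn2real_positive_iff)

lemma iter_intop_const:
  assumes J: "enum_ok J" and c: "0 < c"
  shows "iter intop N J (\<lambda>_. c) = ennreal (c ^ length J * vol J)"
proof -
  have "iter intop N J (\<lambda>_. 1) = ennreal (vol J)"
    unfolding vol_def using iter_intop_finite[OF J] by simp
  then show ?thesis using iter_intop_scale[OF c, of N J "\<lambda>_. 1"] c vol_pos[OF J]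
    by (simp add: ennreal_mult ennreal_power)
qed

text \<open>Only the budget is enlarged, with no constant in front, so the bound is asymptotic to
  \<open>L ^ length J * vol J\<close> and matches \<open>lat_sum_lower\<close>; the leading
  coefficient depends on this.\<close>

lemma lat_sum_upper:
  assumes J: "enum_ok J" and a: "\<And>j. j \<in> N \<Longrightarrow> 0 \<le> a j" and L: "0 < L"
  shows "lat_sum J (\<lambda>j. L - a j) \<le> (L + real (length J)) ^ length J * vol J"
proof -
  have "ennreal (lat_sum J (\<lambda>j. L - a j)) \<le> iter intop N J (\<lambda>j. L - a j + real (length J))"
    unfolding iter_sumop_eq[OF J, symmetric] by (rule iter_sumop_le_intop)
  also have "\<dots> \<le> iter intop N J (\<lambda>_. L + real (length J))" using a
    by (intro iter_mono mono_hybrid) auto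
  also have "\<dots> = ennreal ((L + real (length J)) ^ length J * vol J)"
    using L by (intro iter_intop_const J) auto
  finally show ?thesis using L vol_pos[OF J] by (subst (asm) ennreal_le_iff) auto
qed

lemma lat_sum_lower:
  assumes J: "enum_ok J" and a: "\<And>j. j \<in> N \<Longrightarrow> a j \<le> A" and L: "A < L"
  shows "(L - A) ^ length J * vol J \<le> lat_sum J (\<lambda>j. L - a j)"
proof -
  have "ennreal ((L - A) ^ length J * vol J) = iter intop N J (\<lambda>_. L - A)"
    using L by (intro iter_intop_const[symmetric] J) auto
  also have "\<dots> \<le> iter intop N J (\<lambda>j. L - a j)" using a by (intro iter_mono mono_hybrid) auto
  also have "\<dots> \<le> iter sumop N J (\<lambda>j. L - a j)" by (rule iter_hybrid_le_sumop)
  finally show ?thesis unfolding iter_sumop_eq[OF J] using lat_sum_nonneg by simp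
qed

text \<open>With \<open>p\<close> the polynomial of the hybrid, \<open>r\<close> the length of
  \<open>J\<close> and \<open>x = 1 / (D + 1)\<close>, the lattice sum lies between p(L) and (1 +
  x)^r p(L + r x). All constants are uniform in \<open>D\<close> and in the offsets
  \<open>a\<close>, so that the estimate can be summed over \<open>m\<close> afterwards.\<close>

lemma lat_sum_poly_approx:
  assumes J: "enum_ok J"
  shows "\<exists>C\<ge>0. \<exists>d. \<exists>K\<ge>0. \<forall>D a A. length J \<le> Suc D \<longrightarrow> 0 \<le> A \<longrightarrow> (\<forall>j\<in>N. 0 \<le> a j \<and> a j \<le> A) \<longrightarrow>
    (\<exists>p. degree p \<le> d \<and> (\<forall>L>0. C * (A + real (length J) * ln (real (Suc D))) < L \<longrightarrow>
      \<bar>lat_sum J (\<lambda>j. L - a j) - poly p L\<bar> \<le>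
        K * (L + 1 + real (length J)) ^ length J / real (Suc D)))"
proof -
  define r where "r = length J"
  have "\<exists>C\<ge>0. \<exists>d. \<forall>B f a A. shift_comb N (set (subseqs J)) B f \<longrightarrow> 0 \<le> B \<longrightarrow> 0 \<le> A \<longrightarrow> (\<forall>j\<in>N. \<bar>a j\<bar> \<le> A) \<longrightarrow>
    (\<exists>p. degree p \<le> d \<and> (\<forall>L. C * (A + B) < L \<longrightarrow>
      0 \<le> poly p L \<and> f (\<lambda>j. L - a j) = ennreal (poly p L)))"
  proof (rule shift_comb_poly[OF finite_N])
    fix K s assume "K \<in> set (subseqs J)" "s \<in> set K"
    then have "s \<in> set J" using subseqs_powset[of J] by (metis PowD image_eqI subsetD)
    then show "s \<noteq> {} \<and> s \<subseteq> N" by (rule enum_okD[OF J])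
  qed simp
  then obtain C d where C: "C \<ge> 0" and shift_comb: "\<forall>B f a A. shift_comb N (set (subseqs J)) B f \<longrightarrow>
    0 \<le> B \<longrightarrow> 0 \<le> A \<longrightarrow> (\<forall>j\<in>N. \<bar>a j\<bar> \<le> A) \<longrightarrow>
    (\<exists>p. degree p \<le> d \<and> (\<forall>L. C * (A + B) < L \<longrightarrow>
      0 \<le> poly p L \<and> f (\<lambda>j. L - a j) = ennreal (poly p L)))"
    by (elim exE conjE)
  obtain G where G: "G \<ge> 0" and growth: "\<forall>(p :: real poly) \<tau> M. degree p \<le> d \<longrightarrow>
    (\<forall>t\<in>{\<tau>..\<tau> + 1}. \<bar>poly p t\<bar> \<le> M) \<longrightarrow>
    (\<forall>t. \<bar>poly p t\<bar> \<le> G * M * (1 + \<bar>t - \<tau>\<bar>) ^ d) \<and>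
    (\<forall>h. 0 \<le> h \<longrightarrow> h \<le> 1 \<longrightarrow> \<bar>poly p (\<tau> + h) - poly p \<tau>\<bar> \<le> G * M * h)"
    using poly_growth[of d] by (elim exE conjE)
  define K where "K = vol J * (2 ^ r + 2 ^ r * (G * real r))"
  have K: "K \<ge> 0" using G vol_pos[OF J] by (auto simp: K_def)
  have "\<exists>p. degree p \<le> d \<and> (\<forall>L>0. C * (A + real r * ln (real (Suc D))) < L \<longrightarrow>
      \<bar>lat_sum J (\<lambda>j. L - a j) - poly p L\<bar> \<le> K * (L + 1 + real r) ^ r / real (Suc D))"
    if D: "r \<le> Suc D" and A: "0 \<le> A" "\<forall>j\<in>N. 0 \<le> a j \<and> a j \<le> A" for D a A
  proof -
    define x where "x = 1 / real (Suc D)"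
    have x: "0 \<le> x" "x \<le> 1" by (auto simp: x_def)
    \<comment> \<open>This is the role of the bound on \<open>r\<close>: the shift must stay inside
      the window of length 1.\<close>
    have rx: "0 \<le> real r * x" "real r * x \<le> 1" using D by (auto simp: x_def)
    have "\<exists>p. degree p \<le> d \<and> (\<forall>L. C * (A + real r * ln (real (Suc D))) < L \<longrightarrow>
      0 \<le> poly p L \<and> iter (hybrid D) N J (\<lambda>j. L - a j) = ennreal (poly p L))"
      using shift_comb[rule_format, OF shift_comb_iter_hybrid[of N J D], of A a] A unfolding r_def
        by simp
    then obtain p where p: "degree p \<le> d"
      "\<And>L. C * (A + real r * ln (real (Suc D))) < L \<Longrightarrow> 0 \<le> poly p L"
      "\<And>L. C * (A + real r * ln (real (Suc D))) < L \<Longrightarrow>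
        iter (hybrid D) N J (\<lambda>j. L - a j) = ennreal (poly p L)"
      by blast
    have "\<bar>lat_sum J (\<lambda>j. L - a j) - poly p L\<bar> \<le> K * (L + 1 + real r) ^ r / real (Suc D)"
      if L: "0 < L" "C * (A + real r * ln (real (Suc D))) < L" for L
    proof -
      define M where "M = (L + 1 + real r) ^ r * vol J"
      have M0: "0 \<le> M" using vol_pos[OF J] L by (auto simp: M_def)
      have le: "poly p t \<le> lat_sum J (\<lambda>j. t - a j)" if "L \<le> t" for t
      proof -
        have t: "C * (A + real r * ln (real (Suc D))) < t" using that L by simp
        have "ennreal (poly p t) \<le> ennreal (lat_sum J (\<lambda>j. t - a j))"
          unfolding p(3)[OF t, symmetric] iter_sumop_eq[OF J, symmetric]
            by (rule iter_hybrid_le_sumop)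
        then show ?thesis using lat_sum_nonneg by simp
      qed
      \<comment> \<open>The hybrid, being below the lattice sum, inherits its trivial upper bound,
        and this in turn controls the increment of \<open>p\<close>.\<close>
      have bnd: "\<forall>t\<in>{L..L + 1}. \<bar>poly p t\<bar> \<le> M"
      proof
        fix t assume t: "t \<in> {L..L + 1}"
        have "poly p t \<le> lat_sum J (\<lambda>j. t - a j)" using t by (intro le) auto
        also have "\<dots> \<le> (t + real r) ^ r * vol J" unfolding r_def using t L A
          by (intro lat_sum_upper J) auto
        also have "\<dots> \<le> M" unfolding M_def using t L vol_pos[OF J]
          by (intro mult_right_mono power_mono) auto
        finally show "\<bar>poly p t\<bar> \<le> M" using p(2)[of t] t L by simp
      qed
      have inc: "\<bar>poly p (L + real r * x) - poly p L\<bar> \<le> G * M * (real r * x)"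
        using growth[rule_format, OF p(1) bnd[rule_format]] rx by blast
      have "C * (A + real r * ln (real (Suc D))) < L + real r * x" using L rx by linarith
      note pLx = p(2)[OF this] p(3)[OF this]
      have "ennreal (lat_sum J (\<lambda>j. L - a j)) \<le>
        ennreal (1 + x) ^ r * iter (hybrid D) N J (\<lambda>j. L - a j + real r * x)"
        unfolding iter_sumop_eq[OF J, symmetric] r_def x_def by (rule iter_sumop_le_hybrid)
      also have "(\<lambda>j. L - a j + real r * x) = (\<lambda>j. (L + real r * x) - a j)" by auto
      also have "iter (hybrid D) N J (\<lambda>j. (L + real r * x) - a j) =
        ennreal (poly p (L + real r * x))" by (rule pLx)
      also have "ennreal (1 + x) ^ r * ennreal (poly p (L + real r * x)) =
        ennreal ((1 + x) ^ r * poly p (L + real r * x))"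
        using x pLx(1) unfolding ennreal_power[OF add_nonneg_nonneg[OF zero_le_one x(1)]]
        by (intro ennreal_mult[symmetric]) auto
      finally have up: "lat_sum J (\<lambda>j. L - a j) \<le> (1 + x) ^ r * poly p (L + real r * x)"
        using x pLx(1) by (subst (asm) ennreal_le_iff) auto
      have "(1 + x) ^ r * poly p (L + real r * x) \<le> (1 + x) ^ r * (poly p L + G * M * (real r * x))"
        using x inc by (intro mult_left_mono) auto
      moreover have "(1 + x) ^ r * (poly p L + G * M * (real r * x)) - poly p L =
        ((1 + x) ^ r - 1) * poly p L + (1 + x) ^ r * (G * M * (real r * x))"
          by (simp add: algebra_simps)
      moreover have "((1 + x) ^ r - 1) * poly p L \<le> (2 ^ r * x) * M"
        using bnd[rule_format, of L] p(2)[OF L(2)] x one_plus_power_le[OF x]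
          by (intro mult_mono) auto
      moreover have "(1 + x) ^ r * (G * M * (real r * x)) \<le> 2 ^ r * (G * M * (real r * x))"
        using x G M0 by (intro mult_right_mono power_mono) auto
      ultimately have "lat_sum J (\<lambda>j. L - a j) - poly p L \<le>
        (2 ^ r * x) * M + 2 ^ r * (G * M * (real r * x))"
        using up by linarith
      also have "\<dots> = K * (L + 1 + real r) ^ r / real (Suc D)"
        by (simp add: K_def M_def x_def algebra_simps add_divide_distrib)
      finally show ?thesis using le[of L] by simp
    qed
    then show ?thesis using p(1) by blast
  qed
  then show ?thesis unfolding r_def[symmetric] using C K by blast
qed

text \<open>Outside the box some budget \<open>L - ln (m j)\<close> is negative and
  \<open>lat_sum\<close> vanishes, so this is the full convolution.\<close>

definition eta_sum :: "nat set list \<Rightarrow> real \<Rightarrow> real" where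
  "eta_sum J L = (\<Sum>m\<in>pbox (nat \<lfloor>exp L\<rfloor>). mfun (eta J) m * lat_sum J (\<lambda>j. L - ln (real (m j))))"

lemma pbox_ln: "m \<in> pbox X \<Longrightarrow> j \<in> N \<Longrightarrow> 0 \<le> ln (real (m j)) \<and> ln (real (m j)) \<le> ln (real X)"
  by (auto simp: pbox_def PiE_iff)

text \<open>The same \<open>D\<close> truncates both sums. For \<open>m\<close> in the box of side
  \<open>D + 1\<close> the polynomials of \<open>lat_sum_poly_approx\<close> are added up with
  weights \<open>mfun (eta J) m\<close>; all offsets are at most ln (D + 1), so one threshold
  proportional to it serves them all. Outside this box the lcm exceeds \<open>D\<close>, and the
  moment of \<open>mfun_weight_bound\<close> gains (D + 1)^(-1/4).\<close>

lemma eta_sum_poly_step: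
  assumes J: "enum_ok J"
  shows "\<exists>C\<ge>0. \<exists>d. \<exists>B\<ge>0. \<forall>D. length J \<le> Suc D \<longrightarrow> (\<exists>P. degree P \<le> d \<and>
    (\<forall>L>0. C * ln (real (Suc D)) < L \<longrightarrow> ln (real (Suc D)) \<le> L \<longrightarrow>
      \<bar>eta_sum J L - poly P L\<bar> \<le>
        B * (L + 1 + real (length J)) ^ length J * real (Suc D) powr (-1/4)))"
proof -
  define r where "r = length J"
  obtain C d K where C: "C \<ge> 0" and K: "K \<ge> 0" and approx: "\<forall>D a A. r \<le> Suc D \<longrightarrow> 0 \<le> A \<longrightarrow>
    (\<forall>j\<in>N. 0 \<le> a j \<and> a j \<le> A) \<longrightarrow>
    (\<exists>p. degree p \<le> d \<and> (\<forall>L>0. C * (A + real r * ln (real (Suc D))) < L \<longrightarrow>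
      \<bar>lat_sum J (\<lambda>j. L - a j) - poly p L\<bar> \<le> K * (L + 1 + real r) ^ r / real (Suc D)))"
    using lat_sum_poly_approx[OF J] unfolding r_def[symmetric] by (elim exE conjE)
  obtain W where W: "W \<ge> 0" and weight:
    "\<forall>X. (\<Sum>m\<in>pbox X. \<bar>mfun (eta J) m\<bar> * real (Lcm (m ` N)) powr (1/4)) \<le> W"
    using mfun_weight_bound[OF J] by (elim exE conjE)
  have Lcm1: "1 \<le> real (Lcm (m ` N)) powr (1/4)" if "m \<in> posv" for m
    using Lcm_pos[OF that] by (intro ge_one_powr_ge_zero) auto
  define B where "B = W * (K + vol J)"
  have B: "B \<ge> 0" using W K vol_pos[OF J] by (auto simp: B_def)
  have "\<exists>P. degree P \<le> d \<and> (\<forall>L>0. C * (1 + real r) * ln (real (Suc D)) < L \<longrightarrow> ln (real (Suc D)) \<le> L \<longrightarrow>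
      \<bar>eta_sum J L - poly P L\<bar> \<le> B * (L + 1 + real r) ^ r * real (Suc D) powr (-1/4))"
        if D: "r \<le> Suc D" for D
  proof -
    define \<Lambda> where "\<Lambda> = ln (real (Suc D))"
    have \<Lambda>: "0 \<le> \<Lambda>" by (simp add: \<Lambda>_def)
    have thr: "C * (\<Lambda> + real r * \<Lambda>) = C * (1 + real r) * \<Lambda>" by (simp add: algebra_simps)
    have "\<forall>m\<in>pbox (Suc D). \<exists>p. degree p \<le> d \<and> (\<forall>L>0. C * (1 + real r) * \<Lambda> < L \<longrightarrow>
      \<bar>lat_sum J (\<lambda>j. L - ln (real (m j))) - poly p L\<bar> \<le> K * (L + 1 + real r) ^ r / real (Suc D))"
    proof
      fix m assume m: "m \<in> pbox (Suc D)"
      have bd: "\<forall>j\<in>N. 0 \<le> ln (real (m j)) \<and> ln (real (m j)) \<le> \<Lambda>"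
        unfolding \<Lambda>_def using pbox_ln[OF m] by (intro ballI)
      have "\<exists>p. degree p \<le> d \<and> (\<forall>L>0. C * (\<Lambda> + real r * ln (real (Suc D))) < L \<longrightarrow>
        \<bar>lat_sum J (\<lambda>j. L - ln (real (m j))) - poly p L\<bar> \<le> K * (L + 1 + real r) ^ r / real (Suc D))"
        using approx D \<Lambda> bd by (elim allE impE) assumption+
      then show "\<exists>p. degree p \<le> d \<and> (\<forall>L>0. C * (1 + real r) * \<Lambda> < L \<longrightarrow>
        \<bar>lat_sum J (\<lambda>j. L - ln (real (m j))) - poly p L\<bar> \<le> K * (L + 1 + real r) ^ r / real (Suc D))"
        unfolding \<Lambda>_def[symmetric] thr .
    qed
    then obtain p where p: "\<And>m. m \<in> pbox (Suc D) \<Longrightarrow> degree (p m) \<le> d"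
      "\<And>m L. m \<in> pbox (Suc D) \<Longrightarrow> 0 < L \<Longrightarrow> C * (1 + real r) * \<Lambda> < L \<Longrightarrow>
        \<bar>lat_sum J (\<lambda>j. L - ln (real (m j))) - poly (p m) L\<bar> \<le>
          K * (L + 1 + real r) ^ r / real (Suc D)"
      by metis
    define P where "P = (\<Sum>m\<in>pbox (Suc D). smult (mfun (eta J) m) (p m))"
    have degP: "degree P \<le> d"
      unfolding P_def by (intro degree_sum_le) (auto intro: order.trans[OF degree_smult_le] p(1))
    have "\<bar>eta_sum J L - poly P L\<bar> \<le> B * (L + 1 + real r) ^ r * real (Suc D) powr (-1/4)"
      if L: "0 < L" "C * (1 + real r) * \<Lambda> < L" "\<Lambda> \<le> L" for L
    proof -
      define X where "X = nat \<lfloor>exp L\<rfloor>"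
      define M where "M = (L + 1 + real r) ^ r"
      have M: "M \<ge> 0" using L by (auto simp: M_def)
      let ?t = "\<lambda>m. lat_sum J (\<lambda>j. L - ln (real (m j)))"
      let ?y = "real (Suc D) powr (-1/4)"
      have "exp \<Lambda> = real (Suc D)" by (simp add: \<Lambda>_def)
      then have "real (Suc D) \<le> exp L" using L(3) by (metis exp_le_cancel_iff)
      then have DX: "Suc D \<le> X" unfolding X_def by (simp add: le_nat_floor)
      have sub: "pbox (Suc D) \<subseteq> pbox X" by (rule pbox_mono[OF DX])
      have "eta_sum J L = (\<Sum>m\<in>pbox X - pbox (Suc D). mfun (eta J) m * ?t m) +
        (\<Sum>m\<in>pbox (Suc D). mfun (eta J) m * ?t m)"
        unfolding eta_sum_def X_def[symmetric] by (rule sum.subset_diff[OF sub]) simp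
      moreover have "poly P L = (\<Sum>m\<in>pbox (Suc D). mfun (eta J) m * poly (p m) L)"
        by (simp add: P_def poly_sum)
      ultimately have split: "eta_sum J L - poly P L =
        (\<Sum>m\<in>pbox X - pbox (Suc D). mfun (eta J) m * ?t m) +
         (\<Sum>m\<in>pbox (Suc D). mfun (eta J) m * (?t m - poly (p m) L))"
        by (simp add: right_diff_distrib sum_subtractf)
      have y1: "1 / real (Suc D) \<le> ?y"
      proof -
        have "1 / real (Suc D) = real (Suc D) powr (-1)" by (simp add: powr_minus_divide)
        also have "\<dots> \<le> ?y" by (intro powr_mono) auto
        finally show ?thesis .
      qed
      have "\<bar>\<Sum>m\<in>pbox (Suc D). mfun (eta J) m * (?t m - poly (p m) L)\<bar> \<le>
         (\<Sum>m\<in>pbox (Suc D). (\<bar>mfun (eta J) m\<bar> * real (Lcm (m ` N)) powr (1/4)) * (K * M * ?y))"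
      proof (intro order.trans[OF sum_abs] sum_mono)
        fix m assume m: "m \<in> pbox (Suc D)"
        have "\<bar>?t m - poly (p m) L\<bar> \<le> K * M * (1 / real (Suc D))" using p(2)[OF m L(1,2)]
          by (simp add: M_def)
        also have "\<dots> \<le> K * M * ?y" using K M by (intro mult_left_mono y1) auto
        finally have "\<bar>?t m - poly (p m) L\<bar> \<le> K * M * ?y" .
        moreover have "\<bar>mfun (eta J) m\<bar> * 1 \<le> \<bar>mfun (eta J) m\<bar> * real (Lcm (m ` N)) powr (1/4)"
          using m pbox_subset_posv by (intro mult_left_mono Lcm1) auto
        ultimately show "\<bar>mfun (eta J) m * (?t m - poly (p m) L)\<bar> \<le>
            (\<bar>mfun (eta J) m\<bar> * real (Lcm (m ` N)) powr (1/4)) * (K * M * ?y)"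
          unfolding abs_mult by (intro mult_mono) auto
      qed
      also have "\<dots> \<le> W * (K * M * ?y)"
        unfolding sum_distrib_right[symmetric] using weight K M by (intro mult_right_mono) auto
      finally have b1: "\<bar>\<Sum>m\<in>pbox (Suc D). mfun (eta J) m * (?t m - poly (p m) L)\<bar> \<le>
        W * (K * M * ?y)" .
      have "\<bar>\<Sum>m\<in>pbox X - pbox (Suc D). mfun (eta J) m * ?t m\<bar> \<le>
         (\<Sum>m\<in>pbox X - pbox (Suc D). (\<bar>mfun (eta J) m\<bar> * real (Lcm (m ` N)) powr (1/4)) * (vol J *
           M * ?y))"
      proof (intro order.trans[OF sum_abs] sum_mono)
        fix m assume m: "m \<in> pbox X - pbox (Suc D)"
        then have mH: "m \<in> posv" and mD: "Suc D \<le> maxn m" using pbox_subset_posv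
          by (auto simp: pbox_iff)
        have "?t m \<le> (L + real r) ^ r * vol J"
          unfolding r_def using m pbox_ln L by (intro lat_sum_upper J) auto
        also have "\<dots> \<le> M * vol J" unfolding M_def using L vol_pos[OF J]
          by (intro mult_right_mono power_mono) auto
        finally have t: "\<bar>?t m\<bar> \<le> vol J * M" using lat_sum_nonneg by (simp add: mult.commute)
        have "real (Suc D) powr (1/4) \<le> real (Lcm (m ` N)) powr (1/4)"
          using mD maxn_le_Lcm[OF mH] by (intro powr_mono2) auto
        then have "1 \<le> real (Lcm (m ` N)) powr (1/4) * ?y"
          by (simp add: powr_minus divide_simps del: of_nat_Suc)
        then have "\<bar>mfun (eta J) m\<bar> * (vol J * M) * 1 \<le>
          \<bar>mfun (eta J) m\<bar> * (vol J * M) * (real (Lcm (m ` N)) powr (1/4) * ?y)"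
          using vol_pos[OF J] M by (intro mult_left_mono) auto
        moreover have "\<bar>mfun (eta J) m * ?t m\<bar> \<le> \<bar>mfun (eta J) m\<bar> * (vol J * M)"
          unfolding abs_mult using t by (intro mult_left_mono) auto
        ultimately show "\<bar>mfun (eta J) m * ?t m\<bar> \<le>
          (\<bar>mfun (eta J) m\<bar> * real (Lcm (m ` N)) powr (1/4)) * (vol J * M * ?y)"
          by (simp add: mult_ac)
      qed
      also have "\<dots> \<le> (\<Sum>m\<in>pbox X. (\<bar>mfun (eta J) m\<bar> * real (Lcm (m ` N)) powr (1/4)) * (vol J * M *
        ?y))"
        using vol_pos[OF J] M by (intro sum_mono2) auto
      also have "\<dots> \<le> W * (vol J * M * ?y)"
        unfolding sum_distrib_right[symmetric] using weight vol_pos[OF J] M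
          by (intro mult_right_mono) auto
      finally have b2: "\<bar>\<Sum>m\<in>pbox X - pbox (Suc D). mfun (eta J) m * ?t m\<bar> \<le> W * (vol J * M * ?y)" .
      have "\<bar>eta_sum J L - poly P L\<bar> \<le> W * (vol J * M * ?y) + W * (K * M * ?y)"
        unfolding split using b1 b2 by linarith
      also have "\<dots> = B * M * ?y" by (simp add: B_def algebra_simps)
      finally show ?thesis by (simp only: M_def)
    qed
    then show ?thesis using degP by (auto simp: \<Lambda>_def)
  qed
  then show ?thesis unfolding r_def[symmetric] using C B
    by (intro exI[of _ "C * (1 + real r)"] conjI exI[of _ d] exI[of _ B]) auto
qed

text \<open>Here \<open>D + 1\<close> runs through powers of 2, so ln D grows linearly in
  \<open>k\<close>, like the windows for \<open>L\<close> in \<open>poly_approx\<close>. The power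
  of \<open>L\<close> in the error is absorbed by giving up half of the decay.\<close>

lemma eta_sum_approx:
  assumes J: "enum_ok J"
  shows "\<exists>c Q \<mu> K. c > 0 \<and> \<mu> > 0 \<and> (\<forall>L\<ge>c. \<bar>eta_sum J L - poly Q L\<bar> \<le> K * exp (- \<mu> * L))"
proof -
  define r where "r = length J"
  obtain C d B where C: "C \<ge> 0" and B: "B \<ge> 0" and approx: "\<forall>D. r \<le> Suc D \<longrightarrow> (\<exists>P. degree P \<le> d \<and>
    (\<forall>L>0. C * ln (real (Suc D)) < L \<longrightarrow> ln (real (Suc D)) \<le> L \<longrightarrow>
      \<bar>eta_sum J L - poly P L\<bar> \<le> B * (L + 1 + real r) ^ r * real (Suc D) powr (-1/4)))"
    using eta_sum_poly_step[OF J] unfolding r_def[symmetric] by (elim exE conjE)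
  \<comment> \<open>This gives \<open>(C + 1) * (k + r) < c * (k + 1)\<close>. As ln (D + 1) is at
    most \<open>k + r\<close>, both conditions on it hold throughout the k-th window.\<close>
  define c where "c = (C + 1) * (real r + 1)"
  have "(0 + 1) * (0 + 1) \<le> c" unfolding c_def using C by (intro mult_mono add_mono) auto
  then have c: "c \<ge> 1" by simp
  define \<theta>0 :: real where "\<theta>0 = 2 powr (-1/4)"
  define \<theta> where "\<theta> = sqrt \<theta>0"
  have \<theta>0: "0 < \<theta>0" "\<theta>0 < 1" by (auto simp: \<theta>0_def powr_less_one)
  have \<theta>: "0 < \<theta>" "\<theta> < 1" "\<theta> * \<theta> = \<theta>0" using \<theta>0 by (auto simp: \<theta>_def)
  define c' where "c' = 2 * c + 1 + real r"
  obtain K0 where K0: "K0 \<ge> 0" "\<And>m. \<theta> ^ m * (1 + c' * (real m + 2)) ^ r \<le> K0"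
    using poly_power_geometric_bounded[OF \<theta>(1,2), of c' r] c by (auto simp: c'_def)
  have "\<exists>P. degree P \<le> d \<and> (\<forall>L. c * (real k + 1) \<le> L \<longrightarrow> L \<le> c * (real k + 3) \<longrightarrow>
     \<bar>eta_sum J L - poly P L\<bar> \<le> B * K0 * \<theta> ^ k)" for k
  proof -
    \<comment> \<open>The extra exponent \<open>r\<close> ensures \<open>r \<le> D + 1\<close>, even
      for \<open>k = 0\<close>.\<close>
    define D where "D = 2 ^ (k + r) - (1::nat)"
    have SD: "Suc D = 2 ^ (k + r)" by (simp add: D_def)
    have "r < 2 ^ r" by (rule less_exp)
    also have "(2::nat) ^ r \<le> 2 ^ (k + r)" by (intro power_increasing) auto
    finally have rD: "r \<le> Suc D" unfolding SD by simp
    have lnD: "ln (real (Suc D)) = real (k + r) * ln 2" unfolding SD by (simp add: ln_realpow)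
    have ln2: "ln (2::real) \<le> 1" using ln_add_one_self_le_self[of "1::real"] by simp
    have ln_le: "ln (real (Suc D)) \<le> real (k + r)"
      unfolding lnD using mult_left_mono[OF ln2, of "real (k + r)"] by simp
    have kr: "real (k + r) < (real r + 1) * (real k + 1)"
      by (simp add: algebra_simps add_pos_nonneg)
    obtain P where P: "degree P \<le> d" "\<forall>L>0. C * ln (real (Suc D)) < L \<longrightarrow> ln (real (Suc D)) \<le> L \<longrightarrow>
      \<bar>eta_sum J L - poly P L\<bar> \<le> B * (L + 1 + real r) ^ r * real (Suc D) powr (-1/4)"
      using approx rD by blast
    have "\<bar>eta_sum J L - poly P L\<bar> \<le> B * K0 * \<theta> ^ k"
      if L: "c * (real k + 1) \<le> L" "L \<le> c * (real k + 3)" for L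
    proof -
      have "c * 1 \<le> c * (real k + 1)" using c by (intro mult_left_mono) auto
      then have L0: "0 < L" using L c by linarith
      have 1: "(C + 1) * real (k + r) < L"
      proof -
        have "(C + 1) * real (k + r) < (C + 1) * ((real r + 1) * (real k + 1))"
          using C kr by (intro mult_strict_left_mono) auto
        then show ?thesis using L(1) by (simp add: c_def mult.assoc)
      qed
      have "C * ln (real (Suc D)) \<le> C * real (k + r)" using C ln_le by (intro mult_left_mono) auto
      also have "\<dots> \<le> (C + 1) * real (k + r)" by (intro mult_right_mono) auto
      finally have 2: "C * ln (real (Suc D)) < L" using 1 by simp
      have "1 * real (k + r) \<le> (C + 1) * real (k + r)" using C by (intro mult_right_mono) auto
      then have "real (k + r) < L" using 1 by simp
      then have 3: "ln (real (Suc D)) \<le> L" using order.trans[OF ln_le] by simp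
      have "\<bar>eta_sum J L - poly P L\<bar> \<le> B * (L + 1 + real r) ^ r * real (Suc D) powr (-1/4)"
        using P(2) L0 2 3 by blast
      also have "\<dots> \<le> B * (1 + c' * (real k + 2)) ^ r * \<theta>0 ^ k"
      proof (intro mult_mono mult_left_mono power_mono)
        have "0 \<le> real r * real k" by simp
        moreover have "0 \<le> c * real k" using c by simp
        moreover have "c' * (real k + 2) =
          2 * (c * real k) + 4 * c + real k + 2 + real r * real k + 2 * real r"
          by (simp add: c'_def algebra_simps)
        moreover have "c * (real k + 3) = c * real k + 3 * c" by (simp add: algebra_simps)
        ultimately show "L + 1 + real r \<le> 1 + c' * (real k + 2)"
          using L(2) c of_nat_0_le_iff[of r, where ?'a = real] of_nat_0_le_iff[of k,
            where ?'a = real] by linarith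
        have "real (Suc D) powr (-1/4) \<le> (2 ^ k) powr (-1/4)"
          unfolding SD by (intro powr_mono2') (auto simp: power_add)
        also have "\<dots> = \<theta>0 ^ k"
          unfolding \<theta>0_def by (simp add: powr_realpow[symmetric] powr_powr mult.commute)
        finally show "real (Suc D) powr (-1/4) \<le> \<theta>0 ^ k" .
      qed (use B L0 c in \<open>auto simp: c'_def\<close>)
      also have "\<dots> = B * (\<theta> ^ k * (1 + c' * (real k + 2)) ^ r) * \<theta> ^ k"
        unfolding \<theta>(3)[symmetric] power_mult_distrib by (simp only: mult_ac)
      also have "\<dots> \<le> B * K0 * \<theta> ^ k"
        using B K0(2)[of k] \<theta> by (intro mult_right_mono mult_left_mono) auto
      finally show ?thesis .
    qed
    then show ?thesis using P(1) by blast
  qed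
  then obtain P where P: "\<And>k. degree (P k) \<le> d" "\<And>k L. c * (real k + 1) \<le> L \<Longrightarrow> L \<le> c * (real k + 3) \<Longrightarrow>
     \<bar>eta_sum J L - poly (P k) L\<bar> \<le> B * K0 * \<theta> ^ k" by metis
  have "B * K0 \<ge> 0" using B K0 by simp
  from poly_approx[OF c \<theta>(1,2) this P] obtain Q \<mu> K
    where "\<mu> > 0" "\<forall>L\<ge>c. \<bar>eta_sum J L - poly Q L\<bar> \<le> K * exp (- \<mu> * L)" by blast
  then show ?thesis using c by (intro exI[of _ c] exI[of _ Q] exI[of _ \<mu>] exI[of _ K]) simp
qed

text \<open>Dominated convergence, written out. For fixed \<open>m\<close> the normalised sum tends
  to \<open>vol J\<close> whatever the offsets are, it is bounded by \<open>Cq\<close> for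
  \<open>L \<ge> 1\<close>, and the coefficients \<open>mfun (eta J) m\<close> are absolutely
  summable with sum \<open>C_const (card N)\<close>.\<close>

lemma eta_sum_lead:
  assumes J: "enum_ok J"
  shows "((\<lambda>L. eta_sum J L / L ^ length J) \<longlongrightarrow> C_const (card N) * vol J) at_top"
proof -
  define r where "r = length J"
  let ?e = "mfun (eta J)"
  define q where "q = (\<lambda>m L. lat_sum J (\<lambda>j. L - ln (real (m j))) / L ^ r)"
  define Cq where "Cq = (1 + real r) ^ r * vol J + vol J"
  have vol: "0 < vol J" by (rule vol_pos[OF J])
  then have Cq: "Cq > 0" by (auto simp: Cq_def intro!: add_nonneg_pos)
  have abs: "(\<lambda>m. norm (?e m)) summable_on posv" by (rule mfun_eta_abs_summable[OF J])
  define E where "E = infsum (\<lambda>m. norm (?e m)) posv"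
  have lim_abs: "(\<lambda>X. \<Sum>m\<in>pbox X. norm (?e m)) \<longlonglongrightarrow> E"
    unfolding E_def by (rule exhaust_tendsto[OF has_sum_infsum[OF abs] finite_pbox pbox_subset_posv pbox_mono pbox_cover])
  have lim: "(\<lambda>X. \<Sum>m\<in>pbox X. ?e m) \<longlonglongrightarrow> C_const (card N)"
    unfolding C_const_eq(2)[OF J]
    by (rule exhaust_tendsto[OF has_sum_infsum[OF abs_summable_summable[OF abs]] finite_pbox pbox_subset_posv pbox_mono pbox_cover])
  have q_up: "q m L \<le> (1 + real r / L) ^ r * vol J" "0 \<le> q m L" if "m \<in> pbox X" "L > 0" for m X L
  proof -
    have "lat_sum J (\<lambda>j. L - ln (real (m j))) \<le> (L + real r) ^ r * vol J"
      unfolding r_def using that pbox_ln by (intro lat_sum_upper J) auto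
    then have "q m L \<le> (L + real r) ^ r * vol J / L ^ r"
      unfolding q_def using that by (intro divide_right_mono) auto
    also have "\<dots> = ((L + real r) / L) ^ r * vol J" by (simp add: power_divide)
    also have "(L + real r) / L = 1 + real r / L" using that by (simp add: field_simps)
    finally show "q m L \<le> (1 + real r / L) ^ r * vol J" .
    show "0 \<le> q m L" unfolding q_def using that lat_sum_nonneg by (intro divide_nonneg_nonneg) auto
  qed
  have q_lim: "(q m \<longlongrightarrow> vol J) at_top" if m: "m \<in> pbox X" for m X
  proof (rule tendsto_sandwich)
    define A where "A = ln (real X)"
    have "((\<lambda>L::real. (1 - A / L) ^ r * vol J) \<longlongrightarrow> (1 - 0) ^ r * vol J) at_top"
      by (intro tendsto_intros real_tendsto_divide_at_top[OF tendsto_const] filterlim_ident)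
    then show "((\<lambda>L::real. (1 - A / L) ^ r * vol J) \<longlongrightarrow> vol J) at_top" by simp
    have "((\<lambda>L::real. (1 + real r / L) ^ r * vol J) \<longlongrightarrow> (1 + 0) ^ r * vol J) at_top"
      by (intro tendsto_intros real_tendsto_divide_at_top[OF tendsto_const] filterlim_ident)
    then show "((\<lambda>L::real. (1 + real r / L) ^ r * vol J) \<longlongrightarrow> vol J) at_top" by simp
    show "\<forall>\<^sub>F L in at_top. q m L \<le> (1 + real r / L) ^ r * vol J"
      using eventually_gt_at_top[of 0] by eventually_elim (rule q_up(1)[OF m])
    show "\<forall>\<^sub>F L in at_top. (1 - A / L) ^ r * vol J \<le> q m L"
      using eventually_gt_at_top[of "max 0 A"]
    proof eventually_elim
      case (elim L)
      have "(1 - A / L) ^ r * vol J = ((L - A) / L) ^ r * vol J" using elim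
        by (simp add: diff_divide_distrib)
      also have "\<dots> = (L - A) ^ r * vol J / L ^ r" by (simp add: power_divide)
      also have "\<dots> \<le> q m L"
        unfolding q_def r_def using elim pbox_ln[OF m]
          by (intro divide_right_mono lat_sum_lower J) (auto simp: A_def)
      finally show ?case .
    qed
  qed
  show ?thesis
    unfolding r_def[symmetric]
  proof (rule tendstoI)
    fix \<epsilon> :: real assume \<epsilon>: "\<epsilon> > 0"
    define \<delta> where "\<delta> = \<epsilon> / (3 * Cq + 3 * vol J)"
    have den: "3 * Cq + 3 * vol J > 0" using Cq vol by simp
    have \<delta>: "\<delta> > 0" using \<epsilon> den by (simp add: \<delta>_def)
    have "\<forall>\<^sub>F X in sequentially. dist (\<Sum>m\<in>pbox X. norm (?e m)) E < \<delta> \<and>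
      dist (\<Sum>m\<in>pbox X. ?e m) (C_const (card N)) < \<delta>"
      using tendstoD[OF lim_abs \<delta>] tendstoD[OF lim \<delta>] by (rule eventually_conj)
    then obtain X0 where X0: "\<bar>(\<Sum>m\<in>pbox X0. norm (?e m)) - E\<bar> < \<delta>"
      "\<bar>(\<Sum>m\<in>pbox X0. ?e m) - C_const (card N)\<bar> < \<delta>"
      by (auto simp: eventually_sequentially dist_real_def)
    have "((\<lambda>L. \<Sum>m\<in>pbox X0. ?e m * q m L) \<longlongrightarrow> (\<Sum>m\<in>pbox X0. ?e m * vol J)) at_top"
      by (intro tendsto_intros q_lim)
    from tendstoD[OF this, of "\<epsilon> / 3"] \<epsilon>
    have "\<forall>\<^sub>F L in at_top. \<bar>(\<Sum>m\<in>pbox X0. ?e m * q m L) - (\<Sum>m\<in>pbox X0. ?e m * vol J)\<bar> < \<epsilon> / 3"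
      by (simp add: dist_real_def)
    then show "\<forall>\<^sub>F L in at_top. dist (eta_sum J L / L ^ r) (C_const (card N) * vol J) < \<epsilon>"
      using eventually_ge_at_top[of "max 1 (ln (real (Suc X0)))"]
    proof eventually_elim
      case (elim L)
      define X where "X = nat \<lfloor>exp L\<rfloor>"
      have "ln (real (Suc X0)) \<le> L" using elim(2) by simp
      then have "exp (ln (real (Suc X0))) \<le> exp L" by (simp only: exp_le_cancel_iff)
      then have "real (Suc X0) \<le> exp L"
        by (simp only: exp_ln_iff[THEN iffD2] of_nat_0_less_iff zero_less_Suc)
      then have "Suc X0 \<le> X" unfolding X_def by (simp add: le_nat_floor)
      then have sub: "pbox X0 \<subseteq> pbox X" by (intro pbox_mono) simp
      have "eta_sum J L / L ^ r = (\<Sum>m\<in>pbox X. ?e m * q m L)"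
        unfolding eta_sum_def X_def[symmetric] q_def by (simp add: sum_divide_distrib)
      also have "\<dots> = (\<Sum>m\<in>pbox X - pbox X0. ?e m * q m L) + (\<Sum>m\<in>pbox X0. ?e m * q m L)"
        by (rule sum.subset_diff[OF sub]) simp
      finally have eq: "eta_sum J L / L ^ r =
        (\<Sum>m\<in>pbox X - pbox X0. ?e m * q m L) + (\<Sum>m\<in>pbox X0. ?e m * q m L)" .
      have "\<bar>\<Sum>m\<in>pbox X - pbox X0. ?e m * q m L\<bar> \<le> (\<Sum>m\<in>pbox X - pbox X0. norm (?e m) * Cq)"
      proof (intro order.trans[OF sum_abs] sum_mono)
        fix m assume m: "m \<in> pbox X - pbox X0"
        have "q m L \<le> (1 + real r / L) ^ r * vol J" using m elim by (intro q_up(1)) auto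
        also have "\<dots> \<le> (1 + real r) ^ r * vol J"
        proof (intro mult_right_mono power_mono add_left_mono)
          show "real r / L \<le> real r" using elim divide_left_mono[of 1 L "real r"] by simp
        qed (use elim vol in auto)
        also have "\<dots> \<le> Cq" using vol by (simp add: Cq_def)
        finally have "\<bar>q m L\<bar> \<le> Cq" using q_up(2)[of m X L] m elim by simp
        then show "\<bar>?e m * q m L\<bar> \<le> norm (?e m) * Cq" unfolding abs_mult by (intro mult_mono) auto
      qed
      also have "\<dots> = ((\<Sum>m\<in>pbox X. norm (?e m)) - (\<Sum>m\<in>pbox X0. norm (?e m))) * Cq"
        by (simp add: sum_distrib_right[symmetric] sum_diff[OF finite_pbox sub])
      also have "\<dots> \<le> \<delta> * Cq"
      proof -
        have "(\<Sum>m\<in>pbox X. norm (?e m)) \<le> E"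
          unfolding E_def by (intro finite_sum_le_infsum abs finite_pbox pbox_subset_posv) auto
        then show ?thesis using X0(1) Cq by (intro mult_right_mono) auto
      qed
      finally have 1: "\<bar>\<Sum>m\<in>pbox X - pbox X0. ?e m * q m L\<bar> \<le> \<delta> * Cq" .
      have "(\<Sum>m\<in>pbox X0. ?e m * vol J) - C_const (card N) * vol J =
        ((\<Sum>m\<in>pbox X0. ?e m) - C_const (card N)) * vol J"
        by (simp add: left_diff_distrib sum_distrib_right)
      then have 2: "\<bar>(\<Sum>m\<in>pbox X0. ?e m * vol J) - C_const (card N) * vol J\<bar> \<le> \<delta> * vol J"
        using X0(2) vol by (simp add: abs_mult mult_right_mono)
      have "\<delta> * (3 * Cq + 3 * vol J) = \<epsilon>" using den by (simp add: \<delta>_def)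
      then have "\<delta> * Cq + \<delta> * vol J = \<epsilon> / 3" by (simp add: algebra_simps)
      then show ?case unfolding eq dist_real_def using 1 2 elim(1) \<epsilon> by linarith
    qed
  qed
qed

text \<open>Inside the box all budgets are non-negative, so the sum for the empty list equals 1 and
  may be attached to 1/lcm; \<open>sum_mfun_steps\<close> then trades it for the sum over the whole
  list.\<close>

lemma eta_sum_eq:
  assumes J: "enum_ok J" and L: "0 \<le> L"
  shows "(\<Sum>m\<in>pbox (nat \<lfloor>exp L\<rfloor>). 1 / real (Lcm (m ` N))) = eta_sum J L"
proof -
  define X where "X = nat \<lfloor>exp L\<rfloor>"
  have X: "real X \<le> exp L" "exp L < real (Suc X)" unfolding X_def by (simp_all) linarith
  have lt: "L < ln (real (Suc X))" using X(2) by (subst exp_less_cancel_iff[symmetric]) simp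
  have "(\<Sum>m\<in>pbox X. 1 / real (Lcm (m ` N))) =
    (\<Sum>m\<in>pbox X. mfun lcm_local m * trunc_sum X [] (\<lambda>j. L - ln (real (m j))))"
  proof (intro sum.cong refl)
    fix m assume m: "m \<in> pbox X"
    have "ln (real (m j)) \<le> L" if "j \<in> N" for j
    proof -
      have "0 < m j" "m j \<le> X" using m that by (auto simp: pbox_def PiE_iff)
      then have "ln (real (m j)) \<le> ln (exp L)" using X(1) by (intro ln_mono) auto
      then show ?thesis by simp
    qed
    then show "1 / real (Lcm (m ` N)) = mfun lcm_local m * trunc_sum X [] (\<lambda>j. L - ln (real (m j)))"
      using mfun_lcm_local[OF subsetD[OF pbox_subset_posv m]] by simp
  qed
  also have "\<dots> = (\<Sum>m\<in>pbox X. mfun (steps J lcm_local) m * trunc_sum X J (\<lambda>j. L - ln (real (m j))))"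
    by (intro sum_mfun_steps[where l = "\<lambda>_. L"] unital_lcm_local lt enum_okD[OF J])
  also have "\<dots> = eta_sum J L"
    unfolding eta_sum_def X_def[symmetric] eta_def
  proof (intro sum.cong refl)
    fix m assume m: "m \<in> pbox X"
    have "iter sumop N J (\<lambda>j. L - ln (real (m j))) =
      ennreal (trunc_sum X J (\<lambda>j. L - ln (real (m j))))"
    proof (rule iter_sumop_eq_trunc_sum)
      show "L - ln (real (m j)) < ln (real (Suc X))" if "j \<in> N" for j using pbox_ln[OF m that] lt
        by linarith
    qed (rule enum_okD[OF J])
    then have "lat_sum J (\<lambda>j. L - ln (real (m j))) = trunc_sum X J (\<lambda>j. L - ln (real (m j)))"
      by (simp add: lat_sum_def trunc_sum_nonneg)
    then show "mfun (steps J lcm_local) m * trunc_sum X J (\<lambda>j. L - ln (real (m j))) =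
      mfun (steps J lcm_local) m * lat_sum J (\<lambda>j. L - ln (real (m j)))" by simp
  qed
  finally show ?thesis by (simp only: X_def)
qed

end

section \<open>The normalised integral\<close>

text \<open>Substitution \<open>y = exp t\<close>. Since \<open>F\<close> vanishes beyond
  \<open>R\<close>, it can be carried out on a compact interval.\<close>

lemma nn_integral_exp_substitution:
  fixes F :: "real \<Rightarrow> real"
  assumes [measurable]: "F \<in> borel_measurable borel" and F: "\<And>t. 0 \<le> F t" "\<And>t. R < t \<Longrightarrow>
    F t = 0" and R: "0 \<le> R"
  shows "(\<integral>\<^sup>+y. ennreal (1 / y * indicator {1..} y) * ennreal (F (ln y)) \<partial>lborel) =
    (\<integral>\<^sup>+t. ennreal (F t) * indicator {0..} t \<partial>lborel)"
proof -
  have "(\<integral>\<^sup>+y. ennreal (1 / y * indicator {1..} y) * ennreal (F (ln y)) \<partial>lborel) =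
    (\<integral>\<^sup>+y. ennreal (F (ln y) / y * indicator {exp 0..exp R} y) \<partial>lborel)"
  proof (intro nn_integral_cong)
    fix y :: real
    consider "y < 1" | "1 \<le> y" "y \<le> exp R" | "1 \<le> y" "exp R < y" by linarith
    then show "ennreal (1 / y * indicator {1..} y) * ennreal (F (ln y)) =
      ennreal (F (ln y) / y * indicator {exp 0..exp R} y)"
    proof cases
      case 3
      then have "R < ln y" by (subst exp_less_cancel_iff[symmetric]) simp
      then show ?thesis using F(2) by simp
    qed (use F(1) in \<open>auto simp: ennreal_mult[symmetric]\<close>)
  qed
  also have "\<dots> = (\<integral>\<^sup>+t. ennreal (F (ln (exp t)) / exp t * exp t * indicator {0..R} t) \<partial>lborel)"
  proof (rule nn_integral_substitution)
    show "set_borel_measurable borel {exp 0..exp R} (\<lambda>y. F (ln y) / y)"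
      unfolding set_borel_measurable_def by measurable
  qed (auto intro!: derivative_eq_intros continuous_intros R)
  also have "\<dots> = (\<integral>\<^sup>+t. ennreal (F t) * indicator {0..} t \<partial>lborel)"
    by (intro nn_integral_cong) (auto simp: indicator_def F(2) not_le)
  finally show ?thesis .
qed

context index_set
begin

text \<open>Integrand of the normalised integral, with the constraints in logarithmic form and
  \<open>s k\<close> as the support of the k-th exponent vector. The indicators are real factors, so
  that one coordinate can be split off at a time.\<close>

definition region_fun :: "(nat \<Rightarrow> nat set) \<Rightarrow> nat set \<Rightarrow> (nat \<Rightarrow> real) \<Rightarrow> (nat \<Rightarrow> real) \<Rightarrow> real" where
  "region_fun s K l y = (\<Prod>k\<in>K. 1 / y k * indicator {1..} (y k)) *
     (\<Prod>j\<in>N. indicator {..l j} (\<Sum>k\<in>K. if j \<in> s k then ln (y k) else 0))"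

lemma region_fun_nonneg: "0 \<le> region_fun s K l y"
proof -
  have "0 \<le> 1 / t * indicator {1..} t" for t :: real by (auto simp: indicator_def)
  then have "0 \<le> (\<Prod>k\<in>K. 1 / y k * indicator {1..} (y k))" by (intro prod_nonneg)
  moreover have "(0::real) \<le> (\<Prod>j\<in>N. indicator {..l j} (\<Sum>k\<in>K. if j \<in> s k then ln (y k) else 0))"
    by (intro prod_nonneg) auto
  ultimately show ?thesis unfolding region_fun_def by (rule mult_nonneg_nonneg)
qed

lemma region_fun_measurable:
  assumes "finite K"
  shows "region_fun s K l \<in> borel_measurable (Pi\<^sub>M K (\<lambda>_. lborel))"
proof -
  have [measurable]: "(\<lambda>y. y k) \<in> borel_measurable (Pi\<^sub>M K (\<lambda>_. lborel :: real measure))"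
    if "k \<in> K" for k
    using measurable_component_singleton[OF that, of "\<lambda>_. lborel :: real measure"] by simp
  have [measurable]: "(\<lambda>y. if j \<in> s k then ln (y k) else 0) \<in> borel_measurable (Pi\<^sub>M K (\<lambda>_. lborel :: real measure))"
    if "k \<in> K" for j k
    using that by (cases "j \<in> s k") simp_all
  have "(\<lambda>y. \<Sum>k\<in>K. if j \<in> s k then ln (y k) else 0) \<in> borel_measurable (Pi\<^sub>M K (\<lambda>_. lborel :: real measure))" for j
    by (intro borel_measurable_sum) measurable
  then have m2: "(\<lambda>y. indicator {..l j} (\<Sum>k\<in>K. if j \<in> s k then ln (y k) else 0) :: real) \<in> borel_measurable (Pi\<^sub>M K (\<lambda>_. lborel))" for j
    by (rule measurable_compose) measurable
  have m1: "(\<lambda>y. 1 / y k *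
    indicator {1..} (y k)) \<in> borel_measurable (Pi\<^sub>M K (\<lambda>_. lborel :: real measure))"
    if "k \<in> K" for k using that by measurable
  show ?thesis
    unfolding region_fun_def[abs_def]
    by (rule borel_measurable_times[OF borel_measurable_prod[OF m1] borel_measurable_prod[OF m2]])
qed

lemma region_fun_insert:
  assumes "finite K" "k \<notin> K"
  shows "region_fun s (insert k K) l (x(k := y)) =
    1 / y * indicator {1..} y * region_fun s K (shift l (s k) (ln y)) x"
proof -
  have "(\<Prod>i\<in>K. 1 / (x(k := y)) i * indicator {1..} ((x(k := y)) i)) =
    (\<Prod>i\<in>K. 1 / x i * indicator {1..} (x i))"
    using assms by (intro prod.cong refl) auto
  moreover have "indicator {..l j} (\<Sum>i\<in>insert k K. if j \<in> s i then ln ((x(k := y)) i) else 0) =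
     (indicator {..shift l (s k) (ln y) j} (\<Sum>i\<in>K. if j \<in> s i then ln (x i) else 0) :: real)" for j
  proof -
    have "(\<Sum>i\<in>K. if j \<in> s i then ln ((x(k := y)) i) else 0) =
      (\<Sum>i\<in>K. if j \<in> s i then ln (x i) else 0)"
      using assms by (intro sum.cong refl) auto
    then show ?thesis using assms by (auto simp: indicator_def shift_def)
  qed
  ultimately show ?thesis using assms by (simp add: region_fun_def)
qed

text \<open>One coordinate is split off by Tonelli, then \<open>y = exp t\<close> removes the weight
  1/y. Fixing the coordinate shifts the budgets by ln y, exactly as in \<open>iter\<close>. The real
  function \<open>F\<close> from \<open>iter_intop_pwpoly\<close> supplies finiteness of the inner
  integral.\<close>

lemma nn_integral_region_fun:
  assumes "distinct ks" "\<And>k. k \<in> set ks \<Longrightarrow> s k \<noteq> {} \<and> s k \<subseteq> N"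
  shows "(\<integral>\<^sup>+y. ennreal (region_fun s (set ks) l y) \<partial>Pi\<^sub>M (set ks) (\<lambda>_. lborel)) =
    iter intop N (map s ks) l"
  using assms
proof (induction ks arbitrary: l)
  case Nil
  interpret product_sigma_finite "\<lambda>_::nat. lborel :: real measure" by standard
  have "(\<integral>\<^sup>+y. ennreal (region_fun s {} l y) \<partial>Pi\<^sub>M {} (\<lambda>_. lborel)) =
    ennreal (region_fun s {} l (\<lambda>_. undefined))"
    by (rule nn_integral_empty) simp
  also have "\<dots> = iter intop N [] l"
  proof (cases "\<forall>j\<in>N. 0 \<le> l j")
    case False
    then obtain j where "j \<in> N" "\<not> 0 \<le> l j" by blast
    then have "(\<Prod>j\<in>N. indicator {..l j} 0 :: real) = 0"
      using finite_N by (intro prod_zero bexI[of _ j]) auto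
    then show ?thesis using False by (simp add: region_fun_def)
  qed (simp add: region_fun_def)
  finally show ?case by simp
next
  case (Cons k ks)
  interpret product_sigma_finite "\<lambda>_::nat. lborel :: real measure" by standard
  have s: "s k \<noteq> {}" "s k \<subseteq> N" using Cons.prems by auto
  then obtain j where j: "j \<in> s k" "j \<in> N" by auto
  obtain F where F: "pwpoly N F" "\<And>l. 0 \<le> F l" "\<And>l. iter intop N (map s ks) l = ennreal (F l)"
    using iter_intop_pwpoly[OF finite_N, of "map s ks"] Cons.prems by fastforce
  have "(\<integral>\<^sup>+y. ennreal (region_fun s (set (k # ks)) l y) \<partial>Pi\<^sub>M (set (k # ks)) (\<lambda>_. lborel)) =
    (\<integral>\<^sup>+y. (\<integral>\<^sup>+x. ennreal (region_fun s (insert k (set ks)) l (x(k := y))) \<partial>Pi\<^sub>M (set ks) (\<lambda>_. lborel)) \<partial>lborel)"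
    unfolding list.set using Cons.prems
    by (intro product_nn_integral_insert_rev measurable_compose[OF region_fun_measurable measurable_ennreal]) auto
  also have "\<dots> = (\<integral>\<^sup>+y. ennreal (1 / y * indicator {1..} y) *
    ennreal (F (shift l (s k) (ln y))) \<partial>lborel)"
  proof (intro nn_integral_cong)
    fix y :: real
    have y: "0 \<le> 1 / y * indicator {1..} y" by (auto simp: indicator_def)
    have "(\<integral>\<^sup>+x. ennreal (region_fun s (insert k (set ks)) l (x(k := y))) \<partial>Pi\<^sub>M (set ks) (\<lambda>_. lborel)) =
      (\<integral>\<^sup>+x. ennreal (1 / y * indicator {1..} y) *
        ennreal (region_fun s (set ks) (shift l (s k) (ln y)) x) \<partial>Pi\<^sub>M (set ks) (\<lambda>_. lborel))"
      using Cons.prems y region_fun_nonneg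
      by (intro nn_integral_cong) (subst region_fun_insert,
        auto simp: ennreal_mult simp del: times_divide_eq_left)
    also have "\<dots> = ennreal (1 / y * indicator {1..} y) *
      (\<integral>\<^sup>+x. ennreal (region_fun s (set ks) (shift l (s k) (ln y)) x) \<partial>Pi\<^sub>M (set ks) (\<lambda>_. lborel))"
      by (intro nn_integral_cmult measurable_compose[OF region_fun_measurable measurable_ennreal]) simp
    also have "(\<integral>\<^sup>+x. ennreal (region_fun s (set ks) (shift l (s k) (ln y)) x) \<partial>Pi\<^sub>M (set ks) (\<lambda>_. lborel)) =
      ennreal (F (shift l (s k) (ln y)))"
      unfolding F(3)[symmetric] using Cons.prems by (intro Cons.IH) auto
    finally show "(\<integral>\<^sup>+x. ennreal (region_fun s (insert k (set ks)) l (x(k := y))) \<partial>Pi\<^sub>M (set ks) (\<lambda>_. lborel)) =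
      ennreal (1 / y * indicator {1..} y) * ennreal (F (shift l (s k) (ln y)))" .
  qed
  also have "\<dots> = (\<integral>\<^sup>+t. ennreal (F (shift l (s k) t)) * indicator {0..} t \<partial>lborel)"
  proof (rule nn_integral_exp_substitution[where R = "max 0 (l j)"])
    have "(\<lambda>t. enn2real (iter intop N (map s ks) (shift l (s k) t))) \<in> borel_measurable borel"
      using measurable_iter[OF mono_hybrid] by measurable
    then show "(\<lambda>t. F (shift l (s k) t)) \<in> borel_measurable borel" by (simp add: F)
    fix t assume "max 0 (l j) < t"
    then have "iter intop N (map s ks) (shift l (s k) t) = 0"
      using j by (intro iter_eq_0[OF mono_hybrid j(2)]) (simp add: shift_def)
    then show "F (shift l (s k) t) = 0" using F(2)[of "shift l (s k) t"] by (simp add: F(3))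
  qed (use F in auto)
  also have "\<dots> = iter intop N (map s (k # ks)) l" unfolding list.map iter_intop_Cons F(3) ..
  finally show ?case .
qed

text \<open>The degree of the polynomial in \<open>eta_sum_approx\<close> is not known. As the error
  tends to 0, the polynomial grows like \<open>eta_sum\<close>, and the non-zero limit in
  \<open>eta_sum_lead\<close> forces both its degree and its leading coefficient.\<close>

lemma eta_sum_expansion:
  assumes J: "enum_ok J"
  shows "\<exists>Q \<mu> c K. degree Q = length J \<and> lead_coeff Q = C_const (card N) * vol J \<and> \<mu> > 0 \<and> c > 0 \<and>
    (\<forall>L\<ge>c. \<bar>eta_sum J L - poly Q L\<bar> \<le> K * exp (- \<mu> * L))"
proof -
  define r where "r = length J"
  define \<kappa> where "\<kappa> = C_const (card N) * vol J"
  have \<kappa>: "\<kappa> \<noteq> 0" using C_const_eq(3)[OF J] vol_pos[OF J] by (simp add: \<kappa>_def)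
  obtain c Q \<mu> K where c: "c > 0" and \<mu>: "\<mu> > 0" and K:
    "\<forall>L\<ge>c. \<bar>eta_sum J L - poly Q L\<bar> \<le> K * exp (- \<mu> * L)"
    using eta_sum_approx[OF J] by (elim exE conjE)
  have "((\<lambda>L. K * exp (- \<mu> * L)) \<longlongrightarrow> K * 0) at_top"
  proof (intro tendsto_intros)
    have "filterlim (\<lambda>L. \<mu> * L) at_top at_top"
      using \<mu> by (intro filterlim_tendsto_pos_mult_at_top[OF tendsto_const _ filterlim_ident])
    then show "((\<lambda>L. exp (- \<mu> * L)) \<longlongrightarrow> 0) at_top"
      by (intro filterlim_compose[OF exp_at_bot]) (simp add: filterlim_uminus_at_bot)
  qed
  then have lim0: "((\<lambda>L. K * exp (- \<mu> * L)) \<longlongrightarrow> 0) at_top" by simp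
  have "\<forall>\<^sub>F L in at_top. norm (eta_sum J L - poly Q L) \<le> K * exp (- \<mu> * L)"
    using eventually_ge_at_top[of c] by eventually_elim (use K in simp)
  then have "((\<lambda>L. eta_sum J L - poly Q L) \<longlongrightarrow> 0) at_top"
    by (rule Lim_null_comparison[OF _ lim0])
  then have "((\<lambda>L. (eta_sum J L - poly Q L) / L ^ r) \<longlongrightarrow> 0) at_top"
  proof (rule Lim_null_comparison[rotated, OF tendsto_rabs_zero])
    show "\<forall>\<^sub>F L in at_top. norm ((eta_sum J L - poly Q L) / L ^ r) \<le> \<bar>eta_sum J L - poly Q L\<bar>"
      using eventually_ge_at_top[of 1]
    proof eventually_elim
      case (elim L)
      then have "1 \<le> L ^ r" by simp
      then show ?case using divide_left_mono[of 1 "L ^ r" "\<bar>eta_sum J L - poly Q L\<bar>"] by simp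
    qed
  qed
  from tendsto_diff[OF eta_sum_lead[OF J] this]
  have limQ: "((\<lambda>L. poly Q L / L ^ r) \<longlongrightarrow> \<kappa>) at_top"
    by (simp add: r_def \<kappa>_def diff_divide_distrib)
  have limD: "((\<lambda>L. poly Q L / L ^ degree Q) \<longlongrightarrow> lead_coeff Q) at_top"
    using poly_divide_tendsto_aux[of Q] by (rule tendsto_mono[rotated]) (rule at_top_le_at_infinity)
  have inv0: "((\<lambda>L::real. 1 / L ^ k) \<longlongrightarrow> 0) at_top" if "k > 0" for k
    using that by (intro real_tendsto_divide_at_top[OF tendsto_const] filterlim_pow_at_top filterlim_ident)
  have "Q \<noteq> 0"
  proof
    assume "Q = 0"
    then have "((\<lambda>L::real. 0::real) \<longlongrightarrow> \<kappa>) at_top" using limQ by simp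
    then show False using \<kappa> tendsto_unique[OF trivial_limit_at_top_linorder tendsto_const] by blast
  qed
  then have lc: "lead_coeff Q \<noteq> 0" by simp
  have deg: "degree Q = r"
  proof (rule linorder_cases[of "degree Q" r])
    assume less: "degree Q < r"
    have "((\<lambda>L. poly Q L / L ^ degree Q * (1 / L ^ (r - degree Q))) \<longlongrightarrow> lead_coeff Q * 0) at_top"
      using less by (intro tendsto_mult limD inv0) simp
    moreover have "L ^ degree Q * L ^ (r - degree Q) = L ^ r" for L :: real
      using less by (simp add: power_add[symmetric])
    ultimately have "((\<lambda>L. poly Q L / L ^ r) \<longlongrightarrow> 0) at_top" by simp
    then show ?thesis using tendsto_unique[OF trivial_limit_at_top_linorder limQ] \<kappa> by blast
  next
    assume less: "r < degree Q"
    have "((\<lambda>L. poly Q L / L ^ r * (1 / L ^ (degree Q - r))) \<longlongrightarrow> \<kappa> * 0) at_top"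
      using less by (intro tendsto_mult limQ inv0) simp
    moreover have "L ^ r * L ^ (degree Q - r) = L ^ degree Q" for L :: real
      using less by (simp add: power_add[symmetric])
    ultimately have "((\<lambda>L. poly Q L / L ^ degree Q) \<longlongrightarrow> 0) at_top" by simp
    then show ?thesis using tendsto_unique[OF trivial_limit_at_top_linorder limD] lc by blast
  qed
  have "lead_coeff Q = \<kappa>" using tendsto_unique[OF trivial_limit_at_top_linorder limD] limQ deg
    by simp
  then show ?thesis using deg \<mu> c K unfolding r_def \<kappa>_def by blast
qed

end

section \<open>The lcm sum and the integral for the index set {1..n}\<close>

context
  notes One_nat_def [simp del]
begin

lemma index_set_interval: "1 \<le> n \<Longrightarrow> index_set {1..n}"
  by unfold_locales auto

lemma lcm_sum_eq_eta_sum: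
  assumes n: "1 \<le> n" and J: "index_set.enum_ok {1..n} J" and x: "1 \<le> x"
  shows "lcm_sum n x = index_set.eta_sum {1..n} J (ln x)"
proof -
  interpret index_set "{1..n}" using n by (rule index_set_interval)
  have "{k::nat. 1 \<le> k \<and> real k \<le> x} = {1..nat \<lfloor>x\<rfloor>}" using x by (auto simp: le_nat_iff le_floor_iff)
  then have "lcm_sum n x = (\<Sum>m\<in>pbox (nat \<lfloor>x\<rfloor>). 1 / real (Lcm (m ` {1..n})))"
    by (simp add: lcm_sum_def pbox_def)
  then show ?thesis using eta_sum_eq[OF J, of "ln x"] x by simp
qed

text \<open>For the second claim, all terms of the polynomial below the leading one are at most
  multiples of \<open>ln x ^ (2 ^ n - 2)\<close> once \<open>ln x \<ge> 1\<close>, and the power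
  saving is smaller still.\<close>

lemma lcm_sum_expansion:
  assumes n: "1 \<le> n" and J: "index_set.enum_ok {1..n} J"
  defines "\<kappa> \<equiv> C_const n * index_set.vol {1..n} J"
  shows "\<exists>Q \<mu>. degree Q = 2 ^ n - 1 \<and> lead_coeff Q = \<kappa> \<and> \<mu> > 0 \<and>
    (\<lambda>x. lcm_sum n x - poly Q (ln x)) \<in> O[at_top](\<lambda>x. x powr (- \<mu>))"
    and "(\<lambda>x. lcm_sum n x - \<kappa> * ln x ^ (2 ^ n - 1)) \<in> O[at_top](\<lambda>x. ln x ^ (2 ^ n - 2))"
proof -
  interpret index_set "{1..n}" using n by (rule index_set_interval)
  obtain Q \<mu> c K where Q: "degree Q = length J" "lead_coeff Q = \<kappa>" and \<mu>: "\<mu> > 0" and c: "c > 0"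
    and K: "\<forall>L\<ge>c. \<bar>eta_sum J L - poly Q L\<bar> \<le> K * exp (- \<mu> * L)"
    using eta_sum_expansion[OF J] unfolding \<kappa>_def by auto
  have r: "length J = 2 ^ n - 1" using enum_ok_length[OF J] by simp
  have "\<forall>\<^sub>F x in at_top. norm (lcm_sum n x - poly Q (ln x)) \<le> K * norm (x powr (- \<mu>))"
    using eventually_ge_at_top[of "max 1 (exp c)"]
  proof eventually_elim
    case (elim x)
    then have "ln (exp c) \<le> ln x" by (intro ln_mono) auto
    then have "\<bar>eta_sum J (ln x) - poly Q (ln x)\<bar> \<le> K * exp (- \<mu> * ln x)" using K by simp
    then show ?case using elim lcm_sum_eq_eta_sum[OF n J, of x] by (simp add: powr_def)
  qed
  then have O1: "(\<lambda>x. lcm_sum n x - poly Q (ln x)) \<in> O[at_top](\<lambda>x. x powr (- \<mu>))" by (rule bigoI)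
  then show "\<exists>Q \<mu>. degree Q = 2 ^ n - 1 \<and> lead_coeff Q = \<kappa> \<and> \<mu> > 0 \<and>
    (\<lambda>x. lcm_sum n x - poly Q (ln x)) \<in> O[at_top](\<lambda>x. x powr (- \<mu>))"
    using Q \<mu> r by metis
  define e where "e = (2::nat) ^ n - 2"
  \<comment> \<open>Hence neither natural subtraction is truncated, not even for
    \<open>n = 1\<close>, where \<open>e = 0\<close>.\<close>
  have "(2::nat) ^ 1 \<le> 2 ^ n" using n by (intro power_increasing) auto
  then have re: "2 ^ n - 1 = Suc e" by (simp add: e_def)
  have polyQ: "poly Q L - \<kappa> * L ^ Suc e = (\<Sum>i\<le>e. coeff Q i * L ^ i)" for L
    using Q r re by (simp add: poly_altdef)
  have ev1: "\<forall>\<^sub>F x in at_top. 1 \<le> ln (x::real)"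
    using eventually_ge_at_top[of "exp 1"]
  proof eventually_elim
    case (elim x)
    then show ?case by (subst ln_ge_iff) (auto intro: less_le_trans[OF exp_gt_zero])
  qed
  have O2: "(\<lambda>x. poly Q (ln x) - \<kappa> * ln x ^ Suc e) \<in> O[at_top](\<lambda>x. ln x ^ e)"
  proof (rule bigoI)
    show "\<forall>\<^sub>F x in at_top. norm (poly Q (ln x) - \<kappa> * ln x ^ Suc e) \<le>
      (\<Sum>i\<le>e. \<bar>coeff Q i\<bar>) * norm (ln x ^ e)"
      using ev1
    proof eventually_elim
      case (elim x)
      show ?case unfolding polyQ sum_distrib_right real_norm_def
      proof (intro order.trans[OF sum_abs] sum_mono)
        fix i assume "i \<in> {..e}"
        then have "ln x ^ i \<le> ln x ^ e" using elim by (intro power_increasing) auto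
        then show "\<bar>coeff Q i * ln x ^ i\<bar> \<le> \<bar>coeff Q i\<bar> * \<bar>ln x ^ e\<bar>"
          using elim by (simp add: abs_mult mult_left_mono)
      qed
    qed
  qed
  have O3: "(\<lambda>x. x powr (- \<mu>)) \<in> O[at_top](\<lambda>x. ln x ^ e)"
  proof (rule bigoI[where c = 1])
    show "\<forall>\<^sub>F x in at_top. norm (x powr - \<mu>) \<le> 1 * norm (ln x ^ e)"
      using ev1 eventually_ge_at_top[of 1]
    proof eventually_elim
      case (elim x)
      have "x powr - \<mu> \<le> x powr 0" using elim \<mu> by (intro powr_mono) auto
      also have "\<dots> \<le> 1" by simp
      also have "1 \<le> ln x ^ e" using elim by (intro one_le_power) auto
      finally show ?case by simp
    qed
  qed
  have "(\<lambda>x. (lcm_sum n x - poly Q (ln x)) + (poly Q (ln x) - \<kappa> *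
    ln x ^ Suc e)) \<in> O[at_top](\<lambda>x. ln x ^ e)"
    by (intro sum_in_bigo landau_o.big_trans[OF O1 O3] O2)
  then show "(\<lambda>x. lcm_sum n x - \<kappa> * ln x ^ (2 ^ n - 1)) \<in> O[at_top](\<lambda>x. ln x ^ (2 ^ n - 2))"
    unfolding re e_def[symmetric] by simp
qed

text \<open>The supports are listed in the order of the integration variables, so each enumeration
  \<open>\<nu>\<close> gets its own list.\<close>

definition bin_supports :: "nat \<Rightarrow> (nat \<Rightarrow> nat \<Rightarrow> nat) \<Rightarrow> nat set list" where
  "bin_supports n \<nu> = map (\<lambda>k. {j \<in> {1..n}. \<nu> k j = 1}) [1..<Suc (card (bin_vecs n))]"

lemma bij_betw_bin_support:
  "bij_betw (\<lambda>v. {j \<in> {1..n}. v j = (1::nat)}) (bin_vecs n) (Pow {1..n} - {{}})"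
proof (rule bij_betw_byWitness[where f' = "\<lambda>s. \<lambda>j\<in>{1..n}. if j \<in> s then 1 else 0"])
  show "\<forall>v\<in>bin_vecs n. (\<lambda>j\<in>{1..n}. if j \<in> {j \<in> {1..n}. v j = (1::nat)} then 1 else 0) = v"
    by (auto simp: bin_vecs_def PiE_iff extensional_def fun_eq_iff)
  show "\<forall>s\<in>Pow {1..n} - {{}}. {j \<in> {1..n}. (\<lambda>j\<in>{1..n}. if j \<in> s then 1 else 0) j = (1::nat)} = s"
    by auto
  show "(\<lambda>v. {j \<in> {1..n}. v j = (1::nat)}) ` bin_vecs n \<subseteq> Pow {1..n} - {{}}"
  proof (intro image_subsetI)
    fix v assume v: "v \<in> bin_vecs n"
    have "\<exists>j\<in>{1..n}. v j = 1"
    proof (rule ccontr)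
      assume "\<not> (\<exists>j\<in>{1..n}. v j = 1)"
      then have "v = zero_vec n"
        using v by (auto simp: bin_vecs_def zero_vec_def PiE_iff extensional_def fun_eq_iff)
      then show False using v by (simp add: bin_vecs_def)
    qed
    then show "{j \<in> {1..n}. v j = (1::nat)} \<in> Pow {1..n} - {{}}" by auto
  qed
  show "(\<lambda>s. \<lambda>j\<in>{1..n}. if j \<in> s then 1 else 0) ` (Pow {1..n} - {{}}) \<subseteq> bin_vecs n"
  proof (intro image_subsetI)
    fix s assume s: "s \<in> Pow {1..n} - {{}}"
    then obtain j where j: "j \<in> s" "j \<in> {1..n}" by blast
    have "(\<lambda>j\<in>{1..n}. if j \<in> s then 1 else (0::nat)) \<noteq> zero_vec n"
    proof
      assume "(\<lambda>j\<in>{1..n}. if j \<in> s then 1 else (0::nat)) = zero_vec n"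
      from fun_cong[OF this, of j] show False using j by (simp add: zero_vec_def)
    qed
    then show "(\<lambda>j\<in>{1..n}. if j \<in> s then 1 else 0) \<in> bin_vecs n" by (auto simp: bin_vecs_def)
  qed
qed

lemma bin_supports_enum_ok:
  assumes n: "1 \<le> n" and \<nu>: "bij_betw \<nu> {1..card (bin_vecs n)} (bin_vecs n)"
  shows "index_set.enum_ok {1..n} (bin_supports n \<nu>)"
proof -
  interpret index_set "{1..n}" using n by (rule index_set_interval)
  have bij: "bij_betw (\<lambda>k. {j \<in> {1..n}. \<nu> k j = 1}) {1..card (bin_vecs n)} (Pow {1..n} - {{}})"
    using bij_betw_trans[OF \<nu> bij_betw_bin_support] by (simp add: o_def)
  have set: "set [1..<Suc (card (bin_vecs n))] = {1..card (bin_vecs n)}" by auto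
  show ?thesis
    using bij unfolding enum_ok_def bin_supports_def bij_betw_def distinct_map set_map set by simp
qed

text \<open>With all multiplicities 1 every block is a single index, and with the zero vector as
  \<open>c\<close> every exponent in the denominator is 1. Taking logarithms of the constraints
  leaves \<open>region_fun\<close>.\<close>

lemma region_integral_eq:
  assumes n: "1 \<le> n" and \<nu>: "bij_betw \<nu> {1..card (bin_vecs n)} (bin_vecs n)" and x: "0 < x"
  shows "region_integral n (bin_vecs n) \<nu> (\<lambda>_. 1) (zero_vec n) x =
    enn2real (iter intop {1..n} (bin_supports n \<nu>) (\<lambda>_. ln x))"
proof -
  interpret index_set "{1..n}" using n by (rule index_set_interval)
  define r where "r = card (bin_vecs n)"
  define s where "s = (\<lambda>k. {j \<in> {1..n}. \<nu> k j = 1})"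
  define M where "M = (Pi\<^sub>M {1..r} (\<lambda>_. lborel) :: (nat \<Rightarrow> real) measure)"
  have be: "block_end \<nu> (\<lambda>_. 1) k = k" for k by (simp add: block_end_def)
  have blk: "{block_end \<nu> (\<lambda>_. 1) (k - 1) + 1..block_end \<nu> (\<lambda>_. 1) k} = {k}" if "k \<in> {1..r}" for k
    using that by (auto simp: be)
  have bin: "\<nu> k j = (if j \<in> s k then 1 else 0)" if "k \<in> {1..r}" "j \<in> {1..n}" for k j
  proof -
    have "\<nu> k \<in> bin_vecs n" using \<nu> that by (auto simp: bij_betw_def r_def)
    then have "\<nu> k j \<in> {0, 1}" using that by (auto simp: bin_vecs_def)
    then show ?thesis using that by (auto simp: s_def)
  qed
  \<comment> \<open>The identity is claimed on the space of \<open>M\<close> only: membership in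
    \<open>int_region\<close> includes extensionality, which points of the product space
    have.\<close>
  have eq: "indicator (int_region n (bin_vecs n) \<nu> (\<lambda>_. 1) x) y *
      (1 / (\<Prod>k=1..r. \<Prod>l\<in>{block_end \<nu> (\<lambda>_. 1) (k - 1) + 1..block_end \<nu> (\<lambda>_. 1) k}.
             y l powr (1 - inner_vec n (\<lambda>j. real (\<nu> k j)) (zero_vec n)))) =
               region_fun s {1..r} (\<lambda>_. ln x) y"
    if y: "y \<in> space M" for y
  proof (cases "\<forall>k\<in>{1..r}. 1 \<le> y k")
    case False
    then obtain k where k: "k \<in> {1..r}" "\<not> 1 \<le> y k" by blast
    then have "(\<Prod>k\<in>{1..r}. 1 / y k * indicator {1..} (y k)) = 0"
      by (intro prod_zero bexI[of _ k]) auto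
    then have "region_fun s {1..r} (\<lambda>_. ln x) y = 0" by (simp add: region_fun_def)
    moreover have "y \<notin> int_region n (bin_vecs n) \<nu> (\<lambda>_. 1) x"
      using k by (auto simp: int_region_def be r_def[symmetric] PiE_iff)
    ultimately show ?thesis by simp
  next
    case True
    have inner: "inner_vec n (\<lambda>j. real (\<nu> k j)) (zero_vec n) = 0" for k
      by (simp add: inner_vec_def zero_vec_def)
    have "(\<Prod>k=1..r. \<Prod>l\<in>{block_end \<nu> (\<lambda>_. 1) (k - 1) + 1..block_end \<nu> (\<lambda>_. 1) k}.
             y l powr (1 - inner_vec n (\<lambda>j. real (\<nu> k j)) (zero_vec n))) = (\<Prod>k=1..r. y k)"
      unfolding inner
    proof (intro prod.cong refl)
      fix k assume k: "k \<in> {1..r}"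
      then have "0 \<le> y k" using True by fastforce
      then show "(\<Prod>l\<in>{block_end \<nu> (\<lambda>_. 1) (k - 1) + 1..block_end \<nu> (\<lambda>_. 1) k}. y l powr (1 - 0)) =
        y k"
        unfolding blk[OF k] by simp
    qed
    moreover have "(\<Prod>k\<in>{1..r}. 1 / y k * indicator {1..} (y k)) = 1 / (\<Prod>k=1..r. y k)"
      using True by (simp add: prod_dividef[of "\<lambda>_. 1", simplified, symmetric])
    moreover have "indicator (int_region n (bin_vecs n) \<nu> (\<lambda>_. 1) x) y =
      (\<Prod>j\<in>{1..n}. indicator {..ln x} (\<Sum>k\<in>{1..r}. if j \<in> s k then ln (y k) else 0) :: real)"
    proof -
      have ln_eq: "(\<Prod>k=1..r. \<Prod>l\<in>{block_end \<nu> (\<lambda>_. 1) (k - 1) +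
        1..block_end \<nu> (\<lambda>_. 1) k}. y l ^ \<nu> k j) \<le> x \<longleftrightarrow>
          (\<Sum>k\<in>{1..r}. if j \<in> s k then ln (y k) else 0) \<le> ln x" if j: "j \<in> {1..n}" for j
      proof -
        have "(\<Prod>k=1..r. \<Prod>l\<in>{block_end \<nu> (\<lambda>_. 1) (k - 1) + 1..block_end \<nu> (\<lambda>_. 1) k}. y l ^ \<nu> k j) =
            (\<Prod>k=1..r. exp (if j \<in> s k then ln (y k) else 0))"
        proof (intro prod.cong refl)
          fix k assume k: "k \<in> {1..r}"
          then have "0 < y k" using True by fastforce
          then show "(\<Prod>l\<in>{block_end \<nu> (\<lambda>_. 1) (k - 1) + 1..block_end \<nu> (\<lambda>_. 1) k}. y l ^ \<nu> k j) =
            exp (if j \<in> s k then ln (y k) else 0)"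
            unfolding blk[OF k] using bin[OF k j] by simp
        qed
        also have "\<dots> = exp (\<Sum>k\<in>{1..r}. if j \<in> s k then ln (y k) else 0)"
          by (simp only: exp_sum finite_atLeastAtMost)
        also have "\<dots> \<le> x \<longleftrightarrow> (\<Sum>k\<in>{1..r}. if j \<in> s k then ln (y k) else 0) \<le> ln x"
          using x by (simp only: ln_ge_iff)
        finally show ?thesis .
      qed
      have "y \<in> {1..r} \<rightarrow>\<^sub>E {1..}" using y True by (auto simp: M_def space_PiM PiE_iff)
      then have iff: "y \<in> int_region n (bin_vecs n) \<nu> (\<lambda>_. 1) x \<longleftrightarrow>
         (\<forall>j\<in>{1..n}. (\<Sum>k\<in>{1..r}. if j \<in> s k then ln (y k) else 0) \<le> ln x)"
        using ln_eq unfolding int_region_def be r_def[symmetric] by auto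
      show ?thesis
      proof (cases "y \<in> int_region n (bin_vecs n) \<nu> (\<lambda>_. 1) x")
        case True
        then show ?thesis using iff by (auto simp: indicator_def intro!: prod.neutral[symmetric])
      next
        case False
        then obtain j where "j \<in> {1..n}" "\<not> (\<Sum>k\<in>{1..r}. if j \<in> s k then ln (y k) else 0) \<le> ln x"
          using iff by blast
        then have "(\<Prod>j\<in>{1..n}. indicator {..ln x} (\<Sum>k\<in>{1..r}. if j \<in> s k then ln (y k) else 0) :: real) = 0"
          by (intro prod_zero bexI[of _ j]) auto
        then show ?thesis using False by simp
      qed
    qed
    ultimately show ?thesis by (simp add: region_fun_def)
  qed
  have "region_integral n (bin_vecs n) \<nu> (\<lambda>_. 1) (zero_vec n) x =
    integral\<^sup>L M (region_fun s {1..r} (\<lambda>_. ln x))"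
    unfolding region_integral_def set_lebesgue_integral_def be r_def[symmetric] M_def[symmetric]
    using eq unfolding be r_def[symmetric] by (intro Bochner_Integration.integral_cong refl) simp
  also have "\<dots> = enn2real (\<integral>\<^sup>+y. ennreal (region_fun s {1..r} (\<lambda>_. ln x) y) \<partial>M)"
    unfolding M_def by (intro integral_eq_nn_integral region_fun_measurable) (auto simp: region_fun_nonneg)
  also have "(\<integral>\<^sup>+y. ennreal (region_fun s {1..r} (\<lambda>_. ln x) y) \<partial>M) =
    iter intop {1..n} (bin_supports n \<nu>) (\<lambda>_. ln x)"
  proof -
    have set: "set [1..<Suc r] = {1..r}" by auto
    have J: "bin_supports n \<nu> = map s [1..<Suc r]" by (simp only: bin_supports_def s_def r_def)
    have "s k \<noteq> {} \<and> s k \<subseteq> {1..n}" if "k \<in> set [1..<Suc r]" for k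
      using enum_okD[OF bin_supports_enum_ok[OF n \<nu>], of "s k"] that unfolding J by auto
    then have "(\<integral>\<^sup>+y. ennreal (region_fun s (set [1..<Suc r]) (\<lambda>_. ln x) y) \<partial>Pi\<^sub>M (set [1..<Suc r]) (\<lambda>_. lborel)) =
      iter intop {1..n} (map s [1..<Suc r]) (\<lambda>_. ln x)"
      by (intro nn_integral_region_fun) auto
    then show ?thesis unfolding set J[symmetric] M_def .
  qed
  finally show ?thesis .
qed

text \<open>By homogeneity the integral is exactly the volume times a power of ln x, so the ratio is
  constant for \<open>x > 1\<close> and its limit is immediate.\<close>

lemma K_ratio_eq:
  assumes n: "1 \<le> n" and \<nu>: "bij_betw \<nu> {1..card (bin_vecs n)} (bin_vecs n)" and x: "1 < x"
  shows "K_ratio n \<nu> x = index_set.vol {1..n} (bin_supports n \<nu>)"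
proof -
  interpret index_set "{1..n}" using n by (rule index_set_interval)
  let ?J = "bin_supports n \<nu>"
  have J: "enum_ok ?J" using n \<nu> by (rule bin_supports_enum_ok)
  have lnx: "0 < ln x" using x by simp
  have r: "length ?J = 2 ^ n - 1" using enum_ok_length[OF J] by simp
  have "(1::nat) \<le> 2 ^ n" by simp
  then have ex: "- (2 ^ n) + 1 = - int (length ?J)" unfolding r by (simp add: of_nat_diff)
  have "region_integral n (bin_vecs n) \<nu> (\<lambda>_. 1) (zero_vec n) x = ln x ^ length ?J * vol ?J"
    using region_integral_eq[OF n \<nu>, of x] iter_intop_const[OF J lnx] vol_pos[OF J] lnx x by simp
  then show ?thesis unfolding K_ratio_def ex using lnx by (simp add: power_int_minus)
qed

end

theorem corollary2:
  fixes n :: nat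
  assumes "n \<ge> 1"
  shows "(\<exists>(Q :: real poly) (\<mu> :: real). degree Q = 2 ^ n - 1 \<and> \<mu> > 0 \<and>
            (\<lambda>x. lcm_sum n x - poly Q (ln x)) \<in> O[at_top](\<lambda>x. x powr (- \<mu>)))
       \<and> (\<forall>p. prime p \<longrightarrow> summable (euler_term n p))
       \<and> convergent_prod (euler_factor n)
       \<and> C_const n > 0
       \<and> (\<forall>\<nu>. bij_betw \<nu> {1..card (bin_vecs n)} (bin_vecs n) \<longrightarrow>
            (K_ratio n \<nu> \<longlongrightarrow> K_const n \<nu>) at_top
          \<and> K_const n \<nu> > 0
          \<and> (\<lambda>x. lcm_sum n x - C_const n * K_const n \<nu> * ln x ^ (2 ^ n - 1))
               \<in> O[at_top](\<lambda>x. ln x ^ (2 ^ n - 2)))"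
proof -
  interpret index_set "{1..n}" using assms by (rule index_set_interval)
  obtain J where "distinct J" "set J = Pow {1..n} - {{}}"
    using finite_distinct_list[of "Pow {1..n} - {{}}"] by auto
  then have J: "enum_ok J" unfolding enum_ok_def by (rule conjI)
  have "(K_ratio n \<nu> \<longlongrightarrow> K_const n \<nu>) at_top \<and> K_const n \<nu> > 0 \<and>
      (\<lambda>x. lcm_sum n x - C_const n * K_const n \<nu> *
        ln x ^ (2 ^ n - 1)) \<in> O[at_top](\<lambda>x. ln x ^ (2 ^ n - 2))"
    if \<nu>: "bij_betw \<nu> {1..card (bin_vecs n)} (bin_vecs n)" for \<nu>
  proof -
    \<comment> \<open>The list induced by \<open>\<nu>\<close> takes the place of the arbitrary
      \<open>J\<close>: its volume is the limit for this \<open>\<nu>\<close>, while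
      \<open>C_const n\<close> is the same for every list.\<close>
    let ?J = "bin_supports n \<nu>"
    have J': "enum_ok ?J" using assms \<nu> by (rule bin_supports_enum_ok)
    have lim: "(K_ratio n \<nu> \<longlongrightarrow> vol ?J) at_top"
      using K_ratio_eq[OF assms \<nu>]
      by (intro tendsto_eventually eventually_mono[OF eventually_gt_at_top[of 1]]) simp
    then have K: "K_const n \<nu> = vol ?J"
      unfolding K_const_def by (intro tendsto_Lim trivial_limit_at_top_linorder)
    show ?thesis
      using lim vol_pos[OF J'] lcm_sum_expansion(2)[OF assms J'] unfolding K by blast
  qed
  then show ?thesis
    using lcm_sum_expansion(1)[OF assms J] infsum_eta_local(3)[OF J] C_const_eq(1,3)[OF J] by auto
qed

end
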